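(* Let $A$ be a quasi-sectorial operator on a separable Hilbert space $H$, $r,s\ge0$ with $r+s<1$, $B\in L(U,H_{-r})$, $C\in L(H_s^{( * )},Y)$ with Hilbert spaces $U,Y$, and suppose that the Hamiltonian $T_0$ satisfies $i\mathbb{R}\subset\varrho(T_0)$. Let $V_{0\pm}$ be the spectral subspaces of $T_0$ for $\mathbb{C}_\pm$. If \[\bigcap_{\lambda\in i\mathbb{R}\cap\varrho(A^* )}\ker B^*(A^*-\lambda)^{-1}=\{0\}\quad\text{on } H^{( * )}_{-s},\tag{1}\] then $V_{0\pm}=\mathcal{R}\begin{pmatrix}I\\ X_{0\pm}\end{pmatrix}$ with closed operators $X_{0\pm}:\mathcal{D}(X_{0\pm})\subset H_{-r}\to H^{( * )}_{-s}$. If \[\bigcap_{\lambda\in i\mathbb{R}\cap\varrho(A)}\ker C(A-\lambda)^{-1}=\{0\}\quad\text{on } H_{-r},\tag{2}\] then $V_{0\pm}=\mathcal{R}\begin{pmatrix}Y_{0\pm}\\ I\end{pmatrix}$ with closed operators $Y_{0\pm}:\mathcal{D}(Y_{0\pm})\subset H^{( * )}_{-s}\to H_{-r}$. If both (1) and (2) hold, then $X_{0\pm}$ are injective and $X_{0\pm}^{-1}=Y_{0\pm}$.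
   Context: Notation: $\mathcal{D},\mathcal{R},\varrho,\sigma$ denote domain, range, resolvent set, spectrum; $L(V,W)$ is the space of bounded operators; $\mathbb{C}_\pm$ are the open right/left half-planes. Sectorial operators: for $\theta\ge0$ put $\Sigma_{\frac\pi2+\theta}=\{\lambda\in\mathbb{C}\setminus\{0\}:\arg\lambda\in[-\frac\pi2-\theta,\frac\pi2+\theta]\}$. An operator $S$ on a Banach space is sectorial if for some $\theta\ge0$, $M>0$ one has $\Sigma_{\frac\pi2+\theta}\subset\varrho(S)$ and $\|(S-\lambda)^{-1}\|\le M/|\lambda|$ on $\Sigma_{\frac\pi2+\theta}$; it is quasi-sectorial if $S-\mu$ is sectorial for some $\mu\in\mathbb{R}$. (Quasi-sectorial operators on Hilbert spaces are closed and densely defined.) Scales: let $A$ be closed and densely defined on the separable Hilbert space $H$ (inner product $(\cdot|\cdot)$, norm $\|\cdot\|$). Put $\Lambda=(I+AA^* )^{1/2}$, $\Lambda_*=(I+A^*A)^{1/2}$. For $\tau>0$: $H_\tau=\mathcal{D}(\Lambda^\tau)$ with norm $\|\Lambda^\tau x\|$, $H_{-\tau}$ is the completion of $H$ in the norm $\|\Lambda^{-\tau}x\|$; $H_0=H$. $H_{\pm\tau}^{( * )}$ are defined likewise with $\Lambda_*$. The inner product extends by continuity to bounded sesquilinear forms $(\cdot|\cdot)_{\tau,-\tau}$ on $H_\tau\times H_{-\tau}$ and $(\cdot|\cdot)^{( * )}_{\tau,-\tau}$ on $H^{( * )}_\tau\times H^{( * )}_{-\tau}$. For each $\tau\in[0,1]$,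 $A$ and $A^*$ act (by extension/restriction by continuity) as bounded operators $A:H^{( * )}_{1-\tau}\to H_{-\tau}$, $A^*:H_{1-\tau}\to H^{( * )}_{-\tau}$, and $A-\lambda$, $A^*-\bar\lambda$ are isomorphisms between these spaces for $\lambda\in\varrho(A)$; the resolvents in (1), (2) are the inverses $(A^*-\lambda)^{-1}:H^{( * )}_{-s}\to H_{1-s}\subset H_r$ and $(A-\lambda)^{-1}:H_{-r}\to H^{( * )}_{1-r}\subset H^{( * )}_s$. $\varrho(A),\varrho(A^* )$ refer to $A,A^*$ as operators on $H$. Hamiltonian: adjoints $B^*\in L(H_r,U)$, $C^*\in L(Y,H^{( * )}_{-s})$ are defined by $(x|Bu)_{r,-r}=(B^*x|u)_U$ and $(Cx|y)_Y=(x|C^*y)^{( * )}_{s,-s}$. The Hamiltonian is $T_0=\begin{pmatrix}A&-BB^*\\ -C^*C&-A^*\end{pmatrix}$, an unbounded operator on $V_0=H_{-r}\times H^{( * )}_{-s}$ with domain $\mathcal{D}(T_0)=H^{( * )}_{1-r}\times H_{1-s}$. Spectral subspaces: under the assumptions ($A$ quasi-sectorial, $r+s<1$, $i\mathbb{R}\subset\varrho(T_0)$) $T_0$ is strictly dichotomous, i.e. there are (uniquely determined) closed $T_0$-invariant subspaces $V_{0\pm}$ with $V_0=V_{0+}\oplus V_{0-}$, $\sigma(T_0|_{V_{0\pm}})\subset\mathbb{C}_\pm$ and $\|(T_0|_{V_{0\pm}}-\lambda)^{-1}\|$ bounded on $\mathbb{C}_\mp$. Explicitly $V_{0\pm}=\ker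 L_{0\mp}$ with $L_{0\pm}=\frac{\pm1}{2\pi i}\int_{\pm h-i\infty}^{\pm h+i\infty}\frac1\lambda(T_0-\lambda)^{-1}\,d\lambda$, where $h>0$ is such that $\{|\operatorname{Re}\lambda|\le h\}\subset\varrho(T_0)$. Graphs: $\mathcal{R}\begin{pmatrix}I\\ X\end{pmatrix}=\{(x,Xx):x\in\mathcal{D}(X)\}$ and $\mathcal{R}\begin{pmatrix}Y\\ I\end{pmatrix}=\{(Yy,y):y\in\mathcal{D}(Y)\}$. *)

theory Defs
  imports "HOL-Analysis.Analysis" "HOL-Computational_Algebra.Polynomial"
begin

section \<open>Complex Banach and Hilbert spaces\<close>

class scaleC =
  fixes scaleC :: "complex \<Rightarrow> 'a \<Rightarrow> 'a"  (infixr \<open>*\<^sub>C\<close> 75)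

class complex_banach = banach + scaleC +
  assumes scaleC_add_right: "a *\<^sub>C (x + y) = a *\<^sub>C x + a *\<^sub>C y"
    and scaleC_add_left: "(a + b) *\<^sub>C x = a *\<^sub>C x + b *\<^sub>C x"
    and scaleC_scaleC: "a *\<^sub>C (b *\<^sub>C x) = (a * b) *\<^sub>C x"
    and scaleC_one: "1 *\<^sub>C x = x"
    and scaleR_scaleC: "r *\<^sub>R x = complex_of_real r *\<^sub>C x"
    and norm_scaleC: "norm (a *\<^sub>C x) = cmod a * norm x"

text \<open>The inner product is linear in its first and antilinear in its second argument.\<close>

class complex_hilbert = complex_banach +
  fixes cinner :: "'a \<Rightarrow> 'a \<Rightarrow> complex"
  assumes cinner_commute: "cinner x y = cnj (cinner y x)"
    and cinner_add_left: "cinner (x + y) z = cinner x z + cinner y z"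
    and cinner_scaleC_left: "cinner (a *\<^sub>C x) y = a * cinner x y"
    and cinner_self: "cinner x x = complex_of_real ((norm x)\<^sup>2)"

instantiation complex :: complex_hilbert
begin
definition scaleC_complex :: "complex \<Rightarrow> complex \<Rightarrow> complex"
  where "scaleC_complex a x = a * x"
definition cinner_complex :: "complex \<Rightarrow> complex \<Rightarrow> complex"
  where "cinner_complex x y = x * cnj y"
instance
proof
  fix x y z a :: complex
  show "cinner x x = complex_of_real ((norm x)\<^sup>2)"
    unfolding cinner_complex_def complex_norm_square ..
qed (simp_all add: scaleC_complex_def cinner_complex_def algebra_simps scaleR_conv_of_real norm_mult)
end

instantiation prod :: (complex_banach, complex_banach) complex_banach
begin
definition scaleC_prod :: "complex \<Rightarrow> 'a \<times> 'b \<Rightarrow> 'a \<times> 'b"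
  where "scaleC_prod a v = (a *\<^sub>C fst v, a *\<^sub>C snd v)"
instance
proof
  fix a :: complex and x :: "'a \<times> 'b"
  show "norm (a *\<^sub>C x) = cmod a * norm x"
  proof -
    have "norm (a *\<^sub>C x) = sqrt ((cmod a)\<^sup>2 * ((norm (fst x))\<^sup>2 + (norm (snd x))\<^sup>2))"
      by (simp add: scaleC_prod_def norm_prod_def norm_scaleC power_mult_distrib distrib_left)
    then show ?thesis
      by (simp add: real_sqrt_mult norm_prod_def)
  qed
qed (simp_all add: scaleC_prod_def scaleC_add_right scaleC_add_left scaleC_scaleC scaleC_one
    scaleR_scaleC scaleR_prod_def)
end

instantiation prod :: (complex_hilbert, complex_hilbert) complex_hilbert
begin
definition cinner_prod :: "'a \<times> 'b \<Rightarrow> 'a \<times> 'b \<Rightarrow> complex"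
  where "cinner_prod v w = cinner (fst v) (fst w) + cinner (snd v) (snd w)"
instance
proof
  fix x y z :: "'a \<times> 'b" and a :: complex
  show "cinner x y = cnj (cinner y x)"
    unfolding cinner_prod_def complex_cnj_add
    by (intro arg_cong2[where f = "(+)"] cinner_commute)
  show "cinner (x + y) z = cinner x z + cinner y z"
    by (simp add: cinner_prod_def cinner_add_left)
  show "cinner (a *\<^sub>C x) y = a * cinner x y"
    by (simp add: cinner_prod_def scaleC_prod_def cinner_scaleC_left distrib_left)
  show "cinner x x = complex_of_real ((norm x)\<^sup>2)"
    by (simp add: cinner_prod_def cinner_self norm_prod_def)
qed
end

global_interpretation complex_vec: vector_space "scaleC :: complex \<Rightarrow> 'a \<Rightarrow> 'a::complex_banach"
  by unfold_locales (simp_all add: scaleC_add_right scaleC_add_left scaleC_scaleC scaleC_one)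

abbreviation csubspace :: "'a::complex_banach set \<Rightarrow> bool"
  where "csubspace \<equiv> module.subspace scaleC"

definition clinear :: "('a::complex_banach \<Rightarrow> 'b::complex_banach) \<Rightarrow> bool"
  where "clinear f \<longleftrightarrow> Vector_Spaces.linear scaleC scaleC f"

definition bounded_clinear :: "('a::complex_banach \<Rightarrow> 'b::complex_banach) \<Rightarrow> bool"
  where "bounded_clinear f \<longleftrightarrow> clinear f \<and> (\<exists>M. \<forall>x. norm (f x) \<le> M * norm x)"


section \<open>Unbounded operators\<close>

text \<open>An operator from \<open>'a\<close> to \<open>'b\<close> is a partial function: its domain is \<open>dom T\<close>, its range is
  \<open>ran T\<close>, and \<open>T x = Some y\<close> says that \<open>x\<close> is in the domain and is mapped to \<open>y\<close>. Equality of
  partial functions is equality of operators including domains.\<close>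

definition linear_op :: "('a::complex_banach \<rightharpoonup> 'b::complex_banach) \<Rightarrow> bool"
  where "linear_op T \<longleftrightarrow> csubspace (dom T) \<and>
    (\<forall>x\<in>dom T. \<forall>y\<in>dom T. the (T (x + y)) = the (T x) + the (T y)) \<and>
    (\<forall>c. \<forall>x\<in>dom T. the (T (c *\<^sub>C x)) = c *\<^sub>C the (T x))"

definition closed_op :: "('a::complex_banach \<rightharpoonup> 'b::complex_banach) \<Rightarrow> bool"
  where "closed_op T \<longleftrightarrow> linear_op T \<and> closed {(x, y). T x = Some y}"

definition op_ker :: "('a \<rightharpoonup> 'b::zero) \<Rightarrow> 'a set"
  where "op_ker T = {x. T x = Some 0}"

definition op_injective :: "('a \<rightharpoonup> 'b) \<Rightarrow> bool"
  where "op_injective T \<longleftrightarrow> inj_on T (dom T)"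

text \<open>The inverse; only meaningful for injective operators.\<close>

definition op_inv :: "('a \<rightharpoonup> 'b) \<Rightarrow> ('b \<rightharpoonup> 'a)"
  where "op_inv T y = (if \<exists>!x. T x = Some y then Some (THE x. T x = Some y) else None)"

definition op_bounded_by :: "('a::real_normed_vector \<rightharpoonup> 'b::real_normed_vector) \<Rightarrow> real \<Rightarrow> bool"
  where "op_bounded_by T M \<longleftrightarrow> (\<forall>x\<in>dom T. norm (the (T x)) \<le> M * norm x)"

text \<open>\<open>T - z\<close> for an operator into a space in which its domain is embedded by \<open>j\<close>.\<close>

definition emb_shift ::
  "('a \<Rightarrow> 'b::complex_banach) \<Rightarrow> ('a \<rightharpoonup> 'b) \<Rightarrow> complex \<Rightarrow> ('a \<rightharpoonup> 'b)"
  where "emb_shift j T z x = map_option (\<lambda>y. y - z *\<^sub>C j x) (T x)"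

abbreviation op_shift :: "('a::complex_banach \<rightharpoonup> 'a) \<Rightarrow> complex \<Rightarrow> ('a \<rightharpoonup> 'a)"
  where "op_shift \<equiv> emb_shift (\<lambda>x. x)"

text \<open>Resolvent set and spectrum of an operator \<open>T\<close> acting in the closed subspace \<open>V\<close>.\<close>

definition resolvent_set_on :: "'a::complex_banach set \<Rightarrow> ('a \<rightharpoonup> 'a) \<Rightarrow> complex set"
  where "resolvent_set_on V T = {z. op_injective (op_shift T z) \<and> ran (op_shift T z) = V \<and>
    (\<exists>M. op_bounded_by (op_inv (op_shift T z)) M)}"

definition spectrum_on :: "'a::complex_banach set \<Rightarrow> ('a \<rightharpoonup> 'a) \<Rightarrow> complex set"
  where "spectrum_on V T = - resolvent_set_on V T"

abbreviation resolvent_set :: "('a::complex_banach \<rightharpoonup> 'a) \<Rightarrow> complex set"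
  where "resolvent_set \<equiv> resolvent_set_on UNIV"

text \<open>The Hilbert space adjoint of a densely defined operator (density makes \<open>z\<close> unique).\<close>

definition adj :: "('a::complex_hilbert \<rightharpoonup> 'b::complex_hilbert) \<Rightarrow> ('b \<rightharpoonup> 'a)"
  where "adj T y =
    (if \<exists>!z. \<forall>x\<in>dom T. cinner (the (T x)) y = cinner x z
     then Some (THE z. \<forall>x\<in>dom T. cinner (the (T x)) y = cinner x z) else None)"

definition sector :: "real \<Rightarrow> complex set"
  where "sector \<theta> = {z. z \<noteq> 0 \<and> - (pi / 2) - \<theta> \<le> Arg z \<and> Arg z \<le> pi / 2 + \<theta>}"

definition sectorial :: "('a::complex_banach \<rightharpoonup> 'a) \<Rightarrow> bool"
  where "sectorial S \<longleftrightarrow> linear_op S \<and>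
    (\<exists>\<theta>\<ge>0. \<exists>M>0. sector \<theta> \<subseteq> resolvent_set S \<and>
      (\<forall>z\<in>sector \<theta>. op_bounded_by (op_inv (op_shift S z)) (M / cmod z)))"

definition quasi_sectorial :: "('a::complex_banach \<rightharpoonup> 'a) \<Rightarrow> bool"
  where "quasi_sectorial S \<longleftrightarrow> (\<exists>\<mu>::real. sectorial (op_shift S (complex_of_real \<mu>)))"


section \<open>Powers of self-adjoint operators and the scales of spaces\<close>

definition poly_op :: "real poly \<Rightarrow> ('a::real_vector \<Rightarrow> 'a) \<Rightarrow> 'a \<Rightarrow> 'a"
  where "poly_op p K x = (\<Sum>i\<le>degree p. coeff p i *\<^sub>R (K ^^ i) x)"

text \<open>Continuous functional calculus of a bounded self-adjoint \<open>K\<close> with spectrum in \<open>[0,1]\<close>: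
  \<open>f(K)\<close> is the limit of \<open>p\<^sub>n(K)\<close> whenever the polynomials \<open>p\<^sub>n\<close> tend to \<open>f\<close> uniformly
  on \<open>[0,1]\<close>. Such \<open>p\<^sub>n\<close> exist for every continuous \<open>f\<close> by Weierstrass, and the
  limit does not depend on them since \<open>\<parallel>p(K)\<parallel> \<le> sup |p|\<close>.\<close>

definition fun_calc :: "('a::complex_hilbert \<Rightarrow> 'a) \<Rightarrow> (real \<Rightarrow> real) \<Rightarrow> 'a \<Rightarrow> 'a"
  where "fun_calc K f x = (THE y. \<forall>p :: nat \<Rightarrow> real poly.
    uniform_limit {0..1} (\<lambda>n. poly (p n)) f sequentially \<longrightarrow> (\<lambda>n. poly_op (p n) K x) \<longlonglongrightarrow> y)"

text \<open>Real powers of a self-adjoint operator \<open>S \<ge> I\<close>. Then \<open>K = S\<^sup>-\<^sup>1\<close> is bounded with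
  spectrum in \<open>[0,1]\<close>, and \<open>S\<close> to the power \<open>\<alpha>\<close> is \<open>K\<close> to the power \<open>-\<alpha>\<close> for \<open>\<alpha> \<le> 0\<close>,
  and the inverse of \<open>S\<close> to the power \<open>-\<alpha>\<close> for \<open>\<alpha> > 0\<close>. The case distinction in
  \<open>cont_power\<close> is needed because \<open>0 powr 0 = 0\<close>.\<close>

definition cont_power :: "real \<Rightarrow> real \<Rightarrow> real"
  where "cont_power \<alpha> t = (if \<alpha> = 0 then 1 else t powr \<alpha>)"

definition op_powr :: "('a::complex_hilbert \<rightharpoonup> 'a) \<Rightarrow> real \<Rightarrow> ('a \<rightharpoonup> 'a)"
  where "op_powr S \<alpha> =
    (let P = (\<lambda>\<beta> x. Some (fun_calc (\<lambda>y. the (op_inv S y)) (cont_power \<beta>) x))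
     in if \<alpha> \<le> 0 then P (- \<alpha>) else op_inv (P \<alpha>))"

text \<open>\<open>Lam A\<close> is \<open>(I + A A\<^sup>*)\<close> to the power \<open>1/2\<close>; the operator \<open>(I + A\<^sup>* A)\<close> to the power
  \<open>1/2\<close> of the other scale is \<open>Lam_star A\<close>. The shift by \<open>-1\<close> adds the identity.\<close>

definition Lam :: "('a::complex_hilbert \<rightharpoonup> 'a) \<Rightarrow> ('a \<rightharpoonup> 'a)"
  where "Lam A = op_powr (op_shift (A \<circ>\<^sub>m adj A) (- 1)) (1 / 2)"

definition Lam_star :: "('a::complex_hilbert \<rightharpoonup> 'a) \<Rightarrow> ('a \<rightharpoonup> 'a)"
  where "Lam_star A = op_powr (op_shift (adj A \<circ>\<^sub>m A) (- 1)) (1 / 2)"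

text \<open>For \<open>\<tau> \<ge> 0\<close> the space \<open>H\<^sub>\<tau>\<close> is \<open>dom (op_powr L \<tau>)\<close> with norm
  \<open>\<lambda>x. norm (the (op_powr L \<tau> x))\<close>, where \<open>L\<close> is \<open>Lam A\<close> or \<open>Lam_star A\<close>. The space with
  exponent \<open>-\<tau>\<close> is a completion of \<open>H\<close>: a Hilbert space \<open>'e\<close> with a dense
  embedding \<open>j\<close> of \<open>H\<close> that is isometric for the norm given by \<open>op_powr L (-\<tau>)\<close>.
  Completions being unique only up to isometric isomorphism, \<open>j\<close> is a parameter.\<close>

definition negative_space ::
  "('h::complex_hilbert \<rightharpoonup> 'h) \<Rightarrow> real \<Rightarrow> ('h \<Rightarrow> 'e::complex_hilbert) \<Rightarrow> bool"
  where "negative_space L \<tau> j \<longleftrightarrow> clinear j \<and>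
    (\<forall>x. norm (j x) = norm (the (op_powr L (- \<tau>) x))) \<and> closure (range j) = UNIV"

text \<open>The extension by continuity of the inner product of \<open>H\<close> to a form \<open>(x|w)\<close> with
  \<open>x\<close> in \<open>H\<^sub>\<tau>\<close> and \<open>w\<close> in the completion with embedding \<open>j\<close>.\<close>

definition pairing :: "('h::complex_hilbert \<Rightarrow> 'e::complex_hilbert) \<Rightarrow> 'h \<Rightarrow> 'e \<Rightarrow> complex"
  where "pairing j x w =
    (THE c. \<forall>h. (\<lambda>n. j (h n)) \<longlonglongrightarrow> w \<longrightarrow> (\<lambda>n. cinner x (h n)) \<longlonglongrightarrow> c)"

text \<open>The extension by continuity of \<open>T\<close>, whose domain is dense in \<open>dom N\<close> with the norm
  \<open>\<lambda>x. norm (the (N x))\<close>, to an operator from \<open>dom N\<close> to the completion with embedding \<open>j\<close>.\<close>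

definition scale_ext :: "('h::complex_hilbert \<rightharpoonup> 'h) \<Rightarrow> ('h \<Rightarrow> 'e::complex_hilbert) \<Rightarrow>
    ('h \<rightharpoonup> 'h) \<Rightarrow> ('h \<rightharpoonup> 'e)"
  where "scale_ext N j T x = (if x \<in> dom N then
    Some (THE w. \<forall>f. (\<forall>n. f n \<in> dom T) \<and> (\<lambda>n. the (N (f n - x))) \<longlonglongrightarrow> 0
      \<longrightarrow> (\<lambda>n. j (the (T (f n)))) \<longlonglongrightarrow> w) else None)"

definition A_ext :: "('h::complex_hilbert \<rightharpoonup> 'h) \<Rightarrow> real \<Rightarrow> ('h \<Rightarrow> 'e::complex_hilbert) \<Rightarrow> ('h \<rightharpoonup> 'e)"
  where "A_ext A r j = scale_ext (op_powr (Lam_star A) (1 - r)) j A"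

definition A_adj_ext ::
  "('h::complex_hilbert \<rightharpoonup> 'h) \<Rightarrow> real \<Rightarrow> ('h \<Rightarrow> 'e::complex_hilbert) \<Rightarrow> ('h \<rightharpoonup> 'e)"
  where "A_adj_ext A s j = scale_ext (op_powr (Lam A) (1 - s)) j (adj A)"


section \<open>The Hamiltonian\<close>

text \<open>\<open>C\<close> is a bounded operator from \<open>dom N\<close>, normed by \<open>\<lambda>x. norm (the (N x))\<close>.\<close>

definition bounded_on_scale ::
  "('h::complex_hilbert \<rightharpoonup> 'h) \<Rightarrow> ('h \<rightharpoonup> 'y::complex_hilbert) \<Rightarrow> bool"
  where "bounded_on_scale N C \<longleftrightarrow> linear_op C \<and> dom C = dom N \<and>
    (\<exists>M. \<forall>x\<in>dom N. norm (the (C x)) \<le> M * norm (the (N x)))"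

definition B_adj :: "('h::complex_hilbert \<rightharpoonup> 'h) \<Rightarrow> real \<Rightarrow> ('h \<Rightarrow> 'e::complex_hilbert) \<Rightarrow>
    ('u::complex_hilbert \<Rightarrow> 'e) \<Rightarrow> ('h \<rightharpoonup> 'u)"
  where "B_adj A r j B x = (if x \<in> dom (op_powr (Lam A) r)
    then Some (THE v. \<forall>u. pairing j x (B u) = cinner v u) else None)"

definition C_adj :: "('h::complex_hilbert \<Rightarrow> 'e::complex_hilbert) \<Rightarrow>
    ('h \<rightharpoonup> 'y::complex_hilbert) \<Rightarrow> 'y \<Rightarrow> 'e"
  where "C_adj j C y = (THE w. \<forall>x\<in>dom C. cinner (the (C x)) y = pairing j x w)"

text \<open>The spaces of the domain are subspaces of \<open>H\<close>, which is embedded in the two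
  components of the space in which the Hamiltonian acts by \<open>jr\<close> and \<open>js\<close>.\<close>

definition hamiltonian :: "('h::complex_hilbert \<rightharpoonup> 'h) \<Rightarrow> real \<Rightarrow> real \<Rightarrow>
    ('h \<Rightarrow> 'hr::complex_hilbert) \<Rightarrow> ('h \<Rightarrow> 'hs::complex_hilbert) \<Rightarrow>
    ('u::complex_hilbert \<Rightarrow> 'hr) \<Rightarrow> ('h \<rightharpoonup> 'y::complex_hilbert) \<Rightarrow> ('hr \<times> 'hs \<rightharpoonup> 'hr \<times> 'hs)"
  where "hamiltonian A r s jr js B C v =
    (if fst v \<in> jr ` dom (op_powr (Lam_star A) (1 - r)) \<and>
        snd v \<in> js ` dom (op_powr (Lam A) (1 - s))
     then let x = inv jr (fst v); y = inv js (snd v) in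
       Some (the (A_ext A r jr x) - B (the (B_adj A r jr B y)),
             - C_adj js C (the (C x)) - the (A_adj_ext A s js y))
     else None)"


text \<open>The two intersections of kernels in the spaces with exponents \<open>-s\<close> and \<open>-r\<close>. Here
  \<open>adj A - z\<close> and \<open>A - z\<close> are the extended operators, while the resolvent sets refer to the
  operators in \<open>H\<close>.\<close>

definition B_kernel :: "('h::complex_hilbert \<rightharpoonup> 'h) \<Rightarrow> real \<Rightarrow> real \<Rightarrow>
    ('h \<Rightarrow> 'hr::complex_hilbert) \<Rightarrow> ('h \<Rightarrow> 'hs::complex_hilbert) \<Rightarrow>
    ('u::complex_hilbert \<Rightarrow> 'hr) \<Rightarrow> 'hs set"
  where "B_kernel A r s jr js B = (\<Inter>z \<in> {z. Re z = 0} \<inter> resolvent_set (adj A).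
    op_ker (B_adj A r jr B \<circ>\<^sub>m op_inv (emb_shift js (A_adj_ext A s js) z)))"

definition C_kernel :: "('h::complex_hilbert \<rightharpoonup> 'h) \<Rightarrow> real \<Rightarrow>
    ('h \<Rightarrow> 'hr::complex_hilbert) \<Rightarrow> ('h \<rightharpoonup> 'y::complex_hilbert) \<Rightarrow> 'hr set"
  where "C_kernel A r jr C = (\<Inter>z \<in> {z. Re z = 0} \<inter> resolvent_set A.
    op_ker (C \<circ>\<^sub>m op_inv (emb_shift jr (A_ext A r jr) z)))"


section \<open>Spectral subspaces and graph subspaces\<close>

definition invariant_subspace :: "('a::complex_banach \<rightharpoonup> 'a) \<Rightarrow> 'a set \<Rightarrow> bool"
  where "invariant_subspace T V \<longleftrightarrow> csubspace V \<and> ran (T |` V) \<subseteq> V"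

text \<open>\<open>Vp\<close> and \<open>Vm\<close> are the subspaces of the strictly dichotomous operator \<open>T\<close> for the open
  right and left half-plane.\<close>

definition spectral_subspaces :: "('a::complex_banach \<rightharpoonup> 'a) \<Rightarrow> 'a set \<Rightarrow> 'a set \<Rightarrow> bool"
  where "spectral_subspaces T Vp Vm \<longleftrightarrow>
    closed Vp \<and> closed Vm \<and> invariant_subspace T Vp \<and> invariant_subspace T Vm \<and>
    (\<forall>v. \<exists>!w. w \<in> Vp \<times> Vm \<and> v = fst w + snd w) \<and>
    spectrum_on Vp (T |` Vp) \<subseteq> {z. Re z > 0} \<and>
    spectrum_on Vm (T |` Vm) \<subseteq> {z. Re z < 0} \<and>
    (\<exists>M. \<forall>z. Re z < 0 \<longrightarrow> op_bounded_by (op_inv (op_shift (T |` Vp) z)) M) \<and>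
    (\<exists>M. \<forall>z. Re z > 0 \<longrightarrow> op_bounded_by (op_inv (op_shift (T |` Vm) z)) M)"

definition graph_I_op :: "('a \<rightharpoonup> 'b) \<Rightarrow> ('a \<times> 'b) set"
  where "graph_I_op X = {(x, the (X x)) | x. x \<in> dom X}"

definition graph_op_I :: "('b \<rightharpoonup> 'a) \<Rightarrow> ('a \<times> 'b) set"
  where "graph_op_I Y = {(the (Y y), y) | y. y \<in> dom Y}"

end

(* Only the boundedness of the resolvents on the spectral subspaces V is available. Extend (x|y') - (y|x')
   to a form [p|v] for p in the domain of T0 and v in V0; T0 is skew-symmetric for it. For u, v in V the
   function [(T0 - z)^-1 u|v] is analytic on one half-plane and, by skew-symmetry on the imaginary axis,
   continues to an entire function of linear growth; Liouville's theorem and the density of the domain make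
   it vanish, so that V is neutral. If v in V has a vanishing component and p = (T0 - z)^-1 v with z imaginary,
   neutrality and dissipativity of T0 for the form (x|y') + (y|x') give B^* y = 0 and C x = 0 for p = (x, y),
   so the other component of v lies in the kernels of (1) or (2).

   On the scales everything is transported to H by the unitary extension of the negative power to the
   completion: A and its adjoint become the bounded operators A (I + A^* A)^(-1/2) and A^* (I + A A^* )^(-1/2)
   on H, which are adjoint to each other and intertwine the functions of the two operators. *)
theory Submission
  imports Defs "HOL-Complex_Analysis.Complex_Analysis"
begin

section \<open>Complex Hilbert spaces\<close>

text \<open>On a spectral subspace V the resolvent of T0 is bounded on a half-plane, but no decay is
  given, so contours cannot be closed. Moreover [p|v] is defined only for p in the domain and is not
  bounded by the norm of p. Writing (T0 - z)^-1 = T0^-1 (1 + z (T0 - z)^-1) leaves the functional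
  [T0^-1 u|v], which skew-symmetry bounds in u, at the price of the factor z: this is the linear
  growth. For T0^-1 u in place of u the function is bounded on one half-plane; a polynomial of
  degree one that is bounded on a ray is constant, and comparing values gives [T0^-3 u|v] = 0.
  Density then removes the powers one at a time. That T0^-1 V is dense in V is not part of the
  dichotomy: it follows from the density of the domain because the projections onto the spectral
  subspaces are bounded, hence the open mapping argument.

  The scales are defined by limits of polynomials, so a sup-norm estimate for polynomials in a
  positive contraction is needed; Bernstein polynomials give it without a spectral theorem. The
  number \<open>eps\<close> = 1 - r - s measures how far the domain lies inside the spaces on which
  the form pairs with the completions.\<close>

lemma clinearI:
  assumes "\<And>x y. f (x + y) = f x + f y" and "\<And>a x. f (a *\<^sub>C x) = a *\<^sub>C f x"
  shows "clinear f"
  using assms unfolding clinear_def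
  by (simp add: Vector_Spaces.linear_iff complex_vec.vector_space_axioms)

lemma clinear_add: "clinear f \<Longrightarrow> f (x + y) = f x + f y"
  and clinear_scaleC: "clinear f \<Longrightarrow> f (a *\<^sub>C x) = a *\<^sub>C f x"
  unfolding clinear_def by (simp_all add: Vector_Spaces.linear_iff)

lemma clinear_zero: "clinear f \<Longrightarrow> f 0 = 0"
  using clinear_scaleC[of f 0 0] by simp

lemma clinear_minus: "clinear f \<Longrightarrow> f (- x) = - f x"
  using clinear_add[of f x "- x"] by (simp add: clinear_zero eq_neg_iff_add_eq_0 add.commute)

lemma clinear_diff: "clinear f \<Longrightarrow> f (x - y) = f x - f y"
  using clinear_add[of f x "- y"] by (simp add: clinear_minus)

lemma clinear_scaleR: "clinear f \<Longrightarrow> f (c *\<^sub>R x) = c *\<^sub>R f x"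
  by (simp add: scaleR_scaleC clinear_scaleC)

lemma clinear_sum: "clinear f \<Longrightarrow> f (sum g I) = (\<Sum>i\<in>I. f (g i))"
  by (induction I rule: infinite_finite_induct) (simp_all add: clinear_zero clinear_add)

lemma clinear_bounded_linear:
  assumes "clinear f" and "\<And>x. norm (f x) \<le> M * norm x"
  shows "bounded_linear f"
  by (rule bounded_linear_intro[where K = M])
    (use assms in \<open>auto simp: clinear_add clinear_scaleR mult.commute\<close>)

lemma bounded_clinear_bounded_linear: "bounded_clinear f \<Longrightarrow> bounded_linear f"
  unfolding bounded_clinear_def by (auto intro: clinear_bounded_linear)

lemma bounded_clinearI: "clinear f \<Longrightarrow> (\<And>x. norm (f x) \<le> M * norm x) \<Longrightarrow> bounded_clinear f"
  unfolding bounded_clinear_def by blast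

lemma csubspaceI:
  assumes "0 \<in> V" "\<And>x y. x \<in> V \<Longrightarrow> y \<in> V \<Longrightarrow> x + y \<in> V" "\<And>c x. x \<in> V \<Longrightarrow> c *\<^sub>C x \<in> V"
  shows "csubspace V"
  using assms by (auto simp: complex_vec.subspace_def)

lemma csubspace_scaleR: "csubspace V \<Longrightarrow> x \<in> V \<Longrightarrow> c *\<^sub>R x \<in> V"
  by (simp add: scaleR_scaleC complex_vec.subspace_scale)

lemma cinner_add_right: "cinner x (y + z) = cinner x y + cinner x z"
  by (metis cinner_add_left cinner_commute complex_cnj_add)

lemma cinner_scaleC_right: "cinner x (a *\<^sub>C y) = cnj a * cinner x y"
  by (metis cinner_commute cinner_scaleC_left complex_cnj_mult)

lemma cinner_scaleR_left: "cinner (c *\<^sub>R x) y = c *\<^sub>R cinner x y"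
  by (simp add: scaleR_scaleC cinner_scaleC_left scaleC_complex_def)

lemma cinner_scaleR_right: "cinner x (c *\<^sub>R y) = c *\<^sub>R cinner x y"
  by (simp add: scaleR_scaleC cinner_scaleC_right scaleC_complex_def)

lemma Re_cinner_self: "Re (cinner x x) = (norm x)\<^sup>2"
  by (simp add: cinner_self)

lemma cinner_self_eq_0: "cinner x x = 0 \<longleftrightarrow> x = 0"
  by (simp add: cinner_self)

lemma cinner_self_add_eq_0:
  assumes "cinner x x + cinner y y = 0"
  shows "x = 0" and "y = 0"
proof -
  have "complex_of_real ((norm x)\<^sup>2 + (norm y)\<^sup>2) = 0"
    using assms by (simp add: cinner_self)
  then show "x = 0" "y = 0"
    unfolding of_real_eq_0_iff by (auto simp: add_nonneg_eq_0_iff)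
qed

lemma norm_minus_sq: "(norm (x - y))\<^sup>2 = (norm x)\<^sup>2 + (norm y)\<^sup>2 - 2 * Re (cinner x y)"
proof -
  have "cinner (x - y) z = cinner x z - cinner y z" "cinner z (x - y) = cinner z x - cinner z y" for z
    using cinner_add_left[of "x - y" y z] cinner_add_right[of z "x - y" y] by simp_all
  then have "cinner (x - y) (x - y) = cinner x x + cinner y y - (cinner x y + cinner y x)"
    by simp
  then have "Re (cinner (x - y) (x - y)) = Re (cinner x x) + Re (cinner y y) - (Re (cinner x y) + Re (cinner y x))"
    by simp
  moreover have "Re (cinner y x) = Re (cinner x y)"
    by (metis cinner_commute complex_cnj cnj.simps(1))
  ultimately show ?thesis
    by (simp add: Re_cinner_self)
qed

lemma norm_cinner_le: "cmod (cinner x y) \<le> norm x * norm y"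
proof (cases "y = 0")
  case True
  then show ?thesis
    using cinner_scaleC_right[of x 0 y] by simp
next
  case False
  define a where "a = cinner x y"
  define n where "n = (norm y)\<^sup>2"
  have n: "n > 0"
    using False by (simp add: n_def)
  have "0 \<le> (norm (x - (a / n) *\<^sub>C y))\<^sup>2"
    by simp
  also have "\<dots> = (norm x)\<^sup>2 + (cmod a)\<^sup>2 / n - 2 * Re (cnj (a / n) * a)"
    unfolding norm_minus_sq cinner_scaleC_right norm_scaleC a_def[symmetric]
    using n by (simp add: norm_divide power_divide power_mult_distrib n_def[symmetric] power2_eq_square[of n])
  also have "Re (cnj (a / n) * a) = (cmod a)\<^sup>2 / n"
    unfolding cmod_power2
    by (simp add: power2_eq_square add_divide_distrib)
  finally have "(cmod a)\<^sup>2 \<le> (norm x)\<^sup>2 * n"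
    using n by (simp add: field_simps)
  then have "(cmod a)\<^sup>2 \<le> (norm x * norm y)\<^sup>2"
    by (simp add: power_mult_distrib n_def)
  then show ?thesis
    unfolding a_def by (rule power2_le_imp_le) simp
qed

text \<open>Antilinearity in the second argument is still linearity over the reals, so the real
  notion applies and supplies limits, sums and differences.\<close>

interpretation cinner: bounded_bilinear "cinner :: 'a::complex_hilbert \<Rightarrow> 'a \<Rightarrow> complex"
proof
  show "\<exists>K. \<forall>a b :: 'a. norm (cinner a b) \<le> norm a * norm b * K"
    by (rule exI[of _ 1]) (simp add: norm_cinner_le)
qed (simp_all add: cinner_add_left cinner_add_right cinner_scaleR_left cinner_scaleR_right)

interpretation scaleC: bounded_bilinear "scaleC :: complex \<Rightarrow> 'a::complex_banach \<Rightarrow> 'a"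
proof
  show "\<exists>K. \<forall>a (b :: 'a). norm (a *\<^sub>C b) \<le> norm a * norm b * K"
    by (rule exI[of _ 1]) (simp add: norm_scaleC)
qed (simp_all add: scaleC_add_left scaleC_add_right scaleR_scaleC scaleC_scaleC scaleC_complex_def mult.commute)

lemma cinner_ext: "(\<And>z. cinner z x = cinner z y) \<Longrightarrow> x = y"
  using cinner_self_eq_0[of "x - y"] by (simp add: cinner.diff_right)

lemma cinner_eq_0_closure:
  assumes "\<And>m. m \<in> M \<Longrightarrow> cinner z m = 0" and "x \<in> closure M"
  shows "cinner z x = 0"
proof -
  obtain f where f: "\<And>n. f n \<in> M" "f \<longlonglongrightarrow> x"
    using assms(2) unfolding closure_sequential by blast
  have "(\<lambda>n. cinner z (f n)) \<longlonglongrightarrow> cinner z x"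
    by (intro cinner.tendsto tendsto_const f)
  moreover have "cinner z (f n) = 0" for n
    using assms(1) f(1) .
  ultimately show ?thesis
    by (simp add: LIMSEQ_const_iff)
qed

section \<open>Orthogonal projection, Riesz representation and adjoints\<close>

lemma csubspace_closure:
  assumes "csubspace M"
  shows "csubspace (closure M)"
proof (rule csubspaceI)
  show "0 \<in> closure M"
    using assms closure_subset complex_vec.subspace_0 by blast
next
  fix x y assume "x \<in> closure M" "y \<in> closure M"
  then obtain f g where "\<And>n. f n \<in> M" "f \<longlonglongrightarrow> x" "\<And>n. g n \<in> M" "g \<longlonglongrightarrow> y"
    unfolding closure_sequential by blast
  then show "x + y \<in> closure M"
    unfolding closure_sequential
    by (intro exI[of _ "\<lambda>n. f n + g n"]) (auto intro: tendsto_add complex_vec.subspace_add assms)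
next
  fix c x assume "x \<in> closure M"
  then obtain f where "\<And>n. f n \<in> M" "f \<longlonglongrightarrow> x"
    unfolding closure_sequential by blast
  then show "c *\<^sub>C x \<in> closure M"
    unfolding closure_sequential
    by (intro exI[of _ "\<lambda>n. c *\<^sub>C f n"]) (auto intro: scaleC.tendsto complex_vec.subspace_scale assms)
qed

lemma parallelogram: "(norm (x - y :: 'a::complex_hilbert))\<^sup>2 + (norm (x + y))\<^sup>2 = 2 * (norm x)\<^sup>2 + 2 * (norm y)\<^sup>2"
  using norm_minus_sq[of x y] norm_minus_sq[of x "- y"] by (simp add: cinner.minus_right)

text \<open>A minimizing sequence is Cauchy by the parallelogram law, because midpoints stay in
  \<open>M\<close> and so have distance at least \<open>d\<close> from \<open>x\<close>. At the
  minimum a nonzero inner product with some \<open>n\<close> would allow a shorter distance.\<close>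

lemma orthogonal_projection:
  fixes M :: "'a::complex_hilbert set"
  assumes "closed M" and M: "csubspace M"
  obtains m where "m \<in> M" and "\<And>n. n \<in> M \<Longrightarrow> cinner (x - m) n = 0"
proof -
  define d where "d = infdist x M"
  have ne: "M \<noteq> {}"
    using complex_vec.subspace_0[OF M] by blast
  have d_le: "d \<le> norm (x - m)" if "m \<in> M" for m
    using infdist_le[OF that, of x] by (simp add: d_def dist_norm)
  have d0: "0 \<le> d"
    by (simp add: d_def infdist_nonneg)
  have "\<exists>m\<in>M. norm (x - m) < d + inverse (Suc k)" for k
  proof (rule ccontr)
    assume "\<not> ?thesis"
    then have "d + inverse (Suc k) \<le> infdist x M"
      unfolding infdist_notempty[OF ne] by (intro cINF_greatest[OF ne]) (force simp: dist_norm)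
    then show False
      by (simp add: d_def)
  qed
  then obtain m where m: "\<And>k. m k \<in> M" "\<And>k. norm (x - m k) < d + inverse (Suc k)"
    by metis
  define e where "e = (\<lambda>k. (d + inverse (real (Suc k)))\<^sup>2 - d\<^sup>2)"
  have e_lim: "e \<longlonglongrightarrow> 0"
    unfolding e_def
    by (rule tendsto_eq_intros LIMSEQ_inverse_real_of_nat refl | simp)+
  have diff: "(norm (m k - m l))\<^sup>2 \<le> 2 * e k + 2 * e l" for k l
  proof -
    have "(1/2) *\<^sub>R (m k + m l) \<in> M"
      by (intro csubspace_scaleR complex_vec.subspace_add M m)
    from d_le[OF this] have "2 * d \<le> 2 * norm (x - (1/2) *\<^sub>R (m k + m l))"
      by simp
    also have "\<dots> = norm (2 *\<^sub>R (x - (1/2) *\<^sub>R (m k + m l)))"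
      by simp
    also have "2 *\<^sub>R (x - (1/2) *\<^sub>R (m k + m l)) = (x - m l) + (x - m k)"
      by (simp add: scaleR_right_diff_distrib scaleR_2)
    finally have "(2 * d)\<^sup>2 \<le> (norm ((x - m l) + (x - m k)))\<^sup>2"
      using d0 by (intro power_mono) auto
    moreover have "(norm (x - m k))\<^sup>2 \<le> (d + inverse (Suc k))\<^sup>2" for k
      using m(2)[of k] by (intro power_mono) auto
    note this[of k] this[of l]
    moreover have "(norm (m k - m l))\<^sup>2 + (norm ((x - m l) + (x - m k)))\<^sup>2
        = 2 * (norm (x - m l))\<^sup>2 + 2 * (norm (x - m k))\<^sup>2"
      using parallelogram[of "x - m l" "x - m k"] by simp
    ultimately show ?thesis
      unfolding e_def by (simp add: power_mult_distrib)
  qed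
  have "Cauchy m"
  proof (rule metric_CauchyI)
    fix \<epsilon> :: real assume "\<epsilon> > 0"
    then have "eventually (\<lambda>k. e k < \<epsilon>\<^sup>2 / 4) sequentially"
      using e_lim by (intro order_tendstoD) auto
    then obtain N where N: "\<And>k. k \<ge> N \<Longrightarrow> e k < \<epsilon>\<^sup>2 / 4"
      unfolding eventually_sequentially by blast
    show "\<exists>N. \<forall>k\<ge>N. \<forall>l\<ge>N. dist (m k) (m l) < \<epsilon>"
    proof (intro exI[of _ N] allI impI)
      fix k l assume "k \<ge> N" "l \<ge> N"
      then have "(norm (m k - m l))\<^sup>2 < \<epsilon>\<^sup>2"
        using diff[of k l] N[of k] N[of l] by simp
      then show "dist (m k) (m l) < \<epsilon>"
        unfolding dist_norm using \<open>\<epsilon> > 0\<close> by (intro power2_less_imp_less[of _ \<epsilon>]) auto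
    qed
  qed
  then obtain m0 where m0: "m \<longlonglongrightarrow> m0"
    by (meson Cauchy_convergent convergent_def)
  then have m0M: "m0 \<in> M"
    using \<open>closed M\<close> m(1) closed_sequentially by blast
  have "norm (x - m0) \<le> d"
  proof (rule LIMSEQ_le)
    show "(\<lambda>k. norm (x - m k)) \<longlonglongrightarrow> norm (x - m0)"
      by (intro tendsto_intros m0)
    show "(\<lambda>k. d + inverse (real (Suc k))) \<longlonglongrightarrow> d"
      by (rule tendsto_eq_intros LIMSEQ_inverse_real_of_nat refl | simp)+
    show "\<exists>N. \<forall>n\<ge>N. norm (x - m n) \<le> d + inverse (real (Suc n))"
      using m(2) less_imp_le by blast
  qed
  then have nd: "norm (x - m0) = d"
    using d_le[OF m0M] by simp
  have "cinner (x - m0) n = 0" if n: "n \<in> M" for n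
  proof (rule ccontr)
    assume a0: "cinner (x - m0) n \<noteq> 0"
    define a where "a = cinner (x - m0) n"
    then have "n \<noteq> 0"
      using a0 by (auto simp: cinner.zero_right)
    define t where "t = (norm n)\<^sup>2"
    have t: "t > 0"
      using \<open>n \<noteq> 0\<close> by (simp add: t_def)
    \<comment> \<open>The coefficient \<open>a / t\<close> is the best one along \<open>n\<close>;
      it would lower the squared distance by \<open>(cmod a)\<^sup>2 / t\<close>.\<close>
    have "m0 + (a / t) *\<^sub>C n \<in> M"
      by (intro complex_vec.subspace_add complex_vec.subspace_scale M m0M n)
    from d_le[OF this] have "d\<^sup>2 \<le> (norm ((x - m0) - (a / t) *\<^sub>C n))\<^sup>2"
      using d0 by (intro power_mono) (auto simp: algebra_simps)
    also have "\<dots> = d\<^sup>2 + (cmod a)\<^sup>2 / t - 2 * Re (cnj (a / t) * a)"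
      unfolding norm_minus_sq cinner_scaleC_right norm_scaleC a_def[symmetric] nd
      using t by (simp add: norm_divide power_divide power_mult_distrib t_def[symmetric] power2_eq_square[of t])
    also have "Re (cnj (a / t) * a) = (cmod a)\<^sup>2 / t"
      unfolding cmod_power2 by (simp add: power2_eq_square add_divide_distrib)
    finally have "(cmod a)\<^sup>2 / t \<le> 0"
      by simp
    then have "a = 0"
      using t by (simp add: divide_le_0_iff)
    then show False
      using a0 a_def by simp
  qed
  with m0M that show ?thesis
    by blast
qed

text \<open>The residue of the projection onto the closure is orthogonal to \<open>M\<close>. This
  is the density test for the ranges of the powers and for the domains of adjoints and of sectorial
  operators.\<close>

lemma dense_if_orthogonal_trivial:
  fixes M :: "'a::complex_hilbert set"
  assumes "csubspace M" and "\<And>z. (\<And>m. m \<in> M \<Longrightarrow> cinner z m = 0) \<Longrightarrow> z = 0"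
  shows "closure M = UNIV"
proof (rule UNIV_eq_I[symmetric])
  fix x :: 'a
  obtain m where m: "m \<in> closure M" "\<And>n. n \<in> closure M \<Longrightarrow> cinner (x - m) n = 0"
    using orthogonal_projection[OF closed_closure csubspace_closure[OF assms(1)]] by metis
  have "x - m = 0"
    by (rule assms(2)) (use m(2) closure_subset in blast)
  then show "x \<in> closure M"
    using m(1) by simp
qed

lemma riesz_representation:
  fixes \<phi> :: "'a::complex_hilbert \<Rightarrow> complex"
  assumes "bounded_clinear \<phi>"
  obtains z where "\<And>x. \<phi> x = cinner x z"
proof (cases "\<forall>x. \<phi> x = 0")
  case True
  then show ?thesis
    by (intro that[of 0]) (simp add: cinner.zero_right)
next
  case False
  then obtain x0 where x0: "\<phi> x0 \<noteq> 0"
    by blast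
  note bl = bounded_clinear_bounded_linear[OF assms]
  have cl: "clinear \<phi>"
    using assms by (simp add: bounded_clinear_def)
  have "\<phi> -` {0} = {x. \<phi> x = 0}"
    by auto
  then have closed: "closed {x. \<phi> x = 0}"
    using continuous_closed_vimage[of "{0}" \<phi>] linear_continuous_at[OF bl] by simp
  have sub: "csubspace {x. \<phi> x = 0}"
    by (rule csubspaceI) (auto simp: clinear_zero[OF cl] clinear_add[OF cl] clinear_scaleC[OF cl])
  obtain m where m: "\<phi> m = 0" "\<And>n. \<phi> n = 0 \<Longrightarrow> cinner (x0 - m) n = 0"
    using orthogonal_projection[OF closed sub, of x0] by auto
  define e where "e = x0 - m"
  have e: "\<phi> e \<noteq> 0"
    using x0 m(1) by (simp add: e_def clinear_diff[OF cl])
  then have e0: "cinner e e \<noteq> 0"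
    using clinear_zero[OF cl] by (auto simp: cinner_self_eq_0)
  \<comment> \<open>\<open>e\<close> spans the complement of the kernel; the factor is fixed by the
    value at \<open>e\<close>, conjugated because the second argument is antilinear.\<close>
  define z where "z = (cnj (\<phi> e) / cinner e e) *\<^sub>C e"
  have real: "cnj (cinner e e) = cinner e e"
    using cinner_commute[of e e] by simp
  have "\<phi> x = cinner x z" for x
  proof -
    have "\<phi> (x - (\<phi> x / \<phi> e) *\<^sub>C e) = 0"
      using e by (simp add: clinear_diff[OF cl] clinear_scaleC[OF cl] scaleC_complex_def)
    then have "cinner e (x - (\<phi> x / \<phi> e) *\<^sub>C e) = 0"
      using m(2) e_def by blast
    then have "cinner (x - (\<phi> x / \<phi> e) *\<^sub>C e) e = 0"
      using cinner_commute by (metis complex_cnj_zero)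
    then have "cinner x e = \<phi> x / \<phi> e * cinner e e"
      by (simp add: cinner.diff_left cinner_scaleC_left)
    then show ?thesis
      using e e0 real by (simp add: z_def cinner_scaleC_right)
  qed
  then show ?thesis
    using that by blast
qed

lemma bounded_adjoint:
  fixes f :: "'a::complex_hilbert \<Rightarrow> 'b::complex_hilbert"
  assumes "bounded_clinear f"
  obtains g where "\<And>x y. cinner (f x) y = cinner x (g y)"
proof -
  obtain M where f: "clinear f" "\<And>x. norm (f x) \<le> M * norm x"
    using assms unfolding bounded_clinear_def by blast
  have "\<exists>z. \<forall>x. cinner (f x) y = cinner x z" for y
  proof -
    have "bounded_clinear (\<lambda>x. cinner (f x) y)"
    proof (rule bounded_clinearI[where M = "M * norm y"])
      show "clinear (\<lambda>x. cinner (f x) y)"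
        by (rule clinearI) (simp_all add: clinear_add[OF f(1)] clinear_scaleC[OF f(1)]
            cinner_add_left cinner_scaleC_left scaleC_complex_def)
      show "norm (cinner (f x) y) \<le> M * norm y * norm x" for x
        using order_trans[OF norm_cinner_le mult_right_mono[OF f(2)[of x], of "norm y"]]
        by (simp add: ac_simps)
    qed
    then show ?thesis
      using riesz_representation by metis
  qed
  then show ?thesis
    using that by metis
qed

lemma clinear_adjoint:
  assumes "\<And>x y. cinner (f x) y = cinner x (g y)"
  shows "clinear g"
  by (rule clinearI; rule cinner_ext) (simp_all add: assms[symmetric] cinner.add_right cinner_scaleC_right)

lemma closure_approx:
  assumes "closure M = UNIV"
  obtains f where "\<And>n::nat. f n \<in> M" and "f \<longlonglongrightarrow> (x :: 'a::metric_space)"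
  using assms closure_sequential[of x M] by auto

lemma closure_range_approx:
  assumes "closure (range g) = UNIV"
  obtains h where "(\<lambda>n::nat. g (h n)) \<longlonglongrightarrow> (x :: 'a::metric_space)"
proof -
  obtain f where f: "\<And>n::nat. f n \<in> range g" "f \<longlonglongrightarrow> x"
    using closure_approx[OF assms] by blast
  then have "\<forall>n. \<exists>h. f n = g h"
    by blast
  then obtain h where "\<And>n. f n = g (h n)"
    by metis
  then have "f = (\<lambda>n. g (h n))"
    by auto
  with f(2) that show ?thesis
    by blast
qed

lemma csubspace_range:
  assumes f: "clinear f"
  shows "csubspace (range f)"
proof (rule csubspaceI)
  show "0 \<in> range f"
    using clinear_zero[OF f] by (metis rangeI)
  show "x + y \<in> range f" if "x \<in> range f" "y \<in> range f" for x y
    using that by (auto simp: clinear_add[OF f, symmetric])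
  show "c *\<^sub>C x \<in> range f" if "x \<in> range f" for c x
    using that by (auto simp: clinear_scaleC[OF f, symmetric])
qed

section \<open>The functional calculus of a positive contraction\<close>

lemma poly_op_eq_sum:
  assumes "degree p \<le> n"
  shows "poly_op p K x = (\<Sum>i\<le>n. coeff p i *\<^sub>R (K ^^ i) x)"
  unfolding poly_op_def
  by (rule sum.mono_neutral_left) (use assms in \<open>auto simp: coeff_eq_0\<close>)

lemma poly_op_add: "poly_op (p + q) K x = poly_op p K x + poly_op q K x"
proof -
  define n where "n = max (degree p) (degree q)"
  have "degree p \<le> n" "degree q \<le> n" "degree (p + q) \<le> n"
    by (auto simp: n_def intro: degree_add_le)
  then show ?thesis
    by (simp add: poly_op_eq_sum[of _ n] scaleR_left_distrib sum.distrib)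
qed

lemma poly_op_smult: "poly_op (smult a p) K x = a *\<^sub>R poly_op p K x"
  using degree_smult_le[of a p]
  by (simp add: poly_op_eq_sum[of _ "degree p"] scaleR_sum_right)

lemma poly_op_0 [simp]: "poly_op 0 K x = 0"
  by (simp add: poly_op_def)

lemma poly_op_diff: "poly_op (p - q) K x = poly_op p K x - poly_op q K x"
  using poly_op_add[of "p - q" q K x] by simp

lemma poly_op_sum: "poly_op (sum p I) K x = (\<Sum>i\<in>I. poly_op (p i) K x)"
  by (induction I rule: infinite_finite_induct) (simp_all add: poly_op_add)

lemma poly_op_monom: "poly_op (monom 1 m) K x = (K ^^ m) x"
proof -
  have "poly_op (monom 1 m) K x = (\<Sum>i\<le>m. (if i = m then (K ^^ m) x else 0))"
    unfolding poly_op_eq_sum[OF degree_monom_le] by (intro sum.cong) auto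
  then show ?thesis
    by simp
qed

lemma poly_op_pCons:
  assumes K: "clinear K"
  shows "poly_op (pCons a p) K x = a *\<^sub>R x + K (poly_op p K x)"
proof -
  have "degree (pCons a p) \<le> Suc (degree p)"
    by (rule degree_pCons_le)
  then show ?thesis
    by (simp add: poly_op_eq_sum[of _ "Suc (degree p)"] poly_op_def sum.atMost_Suc_shift
        clinear_sum[OF K] clinear_scaleR[OF K] del: sum.atMost_Suc)
qed

lemma clinear_poly_op:
  assumes K: "clinear K"
  shows "clinear (poly_op p K)"
proof (induction p)
  case 0
  show ?case
    by (rule clinearI) simp_all
next
  case (pCons a p)
  show ?case
    by (rule clinearI)
      (simp_all add: poly_op_pCons[OF K] clinear_add[OF K] clinear_scaleC[OF K] clinear_add[OF pCons.IH]
        clinear_scaleC[OF pCons.IH] scaleC_add_right scaleR_right_distrib scaleR_scaleC scaleC_scaleC mult.commute)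
qed

lemma poly_op_mult:
  assumes K: "clinear K"
  shows "poly_op (p * q) K x = poly_op p K (poly_op q K x)"
proof (induction p)
  case (pCons a p)
  then show ?case
    by (simp add: mult_pCons_left poly_op_add poly_op_smult poly_op_pCons[OF K])
qed simp

lemma poly_op_X:
  assumes K: "clinear K"
  shows "poly_op [:0, 1:] K x = K x"
  by (simp add: poly_op_pCons[OF K] clinear_zero[OF K])

lemma poly_op_1:
  assumes K: "clinear K"
  shows "poly_op 1 K x = x"
  unfolding one_pCons by (simp add: poly_op_pCons[OF K] clinear_zero[OF K])

section \<open>Bernstein weights and the positivity of polynomials in a contraction\<close>

lemma Suc_binomial_Suc: "real (Suc m) * (k choose Suc m) = (real k - m) * (k choose m)"
proof (cases "m \<le> k")
  case True
  have "Suc m * (k choose Suc m) = (k - m) * (k choose m)"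
    by (simp only: binomial_absorption binomial_absorb_comp)
  then have "real (Suc m * (k choose Suc m)) = real ((k - m) * (k choose m))"
    by (simp only:)
  then show ?thesis
    using True by (simp only: of_nat_mult of_nat_diff)
qed (simp add: binomial_eq_0 not_le)

text \<open>The ratio is a quotient of falling factorials. Raising \<open>m\<close> by one
  multiplies it by (k - m) / (n - m), which differs from k / n by at most m / n; the errors add up
  to less than the square of \<open>m\<close> over \<open>n\<close>.\<close>

lemma binomial_ratio_approx:
  assumes "m \<le> n" "k \<le> n" "0 < n"
  shows "\<bar>real (k choose m) / (n choose m) - (k / n) ^ m\<bar> \<le> (real m)\<^sup>2 / n"
  using assms(1)
proof (induction m)
  case (Suc m)
  define a where "a = real (k choose m) / (n choose m)"
  define c where "c = real k / n"
  define d where "d = (real k - m) / (real n - m)"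
  have c: "0 \<le> c" "c \<le> 1"
    using assms by (simp_all add: c_def)
  have nm: "real n - m > 0"
    using Suc.prems by simp
  have a: "0 \<le> a" "a \<le> 1"
    using assms Suc.prems binomial_right_mono[of k n m] unfolding a_def by (auto simp: divide_le_eq)
  have rec: "real (k choose Suc m) / (n choose Suc m) = a * d"
  proof -
    have "real (j choose Suc m) = (real j - m) * (j choose m) / Suc m" for j
      using Suc_binomial_Suc[of m j] by (simp add: field_simps)
    then show ?thesis
      unfolding a_def d_def by (simp only: times_divide_times_eq) (simp add: mult.commute)
  qed
  have "\<bar>a * (d - c)\<bar> \<le> m / n"
  \<comment> \<open>For \<open>k < m\<close> the factor \<open>d\<close> need not be close to
    \<open>c\<close>, but then \<open>a\<close> is zero.\<close>
  proof (cases "k < m")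
    case True
    then show ?thesis
      by (simp add: a_def binomial_eq_0)
  next
    case False
    have "c - d = (m / n) * ((real n - k) / (real n - m))"
      using nm assms(3) unfolding c_def d_def by (simp add: field_simps)
    moreover have "0 \<le> (real n - k) / (real n - m)" "(real n - k) / (real n - m) \<le> 1"
      using nm False assms by (simp_all add: divide_le_eq)
    ultimately have "0 \<le> c - d" "c - d \<le> m / n"
      by (simp_all only: mult_left_le mult_nonneg_nonneg divide_nonneg_nonneg of_nat_0_le_iff)
    then have "\<bar>d - c\<bar> \<le> m / n"
      by linarith
    then show ?thesis
      using mult_mono[of "\<bar>a\<bar>" 1 "\<bar>d - c\<bar>" "m / n"] a by (simp add: abs_mult)
  qed
  moreover have "\<bar>(a - c ^ m) * c\<bar> \<le> (real m)\<^sup>2 / n"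
    using mult_mono[of "\<bar>a - c ^ m\<bar>" "(real m)\<^sup>2 / n" "\<bar>c\<bar>" 1] Suc c
    by (simp add: a_def c_def abs_mult)
  moreover have "a * d - c ^ Suc m = (a - c ^ m) * c + a * (d - c)"
    by (simp add: algebra_simps)
  ultimately have "\<bar>a * d - c ^ Suc m\<bar> \<le> (real m)\<^sup>2 / n + m / n"
    by linarith
  also have "\<dots> \<le> (real (Suc m))\<^sup>2 / n"
    by (simp add: add_divide_distrib[symmetric] power2_eq_square algebra_simps divide_right_mono)
  finally show ?case
    unfolding rec c_def .
qed simp

text \<open>The factorial moments of the binomial distribution: \<open>choose_mult\<close> pulls out
  \<open>n choose m\<close>, and the rest sums to one by the binomial theorem. Powers k^m would have
  moments with lower order terms; these are exact.\<close>

lemma sum_binomial_bernstein: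
  fixes t :: real
  assumes "m \<le> n"
  shows "(\<Sum>k\<le>n. real ((n choose k) * (k choose m)) * (t ^ k * (1 - t) ^ (n - k))) = (n choose m) * t ^ m"
proof -
  let ?f = "\<lambda>k. real ((n choose k) * (k choose m)) * (t ^ k * (1 - t) ^ (n - k))"
  have "sum ?f {..n} = sum ?f {m..n}"
    by (rule sum.mono_neutral_right) (auto simp: not_le)
  also have "\<dots> = (\<Sum>j=0..n - m. (n choose m) * t ^ m * (real (n - m choose j) * t ^ j * (1 - t) ^ (n - m - j)))"
    unfolding sum.atLeastAtMost_shift_0[OF assms]
  proof (rule sum.cong)
    fix j assume "j \<in> {0..n - m}"
    then have "real ((n choose (m + j)) * (m + j choose m)) = real ((n choose m) * (n - m choose j))"
      using assms choose_mult[of m "m + j" n] by auto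
    then show "(?f \<circ> plus m) j = (n choose m) * t ^ m * (real (n - m choose j) * t ^ j * (1 - t) ^ (n - m - j))"
      by (simp add: power_add)
  qed simp
  also have "\<dots> = (n choose m) * t ^ m * (\<Sum>j\<le>n - m. real (n - m choose j) * t ^ j * (1 - t) ^ (n - m - j))"
    by (simp add: sum_distrib_left atLeast0AtMost)
  also have "(\<Sum>j\<le>n - m. real (n - m choose j) * t ^ j * (1 - t) ^ (n - m - j)) = 1"
    using binomial_ring[of t "1 - t" "n - m"] by simp
  finally show ?thesis
    by simp
qed

text \<open>That the spectrum lies in [0,1] is expressed by the quadratic form alone;
  \<open>poly_op_norm_le\<close> turns this into norm estimates.\<close>

locale positive_contraction =
  fixes K :: "'a::complex_hilbert \<Rightarrow> 'a"
  assumes clin: "clinear K"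
    and selfadjoint: "cinner (K x) y = cinner x (K y)"
    and nonneg: "0 \<le> Re (cinner (K x) x)"
    and le_one: "Re (cinner (K x) x) \<le> (norm x)\<^sup>2"
begin

lemma poly_op_selfadjoint: "cinner (poly_op p K x) y = cinner x (poly_op p K y)"
proof (induction p arbitrary: x y)
  case 0
  then show ?case
    by (simp add: cinner.zero_left cinner.zero_right)
next
  case (pCons a p)
  have "poly_op p K (K y) = K (poly_op p K y)"
    using poly_op_mult[OF clin, of p "[:0, 1:]" y] poly_op_mult[OF clin, of "[:0, 1:]" p y]
    by (simp add: poly_op_X[OF clin] mult.commute)
  then show ?case
    by (simp add: poly_op_pCons[OF clin] cinner.add_left cinner.add_right selfadjoint pCons.IH
        cinner_scaleR_left cinner_scaleR_right)
qed

definition pos_poly :: "real poly \<Rightarrow> bool"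
  where "pos_poly p \<longleftrightarrow> (\<forall>x. 0 \<le> Re (cinner (poly_op p K x) x))"

lemma pos_poly_add: "pos_poly p \<Longrightarrow> pos_poly q \<Longrightarrow> pos_poly (p + q)"
  by (simp add: pos_poly_def poly_op_add cinner.add_left)

text \<open>By self-adjointness of \<open>poly_op g K\<close> the form of \<open>g * g * p\<close>
  at \<open>x\<close> is the form of \<open>p\<close> at \<open>poly_op g K x\<close>.\<close>

lemma pos_poly_square_mult:
  assumes "pos_poly p"
  shows "pos_poly (g * g * p)"
proof -
  have "cinner (poly_op (g * g * p) K x) x = cinner (poly_op p K (poly_op g K x)) (poly_op g K x)" for x
  proof -
    have "poly_op (g * g * p) K x = poly_op (g * (p * g)) K x"
      by (simp add: ac_simps)
    then show ?thesis
      by (simp add: poly_op_mult[OF clin] poly_op_selfadjoint)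
  qed
  then show ?thesis
    using assms by (simp add: pos_poly_def)
qed

lemma pos_poly_1: "pos_poly 1"
  by (simp add: pos_poly_def poly_op_1[OF clin] Re_cinner_self)

lemma pos_poly_X: "pos_poly [:0, 1:]"
  by (simp add: pos_poly_def poly_op_X[OF clin] nonneg)

lemma pos_poly_1_minus_X: "pos_poly [:1, -1:]"
proof -
  have "poly_op [:1, -1:] K x = x - K x" for x
    by (simp add: poly_op_pCons[OF clin] clinear_zero[OF clin] clinear_minus[OF clin])
  then show ?thesis
    using le_one by (simp add: pos_poly_def cinner.diff_left Re_cinner_self)
qed

text \<open>The identity t (1 - t) = t^2 (1 - t) + (1 - t)^2 t replaces the square roots that are
  usually taken to see that a product of commuting positive operators is positive.\<close>

lemma pos_poly_X_mult_1_minus_X: "pos_poly ([:0, 1:] * [:1, -1:])"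
proof -
  have eq: "[:0, 1:] * [:1, -1:] = [:0, 1:] * [:0, 1:] * [:1, -1:] + [:1, -1:] * [:1, -1:] * [:0, 1:: real:]"
    by simp
  show ?thesis
    unfolding eq by (intro pos_poly_add pos_poly_square_mult pos_poly_1_minus_X pos_poly_X)
qed

text \<open>Halving both exponents splits off a square \<open>g * g\<close>; the parities that
  remain leave four cases.\<close>

lemma pos_poly_bernstein: "pos_poly ([:0, 1:] ^ k * [:1, -1:] ^ l)"
proof -
  define e where "e = ([:0, 1:] :: real poly) ^ (k mod 2) * [:1, -1:] ^ (l mod 2)"
  define g where "g = ([:0, 1:] :: real poly) ^ (k div 2) * [:1, -1:] ^ (l div 2)"
  have "k mod 2 = 0 \<or> k mod 2 = 1" "l mod 2 = 0 \<or> l mod 2 = 1"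
    by auto
  then have "pos_poly e"
    using pos_poly_1 pos_poly_X pos_poly_1_minus_X pos_poly_X_mult_1_minus_X unfolding e_def by fastforce
  moreover have "a ^ m = a ^ (m div 2) * a ^ (m div 2) * a ^ (m mod 2)" for a :: "real poly" and m
    by (metis div_mult_mod_eq mult_2_right power_add mult.commute)
  note halve = this
  have "P ^ k * Q ^ l = (P ^ (k div 2) * Q ^ (l div 2)) * (P ^ (k div 2) * Q ^ (l div 2)) * (P ^ (k mod 2) * Q ^ (l mod 2))"
    for P Q :: "real poly"
    by (subst halve[of P k], subst halve[of Q l]) (simp only: mult_ac)
  then have "[:0, 1:] ^ k * [:1, -1:] ^ l = g * g * e"
    unfolding e_def g_def .
  ultimately show ?thesis
    using pos_poly_square_mult by simp
qed

text \<open>The numbers \<open>w k\<close> below are the values of the quadratic form at the Bernstein polynomials of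
  degree \<open>n\<close>. They act as a discrete measure on the points \<open>k / n\<close> whose factorial moments are exactly
  the numbers \<open>(K\<^sup>m x|x)\<close>.\<close>

lemma poly_op_nonneg:
  assumes "\<And>t. 0 \<le> t \<Longrightarrow> t \<le> 1 \<Longrightarrow> 0 \<le> poly p t"
  shows "0 \<le> Re (cinner (poly_op p K x) x)"
proof -
  define d where "d = degree p"
  \<comment> \<open>\<open>E / n\<close> bounds the total error when the powers of k / n in
    \<open>p\<close> are replaced by binomial ratios.\<close>
  define E where "E = (\<Sum>m\<le>d. \<bar>coeff p m\<bar> * (real m)\<^sup>2)"
  have key: "- (E * (norm x)\<^sup>2) / n \<le> Re (cinner (poly_op p K x) x)" if n: "n \<ge> d" "n > 0" for n
  proof -
    define w where "w = (\<lambda>k. real (n choose k) * Re (cinner (poly_op ([:0, 1:] ^ k * [:1, -1:] ^ (n - k)) K x) x))"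
    have w0: "0 \<le> w k" for k
      using pos_poly_bernstein unfolding w_def pos_poly_def by simp
    have moment: "(\<Sum>k\<le>n. w k * (k choose m)) = (n choose m) * Re (cinner ((K ^^ m) x) x)" if "m \<le> n" for m
    proof -
      have "(\<Sum>k\<le>n. smult (real ((n choose k) * (k choose m))) ([:0, 1:] ^ k * [:1, -1:] ^ (n - k)))
          = smult (real (n choose m)) (monom 1 m)"
        unfolding poly_eq_poly_eq_iff[symmetric] fun_eq_iff
        using sum_binomial_bernstein[OF that]
        by (simp add: poly_sum poly_monom del: of_nat_mult)
      then have "poly_op (\<Sum>k\<le>n. smult (real ((n choose k) * (k choose m))) ([:0, 1:] ^ k * [:1, -1:] ^ (n - k))) K x
          = real (n choose m) *\<^sub>R (K ^^ m) x"
        by (simp add: poly_op_smult poly_op_monom)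
      then have "Re (cinner (\<Sum>k\<le>n. real ((n choose k) * (k choose m)) *\<^sub>R
            poly_op ([:0, 1:] ^ k * [:1, -1:] ^ (n - k)) K x) x)
          = Re (cinner (real (n choose m) *\<^sub>R (K ^^ m) x) x)"
        by (simp only: poly_op_sum poly_op_smult)
      then show ?thesis
        by (simp add: cinner.sum_left cinner_scaleR_left w_def mult_ac)
    qed
    have sum_w: "(\<Sum>k\<le>n. w k) = (norm x)\<^sup>2"
      using moment[of 0] by (simp add: Re_cinner_self)
    \<comment> \<open>\<open>p\<close> is nonnegative at the node k / n; the replaced value can fall
      below zero by at most \<open>E / n\<close>.\<close>
    have node: "- (E / n) \<le> (\<Sum>m\<le>d. coeff p m * ((k choose m) / (n choose m)))" if "k \<le> n" for k
    proof -
      have "0 \<le> poly p (k / n)"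
        using that n by (intro assms) auto
      also have "poly p (k / n) = (\<Sum>m\<le>d. coeff p m * (k / n) ^ m)"
        by (simp add: poly_altdef d_def)
      finally have p0: "0 \<le> (\<Sum>m\<le>d. coeff p m * (k / n) ^ m)" .
      have "\<bar>\<Sum>m\<le>d. coeff p m * ((k choose m) / (n choose m) - (k / n) ^ m)\<bar>
          \<le> (\<Sum>m\<le>d. \<bar>coeff p m\<bar> * ((real m)\<^sup>2 / n))"
        by (rule order_trans[OF sum_abs], rule sum_mono, unfold abs_mult,
            intro mult_left_mono binomial_ratio_approx) (use n that in auto)
      also have "\<dots> = E / n"
        by (simp add: E_def sum_divide_distrib)
      finally show ?thesis
        using p0 by (simp add: right_diff_distrib sum_subtractf)
    qed
    have "Re (cinner (poly_op p K x) x) = (\<Sum>m\<le>d. coeff p m * Re (cinner ((K ^^ m) x) x))"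
      by (simp add: poly_op_def d_def cinner.sum_left cinner_scaleR_left)
    also have "\<dots> = (\<Sum>m\<le>d. coeff p m * (\<Sum>k\<le>n. w k * ((k choose m) / (n choose m))))"
    proof (rule sum.cong)
      fix m assume "m \<in> {..d}"
      then have m: "m \<le> n"
        using n by simp
      then have "real (n choose m) \<noteq> 0"
        by simp
      then show "coeff p m * Re (cinner ((K ^^ m) x) x) = coeff p m * (\<Sum>k\<le>n. w k * ((k choose m) / (n choose m)))"
        using moment[OF m] by (simp add: sum_divide_distrib[symmetric])
    qed simp
    also have "\<dots> = (\<Sum>k\<le>n. w k * (\<Sum>m\<le>d. coeff p m * ((k choose m) / (n choose m))))"
      unfolding sum_distrib_left by (subst sum.swap) (simp add: mult_ac)
    also have "\<dots> \<ge> (\<Sum>k\<le>n. w k * - (E / n))"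
      by (intro sum_mono mult_left_mono w0 node) simp
    also have "(\<Sum>k\<le>n. w k * - (E / n)) = (\<Sum>k\<le>n. w k) * - (E / n)"
      by (rule sum_distrib_right[symmetric])
    finally show ?thesis
      by (simp add: sum_w mult.commute)
  qed
  have "(\<lambda>n. - (E * (norm x)\<^sup>2) / real n) \<longlonglongrightarrow> 0"
    by (rule lim_const_over_n)
  then show ?thesis
    by (rule LIMSEQ_le_const2) (intro exI[of _ "Suc d"] allI impI key, simp_all)
qed

text \<open>The polynomial \<open>c\<^sup>2 - p\<^sup>2\<close> is nonnegative on [0,1], and by
  self-adjointness the form of \<open>p * p\<close> is the squared norm of
  \<open>poly_op p K x\<close>.\<close>

lemma poly_op_norm_le:
  assumes "\<And>t. 0 \<le> t \<Longrightarrow> t \<le> 1 \<Longrightarrow> \<bar>poly p t\<bar> \<le> c"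
  shows "norm (poly_op p K x) \<le> c * norm x"
proof -
  have "0 \<le> c"
    using assms[of 0] by simp
  have "0 \<le> Re (cinner (poly_op ([:c\<^sup>2:] - p * p) K x) x)"
  proof (rule poly_op_nonneg)
    fix t :: real assume "0 \<le> t" "t \<le> 1"
    then show "0 \<le> poly ([:c\<^sup>2:] - p * p) t"
      using power_mono[OF assms[of t], of 2] by (simp add: power2_eq_square)
  qed
  also have "poly_op ([:c\<^sup>2:] - p * p) K x = c\<^sup>2 *\<^sub>R x - poly_op p K (poly_op p K x)"
    by (simp add: poly_op_diff poly_op_mult[OF clin] poly_op_pCons[OF clin] clinear_zero[OF clin])
  finally have "(norm (poly_op p K x))\<^sup>2 \<le> (c * norm x)\<^sup>2"
    by (simp add: cinner.diff_left cinner_scaleR_left poly_op_selfadjoint[of p "poly_op p K x"] Re_cinner_self power_mult_distrib)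
  then show ?thesis
    by (rule power2_le_imp_le) (use \<open>0 \<le> c\<close> in simp)
qed

end

section \<open>Continuous functions of a positive contraction\<close>

lemma poly_approximation:
  fixes f :: "real \<Rightarrow> real"
  assumes "continuous_on {0..1} f"
  obtains p :: "nat \<Rightarrow> real poly" where "uniform_limit {0..1} (\<lambda>n. poly (p n)) f sequentially"
proof -
  define p where "p = (\<lambda>n. \<Sum>k\<le>n. smult (f (k / n) * (n choose k)) ([:0, 1:] ^ k * [:1, -1:] ^ (n - k)))"
  have "poly (p n) x = (\<Sum>k\<le>n. f (k / n) * Bernstein n k x)" for n x
    by (simp add: p_def poly_sum Bernstein_def mult_ac)
  then have "uniform_limit {0..1} (\<lambda>n. poly (p n)) f sequentially"
    unfolding uniform_limit_sequentially_iff dist_real_def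
    using Bernstein_Weierstrass[OF assms] by (metis abs_minus_commute)
  then show ?thesis
    by (rule that)
qed

context positive_contraction
begin

text \<open>By \<open>poly_op_norm_le\<close> any two approximating sequences of polynomials, and
  any two members of one, become close when applied to \<open>K\<close>. Hence the description in
  \<open>fun_calc\<close> has exactly one solution.\<close>

lemma fun_calc_limit:
  assumes f: "continuous_on {0..1} f" and p: "uniform_limit {0..1} (\<lambda>n. poly (p n)) f sequentially"
  shows "(\<lambda>n. poly_op (p n) K x) \<longlonglongrightarrow> fun_calc K f x"
proof -
  have close: "\<exists>N. \<forall>n\<ge>N. \<forall>m\<ge>N. norm (poly_op (p n) K x - poly_op (q m) K x) < e"
    if p: "uniform_limit {0..1} (\<lambda>n. poly (p n)) f sequentially"
    and q: "uniform_limit {0..1} (\<lambda>n. poly (q n)) f sequentially" and "e > 0"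
    for p q :: "nat \<Rightarrow> real poly" and e
  proof -
    define \<delta> where "\<delta> = e / (2 * (norm x + 1))"
    have \<delta>: "\<delta> > 0"
      using \<open>e > 0\<close> by (simp add: \<delta>_def add_nonneg_pos)
    obtain N1 where N1: "\<And>n t. n \<ge> N1 \<Longrightarrow> t \<in> {0..1} \<Longrightarrow> \<bar>poly (p n) t - f t\<bar> < \<delta>"
      using p \<delta> unfolding uniform_limit_sequentially_iff dist_real_def by meson
    obtain N2 where N2: "\<And>n t. n \<ge> N2 \<Longrightarrow> t \<in> {0..1} \<Longrightarrow> \<bar>poly (q n) t - f t\<bar> < \<delta>"
      using q \<delta> unfolding uniform_limit_sequentially_iff dist_real_def by meson
    have "norm (poly_op (p n) K x - poly_op (q m) K x) < e" if "n \<ge> max N1 N2" "m \<ge> max N1 N2" for n m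
    proof -
      have "norm (poly_op (p n - q m) K x) \<le> (2 * \<delta>) * norm x"
      proof (rule poly_op_norm_le)
        fix t :: real assume "0 \<le> t" "t \<le> 1"
        then show "\<bar>poly (p n - q m) t\<bar> \<le> 2 * \<delta>"
          using N1[of n t] N2[of m t] that by simp
      qed
      also have "\<dots> < 2 * \<delta> * (norm x + 1)"
        using \<delta> by simp
      also have "\<dots> = e"
        using norm_ge_zero[of x] by (simp add: \<delta>_def field_simps add_nonneg_eq_0_iff)
      finally show ?thesis
        by (simp add: poly_op_diff)
    qed
    then show ?thesis
      by blast
  qed
  have conv: "convergent (\<lambda>n. poly_op (p n) K x)"
    if "uniform_limit {0..1} (\<lambda>n. poly (p n)) f sequentially" for p
    by (intro Cauchy_convergent metric_CauchyI) (use close[OF that that] in \<open>simp add: dist_norm\<close>)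
  obtain y where y: "(\<lambda>n. poly_op (p n) K x) \<longlonglongrightarrow> y"
    using conv[OF p] by (auto simp: convergent_def)
  have y_all: "(\<lambda>n. poly_op (q n) K x) \<longlonglongrightarrow> y" if q: "uniform_limit {0..1} (\<lambda>n. poly (q n)) f sequentially" for q
  proof -
    have "(\<lambda>n. poly_op (p n) K x - poly_op (q n) K x) \<longlonglongrightarrow> 0"
      unfolding LIMSEQ_iff using close[OF p q] by simp (metis (no_types, lifting))
    from tendsto_diff[OF y this] show ?thesis
      by simp
  qed
  have "fun_calc K f x = y"
    unfolding fun_calc_def
  proof (rule the_equality)
    show "\<forall>p. uniform_limit {0..1} (\<lambda>n. poly (p n)) f sequentially \<longrightarrow> (\<lambda>n. poly_op (p n) K x) \<longlonglongrightarrow> y"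
      using y_all by blast
  next
    fix z assume "\<forall>p. uniform_limit {0..1} (\<lambda>n. poly (p n)) f sequentially \<longrightarrow> (\<lambda>n. poly_op (p n) K x) \<longlonglongrightarrow> z"
    then show "z = y"
      using p y LIMSEQ_unique by blast
  qed
  then show ?thesis
    using y by simp
qed

lemma fun_calc_poly:
  assumes "\<And>t. 0 \<le> t \<Longrightarrow> t \<le> 1 \<Longrightarrow> f t = poly p t"
  shows "fun_calc K f x = poly_op p K x"
proof -
  have u: "uniform_limit {0..1} (\<lambda>n. poly p) f sequentially"
    unfolding uniform_limit_sequentially_iff using assms by simp
  have "continuous_on {0..1} (poly p)"
    by (intro continuous_intros)
  then have "continuous_on {0..1} f"
    using assms by (simp cong: continuous_on_cong_simp)
  from fun_calc_limit[OF this u] show ?thesis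
    by (simp add: LIMSEQ_const_iff)
qed

lemma clinear_fun_calc:
  assumes f: "continuous_on {0..1} f"
  shows "clinear (fun_calc K f)"
proof -
  obtain p where p: "uniform_limit {0..1} (\<lambda>n. poly (p n)) f sequentially"
    by (rule poly_approximation[OF f])
  note lim = fun_calc_limit[OF f p] and lin = clinear_poly_op[OF clin]
  show ?thesis
  proof (rule clinearI)
    fix x y a
    show "fun_calc K f (x + y) = fun_calc K f x + fun_calc K f y"
      using lim[of "x + y"] tendsto_add[OF lim[of x] lim[of y]]
      by (simp add: clinear_add[OF lin] LIMSEQ_unique)
    show "fun_calc K f (a *\<^sub>C x) = a *\<^sub>C fun_calc K f x"
      using lim[of "a *\<^sub>C x"] scaleC.tendsto[OF tendsto_const lim[of x], of a]
      by (simp add: clinear_scaleC[OF lin] LIMSEQ_unique)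
  qed
qed

lemma fun_calc_selfadjoint:
  assumes f: "continuous_on {0..1} f"
  shows "cinner (fun_calc K f x) y = cinner x (fun_calc K f y)"
proof -
  obtain p where p: "uniform_limit {0..1} (\<lambda>n. poly (p n)) f sequentially"
    by (rule poly_approximation[OF f])
  note lim = fun_calc_limit[OF f p]
  show ?thesis
    using cinner.tendsto[OF lim[of x] tendsto_const[of y]] cinner.tendsto[OF tendsto_const[of x] lim[of y]]
    by (simp add: poly_op_selfadjoint LIMSEQ_unique)
qed

lemma fun_calc_norm_le:
  assumes f: "continuous_on {0..1} f" and c: "\<And>t. 0 \<le> t \<Longrightarrow> t \<le> 1 \<Longrightarrow> \<bar>f t\<bar> \<le> c"
  shows "norm (fun_calc K f x) \<le> c * norm x"
proof -
  obtain p where p: "uniform_limit {0..1} (\<lambda>n. poly (p n)) f sequentially"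
    by (rule poly_approximation[OF f])
  have le: "norm (fun_calc K f x) \<le> (c + e) * norm x" if e: "e > 0" for e
  proof -
    obtain N where N: "\<And>n t. n \<ge> N \<Longrightarrow> t \<in> {0..1} \<Longrightarrow> \<bar>poly (p n) t - f t\<bar> < e"
      using p e unfolding uniform_limit_sequentially_iff dist_real_def by meson
    have "norm (poly_op (p n) K x) \<le> (c + e) * norm x" if "n \<ge> N" for n
    proof (rule poly_op_norm_le)
      fix t :: real assume "0 \<le> t" "t \<le> 1"
      then show "\<bar>poly (p n) t\<bar> \<le> c + e"
        using N[OF that, of t] c[of t] by auto
    qed
    then show ?thesis
      using LIMSEQ_le_const2[OF tendsto_norm[OF fun_calc_limit[OF f p]]] by blast
  qed
  show ?thesis
  proof (rule field_le_epsilon)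
    fix e :: real assume "e > 0"
    have "norm (fun_calc K f x) \<le> (c + e / (norm x + 1)) * norm x"
      using \<open>e > 0\<close> by (intro le) (simp add: add_nonneg_pos)
    also have "\<dots> \<le> c * norm x + e"
      using \<open>e > 0\<close> norm_ge_zero[of x] by (simp add: field_simps add_nonneg_pos del: norm_ge_zero)
    finally show "norm (fun_calc K f x) \<le> c * norm x + e" .
  qed
qed

lemma fun_calc_mult:
  assumes f: "continuous_on {0..1} f" and g: "continuous_on {0..1} g"
    and h: "\<And>t. 0 \<le> t \<Longrightarrow> t \<le> 1 \<Longrightarrow> h t = f t * g t"
  shows "fun_calc K h x = fun_calc K f (fun_calc K g x)"
proof -
  obtain p where p: "uniform_limit {0..1} (\<lambda>n. poly (p n)) f sequentially"
    by (rule poly_approximation[OF f])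
  obtain q where q: "uniform_limit {0..1} (\<lambda>n. poly (q n)) g sequentially"
    by (rule poly_approximation[OF g])
  have bdd: "bounded (f ` {0..1})" "bounded (g ` {0..1})"
    by (intro compact_imp_bounded compact_continuous_image f g; simp)+
  have "uniform_limit {0..1} (\<lambda>n t. poly (p n) t * poly (q n) t) (\<lambda>t. f t * g t) sequentially"
    using bdd by (intro uniform_lim_mult p q)
  then have pq: "uniform_limit {0..1} (\<lambda>n. poly (p n * q n)) h sequentially"
    unfolding uniform_limit_sequentially_iff using h by simp
  have "continuous_on {0..1} (\<lambda>t. f t * g t)"
    by (intro continuous_intros f g)
  then have hc: "continuous_on {0..1} h"
    using h by (simp cong: continuous_on_cong_simp)
  obtain c where "\<forall>y\<in>f ` {0..1}. norm y \<le> c"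
    using bdd(1) unfolding bounded_iff by blast
  then have c: "\<bar>f t\<bar> \<le> c" if "t \<in> {0..1}" for t
    using that by simp
  obtain N where N: "\<And>n t. n \<ge> N \<Longrightarrow> t \<in> {0..1} \<Longrightarrow> \<bar>poly (p n) t - f t\<bar> < 1"
    using p zero_less_one unfolding uniform_limit_sequentially_iff dist_real_def by meson
  define y where "y = fun_calc K g x"
  define r where "r = (\<lambda>n. poly_op (q n) K x - y)"
  have r: "r \<longlonglongrightarrow> 0"
    unfolding r_def y_def using fun_calc_limit[OF g q] by (simp add: LIM_zero_iff)
  \<comment> \<open>The operators \<open>poly_op (p n) K\<close> are eventually bounded by
    \<open>c + 1\<close>, uniformly in \<open>n\<close>, so they may act on the vanishing error
    \<open>r n\<close>.\<close>
  have "norm (poly_op (p n) K (r n)) \<le> (c + 1) * norm (r n)" if "n \<ge> N" for n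
  proof (rule poly_op_norm_le)
    fix t :: real assume "0 \<le> t" "t \<le> 1"
    then show "\<bar>poly (p n) t\<bar> \<le> c + 1"
      using N[OF that, of t] c[of t] by auto
  qed
  then have "eventually (\<lambda>n. norm (poly_op (p n) K (r n)) \<le> (c + 1) * norm (r n)) sequentially"
    using eventually_sequentially by blast
  then have "(\<lambda>n. poly_op (p n) K (r n)) \<longlonglongrightarrow> 0"
    by (rule Lim_null_comparison) (use tendsto_mult_left[OF tendsto_norm_zero[OF r], of "c + 1"] in simp)
  from tendsto_add[OF this fun_calc_limit[OF f p, of y]]
  have "(\<lambda>n. poly_op (p n * q n) K x) \<longlonglongrightarrow> fun_calc K f y"
    unfolding r_def
    by (simp add: poly_op_mult[OF clin] clinear_diff[OF clinear_poly_op[OF clin]])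
  with fun_calc_limit[OF hc pq] show ?thesis
    unfolding y_def by (rule LIMSEQ_unique)
qed

end

section \<open>Fractional powers\<close>

lemma continuous_on_cont_power: "0 \<le> \<beta> \<Longrightarrow> continuous_on {0..1} (cont_power \<beta>)"
proof (cases "\<beta> = 0")
  case False
  assume "0 \<le> \<beta>"
  with False have "continuous_on {0..1} (\<lambda>t. t powr \<beta>)"
    by (intro continuous_on_powr' continuous_on_id continuous_on_const) auto
  with False show ?thesis
    by (simp add: cont_power_def[abs_def])
qed (simp add: cont_power_def[abs_def])

lemma cont_power_range: "0 \<le> \<beta> \<Longrightarrow> 0 \<le> t \<Longrightarrow> t \<le> 1 \<Longrightarrow> 0 \<le> cont_power \<beta> t \<and> cont_power \<beta> t \<le> 1"
  by (simp add: cont_power_def powr_le1)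

lemma cont_power_add: "0 \<le> \<beta> \<Longrightarrow> 0 \<le> \<gamma> \<Longrightarrow> cont_power (\<beta> + \<gamma>) t = cont_power \<beta> t * cont_power \<gamma> t"
  by (simp add: cont_power_def powr_add add_nonneg_eq_0_iff)

locale injective_positive_contraction = positive_contraction +
  assumes inj_0: "K x = 0 \<Longrightarrow> x = 0"
begin

abbreviation pw :: "real \<Rightarrow> 'a \<Rightarrow> 'a"
  where "pw \<beta> \<equiv> fun_calc K (cont_power \<beta>)"

lemma clinear_pw: "0 \<le> \<beta> \<Longrightarrow> clinear (pw \<beta>)"
  by (intro clinear_fun_calc continuous_on_cont_power)

lemma pw_selfadjoint: "0 \<le> \<beta> \<Longrightarrow> cinner (pw \<beta> x) y = cinner x (pw \<beta> y)"
  by (intro fun_calc_selfadjoint continuous_on_cont_power)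

lemma pw_norm_le: "0 \<le> \<beta> \<Longrightarrow> norm (pw \<beta> x) \<le> norm x"
  using fun_calc_norm_le[OF continuous_on_cont_power, of \<beta> 1 x] cont_power_range[of \<beta>] by simp

lemma pw_add: "0 \<le> \<beta> \<Longrightarrow> 0 \<le> \<gamma> \<Longrightarrow> pw (\<beta> + \<gamma>) x = pw \<beta> (pw \<gamma> x)"
  by (intro fun_calc_mult continuous_on_cont_power) (simp_all add: cont_power_add)

lemma pw_commute: "0 \<le> \<beta> \<Longrightarrow> 0 \<le> \<gamma> \<Longrightarrow> pw \<beta> (pw \<gamma> x) = pw \<gamma> (pw \<beta> x)"
  by (metis pw_add add.commute)

lemma pw_0: "pw 0 x = x"
  using fun_calc_poly[of "cont_power 0" 1 x] by (simp add: cont_power_def poly_op_1[OF clin])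

lemma pw_1: "pw 1 x = K x"
  using fun_calc_poly[of "cont_power 1" "[:0, 1:]" x] by (simp add: cont_power_def poly_op_X[OF clin])

lemma bounded_linear_pw: "0 \<le> \<beta> \<Longrightarrow> bounded_linear (pw \<beta>)"
  by (rule clinear_bounded_linear[where M = 1]) (simp_all add: clinear_pw pw_norm_le)

text \<open>Integer powers of \<open>K\<close> are injective by induction, and an integer power
  above \<open>\<beta>\<close> factors through \<open>pw \<beta>\<close>.\<close>

lemma pw_eq_0:
  assumes "0 \<le> \<beta>" and "pw \<beta> x = 0"
  shows "x = 0"
proof -
  have "pw (real n) x = 0 \<Longrightarrow> x = 0" for n
  proof (induction n)
    case (Suc n)
    have "pw (real (Suc n)) x = K (pw (real n) x)"
      using pw_add[of 1 "real n" x] by (simp add: pw_1 add.commute)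
    with Suc inj_0 show ?case
      by auto
  qed (simp add: pw_0)
  moreover obtain n where n: "\<beta> \<le> real n"
    using real_arch_simple by blast
  have "pw (real n) x = pw (real n - \<beta>) (pw \<beta> x)"
    using pw_add[of "real n - \<beta>" \<beta> x] n assms(1) by simp
  then have "pw (real n) x = 0"
    using assms n by (simp add: clinear_zero[OF clinear_pw])
  ultimately show ?thesis
    by blast
qed

lemma inj_pw: "0 \<le> \<beta> \<Longrightarrow> inj (pw \<beta>)"
  by (rule injI) (metis clinear_diff[OF clinear_pw] pw_eq_0 eq_iff_diff_eq_0)

lemma csubspace_range_pw: "0 \<le> \<beta> \<Longrightarrow> csubspace (range (pw \<beta>))"
  by (intro csubspace_range clinear_pw)

lemma dense_range_pw:
  assumes "0 \<le> \<beta>"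
  shows "closure (range (pw \<beta>)) = UNIV"
proof (rule dense_if_orthogonal_trivial[OF csubspace_range_pw[OF assms]])
  fix z assume "\<And>m. m \<in> range (pw \<beta>) \<Longrightarrow> cinner z m = 0"
  then have "cinner (pw \<beta> z) (pw \<beta> z) = 0"
    by (simp add: pw_selfadjoint[OF assms])
  then show "z = 0"
    using pw_eq_0[OF assms] by (simp add: cinner_self_eq_0)
qed

text \<open>Splitting off the half power writes the form as a squared norm. The result allows powers
  of powers: \<open>Lam A\<close> comes from the power 1/2 of one contraction, and the scale uses
  powers of \<open>Lam A\<close>.\<close>

lemma injective_positive_contraction_pw:
  assumes "0 \<le> \<beta>"
  shows "injective_positive_contraction (pw \<beta>)"
proof
  show "clinear (pw \<beta>)"
    by (rule clinear_pw[OF assms])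
  fix x y
  show "cinner (pw \<beta> x) y = cinner x (pw \<beta> y)"
    by (rule pw_selfadjoint[OF assms])
  have "pw \<beta> x = pw (\<beta> / 2) (pw (\<beta> / 2) x)"
    using pw_add[of "\<beta> / 2" "\<beta> / 2" x] assms by simp
  then have "cinner (pw \<beta> x) x = cinner (pw (\<beta> / 2) x) (pw (\<beta> / 2) x)"
    using assms by (simp add: pw_selfadjoint)
  then have eq: "Re (cinner (pw \<beta> x) x) = (norm (pw (\<beta> / 2) x))\<^sup>2"
    by (simp add: Re_cinner_self)
  show "0 \<le> Re (cinner (pw \<beta> x) x)"
    unfolding eq by simp
  show "Re (cinner (pw \<beta> x) x) \<le> (norm x)\<^sup>2"
    unfolding eq using assms by (intro power_mono pw_norm_le) auto
  show "pw \<beta> x = 0 \<Longrightarrow> x = 0"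
    by (rule pw_eq_0[OF assms])
qed

end

section \<open>Closed densely defined operators\<close>

lemma linear_opI:
  assumes "T 0 = Some 0"
    and "\<And>x x' y y'. T x = Some y \<Longrightarrow> T x' = Some y' \<Longrightarrow> T (x + x') = Some (y + y')"
    and "\<And>c x y. T x = Some y \<Longrightarrow> T (c *\<^sub>C x) = Some (c *\<^sub>C y)"
  shows "linear_op T"
  unfolding linear_op_def
proof (intro conjI ballI allI)
  show "csubspace (dom T)"
    by (rule csubspaceI) (use assms in blast)+
qed (use assms in auto)

lemma linear_op_add:
  assumes "linear_op T" "T x = Some y" "T x' = Some y'"
  shows "T (x + x') = Some (y + y')"
proof -
  have x: "x \<in> dom T" "x' \<in> dom T"
    using assms by auto
  then have "x + x' \<in> dom T"
    using assms(1) unfolding linear_op_def by (metis complex_vec.subspace_add)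
  moreover have "the (T (x + x')) = the (T x) + the (T x')"
    using x assms(1) by (auto simp: linear_op_def)
  ultimately show ?thesis
    using assms(2,3) by auto
qed

lemma linear_op_scaleC:
  assumes "linear_op T" "T x = Some y"
  shows "T (c *\<^sub>C x) = Some (c *\<^sub>C y)"
proof -
  have x: "x \<in> dom T"
    using assms by auto
  then have "c *\<^sub>C x \<in> dom T"
    using assms(1) unfolding linear_op_def by (metis complex_vec.subspace_scale)
  moreover have "the (T (c *\<^sub>C x)) = c *\<^sub>C the (T x)"
    using x assms(1) by (auto simp: linear_op_def)
  ultimately show ?thesis
    using assms(2) by auto
qed

lemma linear_op_zero: "linear_op T \<Longrightarrow> T 0 = Some 0"
proof -
  assume T: "linear_op T"
  then have "0 \<in> dom T"
    unfolding linear_op_def by (metis complex_vec.subspace_0)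
  then obtain y where "T 0 = Some y"
    by auto
  from linear_op_scaleC[OF T this, of 0] show ?thesis
    by simp
qed

lemma linear_op_minus: "linear_op T \<Longrightarrow> T x = Some y \<Longrightarrow> T (- x) = Some (- y)"
  using linear_op_scaleC[of T x y "- 1"] by simp

lemma linear_op_diff:
  "linear_op T \<Longrightarrow> T x = Some y \<Longrightarrow> T x' = Some y' \<Longrightarrow> T (x - x') = Some (y - y')"
  using linear_op_add[of T x y "- x'" "- y'"] linear_op_minus[of T x' y'] by simp

lemma linear_op_csubspace_dom: "linear_op T \<Longrightarrow> csubspace (dom T)"
  by (simp add: linear_op_def)

lemma closed_op_limit:
  assumes "closed_op T" "\<And>n::nat. T (f n) = Some (g n)" "f \<longlonglongrightarrow> x" "g \<longlonglongrightarrow> y"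
  shows "T x = Some y"
proof -
  have "(x, y) \<in> {(x, y). T x = Some y}"
    using assms closed_sequentially[of "{(x, y). T x = Some y}" "\<lambda>n. (f n, g n)" "(x, y)"]
    by (auto simp: closed_op_def intro: tendsto_Pair)
  then show ?thesis
    by simp
qed

lemma closed_opI:
  assumes "linear_op T"
    and "\<And>f g x y. (\<And>n::nat. T (f n) = Some (g n)) \<Longrightarrow> f \<longlonglongrightarrow> x \<Longrightarrow> g \<longlonglongrightarrow> y \<Longrightarrow> T x = Some y"
  shows "closed_op T"
  unfolding closed_op_def
proof (intro conjI assms(1))
  show "closed {(x, y). T x = Some y}"
    unfolding closed_sequential_limits
  proof (intro allI impI, elim conjE)
    fix p l assume p: "\<forall>n::nat. p n \<in> {(x, y). T x = Some y}" "p \<longlonglongrightarrow> l"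
    have "T (fst l) = Some (snd l)"
      by (rule assms(2)[of "\<lambda>n. fst (p n)" "\<lambda>n. snd (p n)"])
        (use p in \<open>auto intro: tendsto_fst tendsto_snd simp: case_prod_beta\<close>)
    then show "l \<in> {(x, y). T x = Some y}"
      by (simp add: case_prod_beta)
  qed
qed

text \<open>Linearity gives the claim for polynomials; closedness of the unbounded \<open>T\<close>
  carries it to their limits.\<close>

lemma fun_calc_intertwine:
  assumes T: "closed_op T" and K1: "positive_contraction K1" and K2: "positive_contraction K2"
    and KT: "\<And>x y. T x = Some y \<Longrightarrow> T (K1 x) = Some (K2 y)"
    and f: "continuous_on {0..1} f" and xy: "T x = Some y"
  shows "T (fun_calc K1 f x) = Some (fun_calc K2 f y)"
proof -
  interpret K1: positive_contraction K1 by fact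
  interpret K2: positive_contraction K2 by fact
  have lin: "linear_op T"
    using T by (simp add: closed_op_def)
  have poly: "T (poly_op p K1 x) = Some (poly_op p K2 y)" for p
  proof (induction p)
    case 0
    show ?case
      by (simp add: linear_op_zero[OF lin])
  next
    case (pCons a p)
    show ?case
      unfolding poly_op_pCons[OF K1.clin] poly_op_pCons[OF K2.clin] scaleR_scaleC
      by (intro linear_op_add[OF lin] linear_op_scaleC[OF lin] xy KT pCons.IH)
  qed
  obtain p where p: "uniform_limit {0..1} (\<lambda>n. poly (p n)) f sequentially"
    by (rule poly_approximation[OF f])
  show ?thesis
    by (rule closed_op_limit[OF T poly K1.fun_calc_limit[OF f p] K2.fun_calc_limit[OF f p]])
qed

lemma cinner_eq_0_commute: "cinner x y = 0 \<longleftrightarrow> cinner y x = 0"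
  by (metis cinner_commute complex_cnj_zero)

lemma cinner_flip: "cinner a b = cinner c d \<Longrightarrow> cinner b a = cinner d c"
  by (metis cinner_commute)

text \<open>Density makes the representing vector unique, which removes the unique existence from
  the definition of \<open>adj\<close>.\<close>

lemma adj_eq_Some_iff:
  assumes dense: "closure (dom T) = UNIV"
  shows "adj T y = Some z \<longleftrightarrow> (\<forall>x w. T x = Some w \<longrightarrow> cinner w y = cinner x z)"
proof -
  let ?P = "\<lambda>z. \<forall>x\<in>dom T. cinner (the (T x)) y = cinner x z"
  have P_iff: "?P z \<longleftrightarrow> (\<forall>x w. T x = Some w \<longrightarrow> cinner w y = cinner x z)" for z
    by force
  have uniq: "z = z'" if "?P z" "?P z'" for z z'
  proof -
    have "cinner (z - z') x = 0" if "x \<in> dom T" for x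
      using \<open>?P z\<close> \<open>?P z'\<close> that by (subst cinner_eq_0_commute) (simp add: cinner.diff_right)
    then have "cinner (z - z') (z - z') = 0"
      using cinner_eq_0_closure[of "dom T" "z - z'" "z - z'"] dense by simp
    then show ?thesis
      by (simp add: cinner_self_eq_0)
  qed
  show ?thesis
  proof
    assume "adj T y = Some z"
    then have ex: "\<exists>!z. ?P z" and z: "z = (THE z. ?P z)"
      unfolding adj_def by (auto split: if_splits)
    from theI'[OF ex] show "\<forall>x w. T x = Some w \<longrightarrow> cinner w y = cinner x z"
      unfolding z by (simp add: P_iff)
  next
    assume "\<forall>x w. T x = Some w \<longrightarrow> cinner w y = cinner x z"
    then have z: "?P z"
      by (simp add: P_iff)
    then have ex: "\<exists>!z. ?P z"
      using uniq by blast
    moreover have "(THE z. ?P z) = z"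
      using z uniq by (intro the_equality) auto
    ultimately show "adj T y = Some z"
      by (simp add: adj_def)
  qed
qed

locale closed_dense =
  fixes A :: "'h::complex_hilbert \<rightharpoonup> 'h"
  assumes closed_op: "closed_op A" and dense: "closure (dom A) = UNIV"
begin

lemma linear_op: "linear_op A"
  using closed_op by (simp add: closed_op_def)

lemmas adj_iff = adj_eq_Some_iff[OF dense]

lemma adj_cinner:
  assumes "adj A v = Some w" "A x = Some y"
  shows "cinner y v = cinner x w" and "cinner v y = cinner w x"
  using assms adj_iff[of v w] by (auto intro: cinner_flip)

lemma closed_op_adj: "closed_op (adj A)"
proof (rule closed_opI)
  show "linear_op (adj A)"
    by (rule linear_opI)
      (simp_all add: adj_iff cinner.zero_right cinner.add_right cinner_scaleC_right)
next
  fix f g x y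
  assume fg: "\<And>n::nat. adj A (f n) = Some (g n)" "f \<longlonglongrightarrow> x" "g \<longlonglongrightarrow> y"
  have "cinner w x = cinner v y" if "A v = Some w" for v w
  proof -
    have "(\<lambda>n. cinner w (f n)) \<longlonglongrightarrow> cinner w x" "(\<lambda>n. cinner v (g n)) \<longlonglongrightarrow> cinner v y"
      by (intro cinner.tendsto tendsto_const fg)+
    moreover have "cinner w (f n) = cinner v (g n)" for n
      using adj_cinner(1)[OF fg(1) that] .
    ultimately show ?thesis
      using LIMSEQ_unique by simp
  qed
  then show "adj A x = Some y"
    by (simp add: adj_iff)
qed

lemma linear_op_adj: "linear_op (adj A)"
  using closed_op_adj by (simp add: closed_op_def)

text \<open>The graph of \<open>A\<close> and the rotated graph of \<open>A\<^sup>*\<close> are orthogonal complements.\<close>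

lemma graph_decomposition:
  obtains x y v w where "A x = Some y" "adj A v = Some w" "h = x - w" "k = y + v"
proof -
  define G where "G = {(x, y). A x = Some y}"
  have "closed G"
    using closed_op by (simp add: closed_op_def G_def)
  moreover have "csubspace G"
    by (rule csubspaceI)
      (auto simp: G_def zero_prod_def scaleC_prod_def intro: linear_op_zero[OF linear_op] linear_op_add[OF linear_op] linear_op_scaleC[OF linear_op])
  ultimately obtain m where m: "m \<in> G" "\<And>n. n \<in> G \<Longrightarrow> cinner ((h, k) - m) n = 0"
    using orthogonal_projection by blast
  obtain x y where xy: "m = (x, y)" "A x = Some y"
    using m(1) by (auto simp: G_def)
  have "cinner b (k - y) = cinner a (x - h)" if "A a = Some b" for a b
  proof -
    have "cinner (h - x) a + cinner (k - y) b = 0"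
      using m(2)[of "(a, b)"] that by (simp add: G_def xy cinner_prod_def)
    then have "cinner (k - y) b = cinner (x - h) a"
      by (simp add: cinner.diff_left algebra_simps)
    then show ?thesis
      by (rule cinner_flip)
  qed
  then have "adj A (k - y) = Some (x - h)"
    by (simp add: adj_iff)
  with xy show ?thesis
    by (intro that[of x y "k - y" "x - h"]) simp_all
qed

lemma dense_adj: "closure (dom (adj A)) = UNIV"
proof (rule dense_if_orthogonal_trivial[OF linear_op_csubspace_dom[OF linear_op_adj]])
  fix z assume z: "\<And>m. m \<in> dom (adj A) \<Longrightarrow> cinner z m = 0"
  \<comment> \<open>Decomposing the pair (0, z) makes \<open>x = w\<close>, so that (y|v) = (x|w)
    becomes (w|w).\<close>
  obtain x y v w where d: "A x = Some y" "adj A v = Some w" "0 = x - w" "z = y + v"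
    by (rule graph_decomposition)
  have "0 = cinner z v"
    using z d(2) by auto
  also have "\<dots> = cinner w w + cinner v v"
    using adj_cinner(1)[OF d(2) d(1)] d(3,4) by (simp add: cinner.add_left)
  finally have "w = 0" "v = 0"
    using cinner_self_add_eq_0[of w v] by simp_all
  then show "z = 0"
    using d linear_op_zero[OF linear_op] by simp
qed

lemma adj_adj: "adj (adj A) = A"
proof
  fix x
  have iff: "adj (adj A) x = Some y \<longleftrightarrow> (\<forall>v w. adj A v = Some w \<longrightarrow> cinner w x = cinner v y)" for y
    by (rule adj_eq_Some_iff[OF dense_adj])
  have 1: "adj (adj A) x = Some y" if "A x = Some y" for y
    unfolding iff using adj_cinner(2)[OF _ that] by simp
  have 2: "A x = Some y" if "adj (adj A) x = Some y" for y
  proof -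
    \<comment> \<open>The part (-w, v) of (x, y) in the rotated graph is orthogonal both to (x, y)
      and to the graph part (a, b), hence to itself.\<close>
    obtain a b v w where d: "A a = Some b" "adj A v = Some w" "x = a - w" "y = b + v"
      by (rule graph_decomposition)
    have "cinner w x = cinner v y"
      using that d(2) iff by blast
    moreover have "cinner w a = cinner v b"
      using adj_cinner(2)[OF d(2,1)] by simp
    ultimately have "- cinner w w = cinner v v"
      using d(3,4) by (simp add: cinner.diff_right cinner.add_right)
    then have "cinner v v + cinner w w = 0"
      by (metis ab_left_minus add.commute)
    from cinner_self_add_eq_0[OF this] d show ?thesis
      by simp
  qed
  show "adj (adj A) x = A x"
    using 1 2 by (cases "A x"; cases "adj (adj A) x") auto
qed

lemma closed_dense_adj: "closed_dense (adj A)"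
  by unfold_locales (rule closed_op_adj dense_adj)+

end

section \<open>The operators of the two scales\<close>

text \<open>In the usual notation \<open>lam_K A\<close> is the inverse of I + A A', where A' is the
  adjoint, \<open>lam_Q A\<close> the inverse of its square root and \<open>lam_F A \<beta>\<close>
  the power -\<beta> of that square root. \<open>lam_F\<close> is a function of \<open>lam_Q\<close>
  and not of \<open>lam_K\<close> with a halved exponent because \<open>op_powr\<close> applied to
  \<open>Lam A\<close> unfolds in this way.\<close>

definition lam_K :: "('h::complex_hilbert \<rightharpoonup> 'h) \<Rightarrow> 'h \<Rightarrow> 'h"
  where "lam_K A y = the (op_inv (op_shift (A \<circ>\<^sub>m adj A) (- 1)) y)"

definition lam_Q :: "('h::complex_hilbert \<rightharpoonup> 'h) \<Rightarrow> 'h \<Rightarrow> 'h"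
  where "lam_Q A = fun_calc (lam_K A) (cont_power (1 / 2))"

definition lam_F :: "('h::complex_hilbert \<rightharpoonup> 'h) \<Rightarrow> real \<Rightarrow> 'h \<Rightarrow> 'h"
  where "lam_F A \<beta> = fun_calc (lam_Q A) (cont_power \<beta>)"

lemma op_inv_eq_Some_iff: "op_inv T y = Some x \<longleftrightarrow> T x = Some y \<and> (\<forall>x'. T x' = Some y \<longrightarrow> x' = x)"
proof (cases "\<exists>!x. T x = Some y")
  case True
  define x0 where "x0 = (THE x. T x = Some y)"
  have "op_inv T y = Some x0"
    unfolding op_inv_def x0_def using True by (rule if_P)
  moreover have "T x0 = Some y"
    unfolding x0_def by (rule theI'[OF True])
  moreover have "x' = x0" if "T x' = Some y" for x'
    unfolding x0_def by (rule the1_equality[OF True that, symmetric])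
  ultimately show ?thesis
    by (metis option.inject)
next
  case False
  then have "op_inv T y = None"
    unfolding op_inv_def by (rule if_not_P)
  with False show ?thesis
    by (metis option.distinct(1))
qed

lemma op_inv_Some_iff: "inj f \<Longrightarrow> op_inv (\<lambda>x. Some (f x)) y = Some x \<longleftrightarrow> y = f x"
  by (auto simp: op_inv_eq_Some_iff dest: injD)

lemma op_inv_op_inv_Some:
  assumes "inj f"
  shows "op_inv (op_inv (\<lambda>x. Some (f x))) = (\<lambda>x. Some (f x))"
proof
  fix y
  have "op_inv (op_inv (\<lambda>x. Some (f x))) y = Some (f y)"
    using assms by (auto simp: op_inv_eq_Some_iff dest: injD)
  then show "op_inv (op_inv (\<lambda>x. Some (f x))) y = Some (f y)" .
qed

context closed_dense
begin

lemma lam_K_eqI: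
  assumes "adj A v = Some w" "A w = Some u" "u + v = k"
  shows "lam_K A k = v"
proof -
  have shift: "op_shift (A \<circ>\<^sub>m adj A) (- 1) v = Some k
      \<longleftrightarrow> (\<exists>w u. adj A v = Some w \<and> A w = Some u \<and> u + v = k)" for v k
    by (auto simp: emb_shift_def map_comp_def split: option.splits)
  have "v' = v" if "op_shift (A \<circ>\<^sub>m adj A) (- 1) v' = Some k" for v'
  proof -
    obtain w' u' where "adj A v' = Some w'" "A w' = Some u'" "u' + v' = k"
      using \<open>op_shift _ _ v' = Some k\<close> shift by blast
    define a b c where "a = v' - v" and "b = w' - w" and "c = u' - u"
    have ab: "adj A a = Some b" "A b = Some c"
      unfolding a_def b_def c_def by (intro linear_op_diff linear_op_adj linear_op; fact)+
    \<comment> \<open>The difference of two solutions satisfies A A' a = -a, so the squared norms of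
      \<open>a\<close> and of A' a add up to zero.\<close>
    have "c = - a"
      using \<open>u + v = k\<close> \<open>u' + v' = k\<close> by (simp add: a_def c_def algebra_simps)
    then have "- cinner a a = cinner b b"
      using adj_cinner(1)[OF ab] by (simp add: cinner.minus_left)
    then have "cinner b b + cinner a a = 0"
      by (metis ab_left_minus)
    from cinner_self_add_eq_0(2)[OF this] show ?thesis
      by (simp add: a_def)
  qed
  moreover have "op_shift (A \<circ>\<^sub>m adj A) (- 1) v = Some k"
    using assms shift by blast
  ultimately have "op_inv (op_shift (A \<circ>\<^sub>m adj A) (- 1)) k = Some v"
    unfolding op_inv_eq_Some_iff by blast
  then show ?thesis
    by (simp add: lam_K_def)
qed

text \<open>Von Neumann's argument: decomposing (0, k) along the graph and the rotated graph solves
  (I + A A') v = k.\<close>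

lemma lam_K_ex:
  obtains w u where "adj A (lam_K A k) = Some w" "A w = Some u" "u + lam_K A k = k"
proof -
  obtain x y v w where d: "A x = Some y" "adj A v = Some w" "0 = x - w" "k = y + v"
    by (rule graph_decomposition)
  then have "lam_K A k = v"
    by (intro lam_K_eqI[of v w y]) simp_all
  with d that[of w y] show ?thesis
    by simp
qed

sublocale K: injective_positive_contraction "lam_K A"
proof
  \<comment> \<open>This expression of (K x|y) by A' K x, A' K y, K x and K y is symmetric in
    \<open>x\<close> and \<open>y\<close> and positive for \<open>x = y\<close>.\<close>
  have K2: "cinner (lam_K A x) y = cinner w w' + cinner (lam_K A x) (lam_K A y)"
    if "adj A (lam_K A x) = Some w" "A w = Some u" "u + lam_K A x = x"
      "adj A (lam_K A y) = Some w'" "A w' = Some u'" "u' + lam_K A y = y" for x y w u w' u'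
  proof -
    have "cinner (lam_K A x) y = cinner (lam_K A x) u' + cinner (lam_K A x) (lam_K A y)"
      by (subst that(6)[symmetric]) (simp only: cinner.add_right)
    then show ?thesis
      using adj_cinner(2)[OF that(1,5)] by simp
  qed
  show "clinear (lam_K A)"
  proof (rule clinearI)
    fix x y a
    obtain w u where x: "adj A (lam_K A x) = Some w" "A w = Some u" "u + lam_K A x = x"
      by (rule lam_K_ex)
    obtain w' u' where y: "adj A (lam_K A y) = Some w'" "A w' = Some u'" "u' + lam_K A y = y"
      by (rule lam_K_ex)
    show "lam_K A (x + y) = lam_K A x + lam_K A y"
    proof (rule lam_K_eqI)
      show "adj A (lam_K A x + lam_K A y) = Some (w + w')" "A (w + w') = Some (u + u')"
        by (intro linear_op_add linear_op_adj linear_op x y)+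
      have "u + u' + (lam_K A x + lam_K A y) = (u + lam_K A x) + (u' + lam_K A y)"
        by simp
      then show "u + u' + (lam_K A x + lam_K A y) = x + y"
        by (simp only: x y)
    qed
    show "lam_K A (a *\<^sub>C x) = a *\<^sub>C lam_K A x"
    proof (rule lam_K_eqI)
      show "adj A (a *\<^sub>C lam_K A x) = Some (a *\<^sub>C w)" "A (a *\<^sub>C w) = Some (a *\<^sub>C u)"
        by (intro linear_op_scaleC linear_op_adj linear_op x)+
      show "a *\<^sub>C u + a *\<^sub>C lam_K A x = a *\<^sub>C x"
        by (simp only: scaleC_add_right[symmetric] x)
    qed
  qed
  fix x y
  obtain w u where x: "adj A (lam_K A x) = Some w" "A w = Some u" "u + lam_K A x = x"
    by (rule lam_K_ex)
  obtain w' u' where y: "adj A (lam_K A y) = Some w'" "A w' = Some u'" "u' + lam_K A y = y"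
    by (rule lam_K_ex)
  have "cinner (lam_K A y) x = cinner w' w + cinner (lam_K A y) (lam_K A x)"
    by (rule K2[OF y x])
  then have "cinner x (lam_K A y) = cinner w w' + cinner (lam_K A x) (lam_K A y)"
    by (metis cinner_commute complex_cnj_add)
  then show "cinner (lam_K A x) y = cinner x (lam_K A y)"
    using K2[OF x y] by simp
  have form: "Re (cinner (lam_K A x) x) = (norm w)\<^sup>2 + (norm (lam_K A x))\<^sup>2"
    by (subst K2[OF x x]) (simp add: Re_cinner_self)
  then show "0 \<le> Re (cinner (lam_K A x) x)"
    by simp
  have le: "Re (cinner (lam_K A x) x) \<le> norm (lam_K A x) * norm x"
    using complex_Re_le_cmod norm_cinner_le order_trans by blast
  then have "(norm (lam_K A x))\<^sup>2 \<le> norm (lam_K A x) * norm x"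
    using form zero_le_power2[of "norm w"] by linarith
  then have "norm (lam_K A x) * norm (lam_K A x) \<le> norm (lam_K A x) * norm x"
    by (simp add: power2_eq_square)
  then have "norm (lam_K A x) \<le> norm x"
    by (cases "lam_K A x = 0") auto
  then have "norm (lam_K A x) * norm x \<le> norm x * norm x"
    by (rule mult_right_mono) simp
  with le show "Re (cinner (lam_K A x) x) \<le> (norm x)\<^sup>2"
    by (simp add: power2_eq_square)
  assume "lam_K A x = 0"
  then show "x = 0"
    using x linear_op_zero[OF linear_op] linear_op_zero[OF linear_op_adj] by simp
qed

sublocale Q: injective_positive_contraction "lam_Q A"
  unfolding lam_Q_def by (rule K.injective_positive_contraction_pw) simp

lemma lam_K_eq_Q_Q: "lam_K A x = lam_Q A (lam_Q A x)"
  using K.pw_add[of "1/2" "1/2" x] by (simp add: K.pw_1 lam_Q_def)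

lemma op_powr_Lam:
  "op_powr (Lam A) \<alpha> = (if \<alpha> \<le> 0 then (\<lambda>x. Some (lam_F A (- \<alpha>) x)) else op_inv (\<lambda>x. Some (lam_F A \<alpha> x)))"
proof -
  have "Lam A = op_inv (\<lambda>x. Some (lam_Q A x))"
    unfolding Lam_def op_powr_def lam_Q_def lam_K_def[abs_def] by (simp add: Let_def)
  moreover have "inj (lam_Q A)"
    unfolding lam_Q_def by (rule K.inj_pw) simp
  ultimately have "op_inv (Lam A) = (\<lambda>x. Some (lam_Q A x))"
    by (simp add: op_inv_op_inv_Some)
  then show ?thesis
    unfolding op_powr_def lam_F_def by (simp add: Let_def)
qed

lemma op_powr_Lam_neg: "0 \<le> \<alpha> \<Longrightarrow> op_powr (Lam A) (- \<alpha>) x = Some (lam_F A \<alpha> x)"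
  by (simp add: op_powr_Lam)

lemma op_powr_Lam_eq_Some_iff: "0 \<le> \<alpha> \<Longrightarrow> op_powr (Lam A) \<alpha> x = Some z \<longleftrightarrow> x = lam_F A \<alpha> z"
proof -
  assume \<alpha>: "0 \<le> \<alpha>"
  show ?thesis
  \<comment> \<open>The exponent zero falls into the branch of \<open>op_powr\<close> without an
    inverse.\<close>
  proof (cases "\<alpha> = 0")
    case True
    then show ?thesis
      by (auto simp: op_powr_Lam lam_F_def Q.pw_0)
  next
    case False
    with \<alpha> show ?thesis
      using op_inv_Some_iff[OF Q.inj_pw[OF \<alpha>]] by (simp add: op_powr_Lam lam_F_def)
  qed
qed

lemma dom_op_powr_Lam: "0 \<le> \<alpha> \<Longrightarrow> dom (op_powr (Lam A) \<alpha>) = range (lam_F A \<alpha>)"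
  by (auto simp: dom_def op_powr_Lam_eq_Some_iff)

lemma lam_F_1: "lam_F A 1 x = lam_Q A x"
  by (simp add: lam_F_def Q.pw_1)

lemma lam_F_add: "0 \<le> \<beta> \<Longrightarrow> 0 \<le> \<gamma> \<Longrightarrow> lam_F A (\<beta> + \<gamma>) x = lam_F A \<beta> (lam_F A \<gamma> x)"
  unfolding lam_F_def by (rule Q.pw_add)

lemma lam_F_split: "0 \<le> \<beta> \<Longrightarrow> \<beta> \<le> \<gamma> \<Longrightarrow> lam_F A \<gamma> x = lam_F A \<beta> (lam_F A (\<gamma> - \<beta>) x)"
  using lam_F_add[of \<beta> "\<gamma> - \<beta>" x] by simp

lemma lam_F_selfadjoint: "0 \<le> \<beta> \<Longrightarrow> cinner (lam_F A \<beta> x) y = cinner x (lam_F A \<beta> y)"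
  unfolding lam_F_def by (rule Q.pw_selfadjoint)

lemma clinear_lam_F: "0 \<le> \<beta> \<Longrightarrow> clinear (lam_F A \<beta>)"
  unfolding lam_F_def by (rule Q.clinear_pw)

lemma lam_F_norm_le: "0 \<le> \<beta> \<Longrightarrow> norm (lam_F A \<beta> x) \<le> norm x"
  unfolding lam_F_def by (rule Q.pw_norm_le)

lemma bounded_linear_lam_F: "0 \<le> \<beta> \<Longrightarrow> bounded_linear (lam_F A \<beta>)"
  unfolding lam_F_def by (rule Q.bounded_linear_pw)

lemma inj_lam_F: "0 \<le> \<beta> \<Longrightarrow> inj (lam_F A \<beta>)"
  unfolding lam_F_def by (rule Q.inj_pw)

lemma dense_range_lam_F: "0 \<le> \<beta> \<Longrightarrow> closure (range (lam_F A \<beta>)) = UNIV"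
  unfolding lam_F_def by (rule Q.dense_range_pw)

end

text \<open>Every closed densely defined operator qualifies; the locale makes all facts available
  for \<open>adj A\<close> too, under the prefix \<open>star\<close>, and \<open>adj_adj\<close>
  lets the two operators change roles.\<close>

locale closed_dense_pair = closed_dense +
  star: closed_dense "adj A"

lemma (in closed_dense) closed_dense_pair: "closed_dense_pair A"
  by (rule closed_dense_pair.intro[OF closed_dense_axioms closed_dense_adj])

context closed_dense_pair
begin

lemma closed_dense_pair_adj: "closed_dense_pair (adj A)"
  unfolding closed_dense_pair_def adj_adj using closed_dense_axioms star.closed_dense_axioms by simp

lemma Lam_star_eq: "Lam_star A = Lam (adj A)"
  by (simp add: Lam_star_def Lam_def adj_adj)

text \<open>With k = (I + A' A)^-1 x and w = A k, applying \<open>A\<close> to A' w = x - k gives (I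
  + A A') w = y.\<close>

lemma lam_K_intertwine:
  assumes xy: "A x = Some y"
  shows "A (lam_K (adj A) x) = Some (lam_K A y)"
proof -
  define k where "k = lam_K (adj A) x"
  obtain w u where k: "A k = Some w" "adj A w = Some u" "u + k = x"
    using star.lam_K_ex[of x] unfolding adj_adj k_def by metis
  have "A (x - k) = Some (y - w)"
    by (rule linear_op_diff[OF linear_op xy k(1)])
  then have "A u = Some (y - w)"
    using k(3) by (metis add_diff_cancel_right')
  then have "lam_K A y = w"
    by (intro lam_K_eqI[OF k(2), of "y - w"]) simp_all
  then show ?thesis
    using k(1) k_def by simp
qed

lemma lam_Q_intertwine: "A x = Some y \<Longrightarrow> A (lam_Q (adj A) x) = Some (lam_Q A y)"
  unfolding lam_Q_def
  by (rule fun_calc_intertwine[OF closed_op star.K.positive_contraction_axioms K.positive_contraction_axioms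
        lam_K_intertwine continuous_on_cont_power]) simp_all

lemma lam_F_intertwine: "0 \<le> \<beta> \<Longrightarrow> A x = Some y \<Longrightarrow> A (lam_F (adj A) \<beta> x) = Some (lam_F A \<beta> y)"
  unfolding lam_F_def
  by (rule fun_calc_intertwine[OF closed_op star.Q.positive_contraction_axioms Q.positive_contraction_axioms
        lam_Q_intertwine continuous_on_cont_power]) simp_all

text \<open>Pairing t = A' A k + k with \<open>k\<close>. For z = Q t, with Q =
  \<open>lam_Q (adj A)\<close>, it says that z is mapped isometrically to the pair (Q z, A Q z) in
  the graph of \<open>A\<close>.\<close>

lemma lam_K_adj_norm:
  assumes "A (lam_K (adj A) t) = Some w"
  shows "(norm (lam_K (adj A) t))\<^sup>2 + (norm w)\<^sup>2 = (norm (lam_Q (adj A) t))\<^sup>2"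
proof -
  define k where "k = lam_K (adj A) t"
  obtain w' u where k: "A k = Some w'" "adj A w' = Some u" "u + k = t"
    using star.lam_K_ex[of t] unfolding adj_adj k_def by metis
  have w: "w' = w"
    using k(1) assms by (simp add: k_def)
  have "cinner t k = cinner w w + cinner k k"
    using adj_cinner(2)[OF k(2,1)] by (subst k(3)[symmetric]) (simp add: cinner.add_left w)
  moreover have "cinner t k = cinner (lam_Q (adj A) t) (lam_Q (adj A) t)"
    by (simp add: k_def star.lam_K_eq_Q_Q star.Q.selfadjoint)
  ultimately have "Re (cinner (lam_Q (adj A) t) (lam_Q (adj A) t)) = Re (cinner w w) + Re (cinner k k)"
    by simp
  then show ?thesis
    by (simp add: Re_cinner_self k_def)
qed

text \<open>For \<open>z\<close> in the dense range of \<open>lam_Q (adj A)\<close> this is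
  \<open>lam_K_adj_norm\<close>; the isometry turns convergent \<open>z\<close> into convergent
  images, and closedness of \<open>A\<close> gives the limit.\<close>

lemma lam_Q_adj_in_dom:
  obtains y where "A (lam_Q (adj A) z) = Some y" and "(norm (lam_Q (adj A) z))\<^sup>2 + (norm y)\<^sup>2 = (norm z)\<^sup>2"
proof -
  note lin = linear_op
  have "\<exists>w. A (lam_K (adj A) t) = Some w" for t
    using star.lam_K_ex[of t] unfolding adj_adj by metis
  then obtain W where W: "\<And>t. A (lam_K (adj A) t) = Some (W t)"
    by metis
  have W_diff: "norm (W t - W t') \<le> norm (lam_Q (adj A) t - lam_Q (adj A) t')" for t t'
  proof -
    have "A (lam_K (adj A) (t - t')) = Some (W t - W t')"
      unfolding clinear_diff[OF star.K.clin] by (intro linear_op_diff lin W)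
    then have "(norm (W t - W t'))\<^sup>2 \<le> (norm (lam_Q (adj A) (t - t')))\<^sup>2"
      using lam_K_adj_norm[of "t - t'" "W t - W t'"] zero_le_power2[of "norm (lam_K (adj A) (t - t'))"]
      by linarith
    then show ?thesis
      unfolding clinear_diff[OF star.Q.clin] by (rule power2_le_imp_le) simp
  qed
  have "closure (range (lam_Q (adj A))) = UNIV"
    using star.dense_range_lam_F[of 1] by (simp add: star.lam_F_1[abs_def])
  then obtain t where "(\<lambda>n. lam_Q (adj A) (t n)) \<longlonglongrightarrow> z"
    by (rule closure_range_approx)
  moreover define f where "f n = lam_Q (adj A) (t n)" for n
  ultimately have f: "f \<longlonglongrightarrow> z" and t: "f n = lam_Q (adj A) (t n)" for n
    by (simp_all add: f_def[abs_def])
  have "Cauchy (\<lambda>n. W (t n))"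
  proof (rule metric_CauchyI)
    fix e :: real assume "e > 0"
    with f obtain N where "\<And>m n. m \<ge> N \<Longrightarrow> n \<ge> N \<Longrightarrow> dist (f m) (f n) < e"
      using LIMSEQ_imp_Cauchy metric_CauchyD by metis
    then show "\<exists>N. \<forall>m\<ge>N. \<forall>n\<ge>N. dist (W (t m)) (W (t n)) < e"
      using W_diff le_less_trans unfolding t dist_norm by meson
  qed
  then obtain y where y: "(\<lambda>n. W (t n)) \<longlonglongrightarrow> y"
    unfolding Cauchy_convergent_iff convergent_def by blast
  have Qf: "(\<lambda>n. lam_Q (adj A) (f n)) \<longlonglongrightarrow> lam_Q (adj A) z"
    using bounded_linear.tendsto[OF star.bounded_linear_lam_F[of 1] f] by (simp add: star.lam_F_1)
  have Af: "A (lam_Q (adj A) (f n)) = Some (W (t n))" for n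
    using W[of "t n"] by (simp add: t star.lam_K_eq_Q_Q)
  have "(norm (lam_Q (adj A) (f n)))\<^sup>2 + (norm (W (t n)))\<^sup>2 = (norm (f n))\<^sup>2" for n
    using lam_K_adj_norm[OF W[of "t n"]] by (simp add: t star.lam_K_eq_Q_Q)
  moreover have "(\<lambda>n. (norm (lam_Q (adj A) (f n)))\<^sup>2 + (norm (W (t n)))\<^sup>2) \<longlonglongrightarrow> (norm (lam_Q (adj A) z))\<^sup>2 + (norm y)\<^sup>2"
    "(\<lambda>n. (norm (f n))\<^sup>2) \<longlonglongrightarrow> (norm z)\<^sup>2"
    by (intro tendsto_intros Qf y f)+
  ultimately have "(norm (lam_Q (adj A) z))\<^sup>2 + (norm y)\<^sup>2 = (norm z)\<^sup>2"
    using LIMSEQ_unique by simp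
  moreover have "A (lam_Q (adj A) z) = Some y"
    by (rule closed_op_limit[OF closed_op Af Qf y])
  ultimately show ?thesis
    using that by blast
qed

definition AQ :: "'a \<Rightarrow> 'a"
  where "AQ z = the (A (lam_Q (adj A) z))"

lemma A_lam_Q: "A (lam_Q (adj A) z) = Some (AQ z)"
  unfolding AQ_def by (rule lam_Q_adj_in_dom[of z]) simp

lemma AQ_norm_le: "norm (AQ z) \<le> norm z"
proof -
  obtain y where "A (lam_Q (adj A) z) = Some y" "(norm (lam_Q (adj A) z))\<^sup>2 + (norm y)\<^sup>2 = (norm z)\<^sup>2"
    by (rule lam_Q_adj_in_dom)
  then have "AQ z = y" "(norm y)\<^sup>2 \<le> (norm z)\<^sup>2"
    using zero_le_power2[of "norm (lam_Q (adj A) z)"] A_lam_Q[of z] by (simp, linarith)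
  then have "(norm (AQ z))\<^sup>2 \<le> (norm z)\<^sup>2"
    by simp
  then show ?thesis
    by (rule power2_le_imp_le) simp
qed

lemma clinear_AQ: "clinear AQ"
proof (rule clinearI)
  fix x y a
  show "AQ (x + y) = AQ x + AQ y"
    using linear_op_add[OF linear_op A_lam_Q[of x] A_lam_Q[of y]] A_lam_Q[of "x + y"]
    by (simp add: clinear_add[OF star.Q.clin])
  show "AQ (a *\<^sub>C x) = a *\<^sub>C AQ x"
    using linear_op_scaleC[OF linear_op A_lam_Q[of x]] A_lam_Q[of "a *\<^sub>C x"]
    by (simp add: clinear_scaleC[OF star.Q.clin])
qed

lemma bounded_linear_AQ: "bounded_linear AQ"
  by (rule clinear_bounded_linear[where M = 1]) (simp_all add: clinear_AQ AQ_norm_le)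

lemma lam_F_AQ: "0 \<le> \<beta> \<Longrightarrow> lam_F A \<beta> (AQ z) = AQ (lam_F (adj A) \<beta> z)"
proof -
  assume \<beta>: "0 \<le> \<beta>"
  have "lam_F (adj A) \<beta> (lam_Q (adj A) z) = lam_Q (adj A) (lam_F (adj A) \<beta> z)"
    using star.Q.pw_commute[OF \<beta>, of 1 z] by (simp add: lam_F_def star.Q.pw_1)
  then show ?thesis
    using lam_F_intertwine[OF \<beta> A_lam_Q[of z]] A_lam_Q[of "lam_F (adj A) \<beta> z"] by simp
qed

text \<open>The map sending z to (Q z, A Q z) is an isometry into the graph of \<open>A\<close>. It
  is onto: subtracting from (x, y) its projection to the range leaves a graph element orthogonal to
  all (K t, A K t), which must vanish.\<close>

lemma dom_eq_range_lam_Q: "dom A = range (lam_Q (adj A))"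
proof
  show "range (lam_Q (adj A)) \<subseteq> dom A"
    using A_lam_Q by blast
  show "dom A \<subseteq> range (lam_Q (adj A))"
  proof
    fix x assume "x \<in> dom A"
    then obtain y where y: "A x = Some y"
      by auto
    have "bounded_clinear (\<lambda>z. cinner (lam_Q (adj A) z) x + cinner (AQ z) y)"
    proof (rule bounded_clinearI[where M = "norm x + norm y"])
      show "clinear (\<lambda>z. cinner (lam_Q (adj A) z) x + cinner (AQ z) y)"
        by (rule clinearI)
          (simp_all add: clinear_add[OF star.Q.clin] clinear_scaleC[OF star.Q.clin] clinear_add[OF clinear_AQ]
            clinear_scaleC[OF clinear_AQ] cinner_add_left cinner_scaleC_left scaleC_complex_def algebra_simps)
      fix z
      have "norm (lam_Q (adj A) z) \<le> norm z"
        using star.lam_F_norm_le[of 1 z] by (simp add: star.lam_F_1)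
      then have "norm (cinner (lam_Q (adj A) z) x) \<le> norm z * norm x"
        using norm_cinner_le mult_right_mono norm_ge_zero order_trans by metis
      moreover have "norm (cinner (AQ z) y) \<le> norm z * norm y"
        using AQ_norm_le norm_cinner_le mult_right_mono norm_ge_zero order_trans by metis
      ultimately show "norm (cinner (lam_Q (adj A) z) x + cinner (AQ z) y) \<le> (norm x + norm y) * norm z"
        using norm_triangle_ineq[of "cinner (lam_Q (adj A) z) x" "cinner (AQ z) y"]
        by (simp add: algebra_simps)
    qed
    \<comment> \<open>\<open>u\<close> is the adjoint of the isometry applied to (x, y), so (Q u, A
      Q u) is the projection.\<close>
    then obtain u where u: "\<And>z. cinner (lam_Q (adj A) z) x + cinner (AQ z) y = cinner z u"
      by (rule riesz_representation) (rule that, simp)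
    define x' y' where "x' = x - lam_Q (adj A) u" and "y' = y - AQ u"
    have x'y': "A x' = Some y'"
      unfolding x'_def y'_def by (intro linear_op_diff linear_op y A_lam_Q)
    have "cinner t x' = 0" for t
    proof -
      define k where "k = lam_K (adj A) t"
      obtain w v where k: "A k = Some w" "adj A w = Some v" "v + k = t"
        using star.lam_K_ex[of t] unfolding adj_adj k_def by metis
      have kQ: "lam_Q (adj A) (lam_Q (adj A) t) = k"
        by (simp add: k_def star.lam_K_eq_Q_Q)
      then have wAQ: "AQ (lam_Q (adj A) t) = w"
        using A_lam_Q[of "lam_Q (adj A) t"] k(1) by simp
      \<comment> \<open>The graph inner product with (k, w) = (K t, A K t) is the plain inner
        product with \<open>t\<close>.\<close>
      have split: "cinner t a = cinner k a + cinner w b" if "A a = Some b" for a b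
        using adj_cinner(2)[OF k(2) that] by (subst k(3)[symmetric]) (simp add: cinner.add_left)
      have "cinner t x' = cinner k x + cinner w y - cinner t (lam_Q (adj A) u)"
        unfolding split[OF y, symmetric] x'_def by (rule cinner.diff_right)
      also have "cinner t (lam_Q (adj A) u) = cinner (lam_Q (adj A) t) u"
        by (rule star.Q.selfadjoint[symmetric])
      also have "\<dots> = cinner k x + cinner w y"
        using u[of "lam_Q (adj A) t"] by (simp add: kQ wAQ)
      finally show ?thesis
        by simp
    qed
    then have "x' = 0"
      by (metis cinner_self_eq_0)
    then show "x \<in> range (lam_Q (adj A))"
      by (auto simp: x'_def)
  qed
qed

end

text \<open>For \<open>w\<close> in the domain of \<open>adj A\<close> both sides are (z|Q A' w), by
  intertwining; density and boundedness do the rest.\<close>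

lemma (in closed_dense_pair) AQ_adjoint:
  "cinner (AQ z) w = cinner z (closed_dense_pair.AQ (adj A) w)"
proof -
  interpret dual: closed_dense_pair "adj A"
    by (rule closed_dense_pair_adj)
  have dom: "cinner (AQ z) w = cinner z (dual.AQ w)" if w: "adj A w = Some v" for w v
  proof -
    have "cinner (AQ z) w = cinner (lam_Q (adj A) z) v"
      by (rule adj_cinner(1)[OF w A_lam_Q])
    also have "\<dots> = cinner z (lam_Q (adj A) v)"
      by (rule star.Q.selfadjoint)
    also have "lam_Q (adj A) v = dual.AQ w"
      using dual.lam_Q_intertwine[OF w] dual.A_lam_Q[of w] by simp
    finally show ?thesis .
  qed
  obtain f where f: "\<And>n::nat. f n \<in> dom (adj A)" "f \<longlonglongrightarrow> w"
    using closure_approx[OF star.dense] by blast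
  have "(\<lambda>n. cinner (AQ z) (f n)) \<longlonglongrightarrow> cinner (AQ z) w"
    by (intro cinner.tendsto tendsto_const f)
  moreover have "(\<lambda>n. cinner z (dual.AQ (f n))) \<longlonglongrightarrow> cinner z (dual.AQ w)"
    by (intro cinner.tendsto tendsto_const bounded_linear.tendsto[OF dual.bounded_linear_AQ] f)
  moreover have "cinner (AQ z) (f n) = cinner z (dual.AQ (f n))" for n
    using f(1)[of n] dom by blast
  ultimately show ?thesis
    using LIMSEQ_unique by simp
qed

section \<open>The spaces with negative exponents\<close>

text \<open>\<open>j\<close> and \<open>g\<close> induce the same norm, hence have the same Cauchy
  sequences; density of \<open>range g\<close> makes the extension surjective.\<close>

lemma isometric_extension:
  fixes j :: "'a::complex_banach \<Rightarrow> 'e::complex_banach" and g :: "'a \<Rightarrow> 'f::complex_banach"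
  assumes j: "clinear j" and g: "clinear g" and norm_eq: "\<And>h. norm (j h) = norm (g h)"
    and dense: "closure (range j) = UNIV" "closure (range g) = UNIV"
  obtains J where "clinear J" "\<And>w. norm (J w) = norm w" "surj J" "\<And>h. J (j h) = g h"
proof -
  have dist_eq: "dist (g x) (g y) = dist (j x) (j y)" for x y
    using norm_eq[of "x - y"] by (simp add: dist_norm clinear_diff[OF g] clinear_diff[OF j])
  have Cauchy_iff: "Cauchy (\<lambda>n. g (h n)) \<longleftrightarrow> Cauchy (\<lambda>n. j (h n))" for h :: "nat \<Rightarrow> 'a"
    by (simp add: Cauchy_def dist_eq)
  have diff: "(\<lambda>n. g (h n) - g (k n)) \<longlonglongrightarrow> 0" if "(\<lambda>n. j (h n) - j (k n)) \<longlonglongrightarrow> 0" for h k :: "nat \<Rightarrow> 'a"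
  proof -
    have "norm (g (h n) - g (k n)) = norm (j (h n) - j (k n))" for n
      using norm_eq[of "h n - k n"] by (simp add: clinear_diff[OF g] clinear_diff[OF j])
    then show ?thesis
      using tendsto_norm_zero[OF that] by (subst tendsto_norm_zero_iff[symmetric]) simp
  qed
  have approx: "\<exists>h. (\<lambda>n::nat. j (h n)) \<longlonglongrightarrow> w" for w
    using closure_range_approx[OF dense(1)] by blast
  have "\<exists>c. \<forall>h. (\<lambda>n::nat. j (h n)) \<longlonglongrightarrow> w \<longrightarrow> (\<lambda>n. g (h n)) \<longlonglongrightarrow> c" for w
  proof -
    obtain h where h: "(\<lambda>n. j (h n)) \<longlonglongrightarrow> w"
      using approx by blast
    then have "Cauchy (\<lambda>n. g (h n))"
      unfolding Cauchy_iff by (rule LIMSEQ_imp_Cauchy)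
    then obtain c where c: "(\<lambda>n. g (h n)) \<longlonglongrightarrow> c"
      unfolding Cauchy_convergent_iff convergent_def by blast
    have "(\<lambda>n. g (k n)) \<longlonglongrightarrow> c" if "(\<lambda>n. j (k n)) \<longlonglongrightarrow> w" for k
      using tendsto_add[OF diff[of k h] c] tendsto_diff[OF that h] by simp
    then show ?thesis
      by blast
  qed
  then obtain J where J: "\<And>w h. (\<lambda>n::nat. j (h n)) \<longlonglongrightarrow> w \<Longrightarrow> (\<lambda>n. g (h n)) \<longlonglongrightarrow> J w"
    by metis
  have Jj: "J (j h) = g h" for h
    using J[of "\<lambda>_. h"] by (simp add: LIMSEQ_const_iff)
  show ?thesis
  proof (rule that)
    show "clinear J"
    proof (rule clinearI)
      fix v w a
      obtain h where h: "(\<lambda>n. j (h n)) \<longlonglongrightarrow> v"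
        using approx by blast
      obtain k where k: "(\<lambda>n. j (k n)) \<longlonglongrightarrow> w"
        using approx by blast
      have "(\<lambda>n. g (h n + k n)) \<longlonglongrightarrow> J (v + w)"
        using tendsto_add[OF h k] by (intro J) (simp add: clinear_add[OF j])
      with tendsto_add[OF J[OF h] J[OF k]] show "J (v + w) = J v + J w"
        by (simp add: clinear_add[OF g] LIMSEQ_unique)
      have "(\<lambda>n. g (a *\<^sub>C h n)) \<longlonglongrightarrow> J (a *\<^sub>C v)"
        using scaleC.tendsto[OF tendsto_const h, of a] by (intro J) (simp add: clinear_scaleC[OF j])
      with scaleC.tendsto[OF tendsto_const J[OF h], of a] show "J (a *\<^sub>C v) = a *\<^sub>C J v"
        by (simp add: clinear_scaleC[OF g] LIMSEQ_unique)
    qed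
    show "norm (J w) = norm w" for w
    proof -
      obtain h where h: "(\<lambda>n. j (h n)) \<longlonglongrightarrow> w"
        using approx by blast
      show ?thesis
        using tendsto_norm[OF h] tendsto_norm[OF J[OF h]] LIMSEQ_unique by (simp add: norm_eq)
    qed
    show "surj J"
      unfolding surj_def
    proof
      fix y
      obtain h where h: "(\<lambda>n. g (h n)) \<longlonglongrightarrow> y"
        by (rule closure_range_approx[OF dense(2)])
      have "Cauchy (\<lambda>n. j (h n))"
        using LIMSEQ_imp_Cauchy[OF h] unfolding Cauchy_iff .
      then obtain w where "(\<lambda>n. j (h n)) \<longlonglongrightarrow> w"
        unfolding Cauchy_convergent_iff convergent_def by blast
      from J[OF this] h have "J w = y"
        by (rule LIMSEQ_unique)
      then show "\<exists>w. y = J w"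
        by blast
    qed
  qed (rule Jj)
qed

text \<open>\<open>J\<close> is the unitary extension of \<open>\<Lambda>\<^sup>-\<^sup>\<tau>\<close> to the completion; it reduces statements about the
  completion to statements about \<open>H\<close>.\<close>

locale neg_scale = closed_dense_pair A for A :: "'h::complex_hilbert \<rightharpoonup> 'h" +
  fixes \<tau> :: real and j :: "'h \<Rightarrow> 'e::complex_hilbert" and J :: "'e \<Rightarrow> 'h"
  assumes tau: "0 \<le> \<tau>" "\<tau> \<le> 1"
    and clinear_j: "clinear j" and dense_j: "closure (range j) = UNIV"
    and clinear_J: "clinear J" and norm_J: "norm (J w) = norm w"
    and surj_J: "surj J" and J_j: "J (j h) = lam_F A \<tau> h"

lemma (in closed_dense_pair) neg_scale_exists:
  assumes "negative_space (Lam A) \<tau> j" "0 \<le> \<tau>" "\<tau> \<le> 1"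
  obtains J where "neg_scale A \<tau> j J"
proof -
  have norm_eq: "norm (j h) = norm (lam_F A \<tau> h)" for h
    using assms by (simp add: negative_space_def op_powr_Lam_neg)
  have j: "clinear j" "closure (range j) = UNIV"
    using assms by (simp_all add: negative_space_def)
  obtain J where "clinear J" "\<And>w. norm (J w) = norm w" "surj J" "\<And>h. J (j h) = lam_F A \<tau> h"
    using isometric_extension[OF j(1) clinear_lam_F[OF assms(2)] norm_eq j(2) dense_range_lam_F[OF assms(2)]] by metis
  with assms j have "neg_scale A \<tau> j J"
    by unfold_locales simp_all
  then show ?thesis
    by (rule that)
qed

context neg_scale
begin

lemma norm_j_le: "norm (j h) \<le> norm h"
  using norm_J[of "j h"] lam_F_norm_le[OF tau(1), of h] by (simp add: J_j)

lemma bounded_linear_j: "bounded_linear j"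
  by (rule clinear_bounded_linear[where M = 1]) (simp_all add: clinear_j norm_j_le)

lemma bounded_linear_J: "bounded_linear J"
  by (rule clinear_bounded_linear[where M = 1]) (simp_all add: clinear_J norm_J)

lemma J_eq_iff: "J v = J w \<longleftrightarrow> v = w"
proof
  assume "J v = J w"
  then have "norm (J (v - w)) = 0"
    by (simp add: clinear_diff[OF clinear_J])
  then show "v = w"
    by (simp add: norm_J)
qed simp

lemma inj_j: "inj j"
proof (rule injI)
  fix x y assume "j x = j y"
  then have "lam_F A \<tau> x = lam_F A \<tau> y"
    by (metis J_j)
  then show "x = y"
    by (rule injD[OF inj_lam_F[OF tau(1)]])
qed

lemma tendsto_J_cancel:
  assumes "(\<lambda>n. J (f n)) \<longlonglongrightarrow> J w"
  shows "f \<longlonglongrightarrow> w"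
proof -
  have "norm (J (f n) - J w) = norm (f n - w)" for n
    by (metis clinear_diff[OF clinear_J] norm_J)
  then show ?thesis
    using tendsto_norm_zero[OF LIM_zero[OF assms]] by (subst LIM_zero_iff[symmetric], subst tendsto_norm_zero_iff[symmetric]) simp
qed

lemma J_obtain: obtains w where "J w = y"
  using surj_J by (metis surjD)

text \<open>Self-adjointness moves \<open>lam_F A \<tau>\<close> to the approximating vectors, where
  it is \<open>J\<close> after \<open>j\<close>. From here on pairings are inner products of
  \<open>H\<close>.\<close>

lemma pairing_lam_F: "pairing j (lam_F A \<tau> z) w = cinner z (J w)"
proof -
  let ?P = "\<lambda>c. \<forall>h. (\<lambda>n. j (h n)) \<longlonglongrightarrow> w \<longrightarrow> (\<lambda>n. cinner (lam_F A \<tau> z) (h n)) \<longlonglongrightarrow> c"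
  have P: "?P (cinner z (J w))"
  proof (intro allI impI)
    fix h assume "(\<lambda>n. j (h n)) \<longlonglongrightarrow> w"
    then have "(\<lambda>n. J (j (h n))) \<longlonglongrightarrow> J w"
      by (rule bounded_linear.tendsto[OF bounded_linear_J])
    then have "(\<lambda>n. cinner z (J (j (h n)))) \<longlonglongrightarrow> cinner z (J w)"
      by (intro cinner.tendsto tendsto_const)
    then show "(\<lambda>n. cinner (lam_F A \<tau> z) (h n)) \<longlonglongrightarrow> cinner z (J w)"
      by (simp add: J_j lam_F_selfadjoint[OF tau(1)])
  qed
  obtain h where h: "(\<lambda>n. j (h n)) \<longlonglongrightarrow> w"
    by (rule closure_range_approx[OF dense_j])
  show ?thesis
    unfolding pairing_def
  proof (rule the_equality)
    show "?P (cinner z (J w))"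
      by (rule P)
    show "c = cinner z (J w)" if "?P c" for c
      using that P h LIMSEQ_unique by blast
  qed
qed

lemma dom_scale_norm: "dom (op_powr (Lam_star A) (1 - \<tau>)) = range (lam_F (adj A) (1 - \<tau>))"
  using tau by (simp add: Lam_star_eq star.dom_op_powr_Lam)

lemma dense_image_j: "closure (j ` range (lam_F (adj A) (1 - \<tau>))) = UNIV"
proof -
  have "j ` closure (range (lam_F (adj A) (1 - \<tau>))) \<subseteq> closure (j ` range (lam_F (adj A) (1 - \<tau>)))"
    by (rule image_closure_subset)
      (auto intro: linear_continuous_on bounded_linear_j closure_subset[THEN subsetD])
  then have "range j \<subseteq> closure (j ` range (lam_F (adj A) (1 - \<tau>)))"
    using tau by (simp add: star.dense_range_lam_F)
  then have "closure (range j) \<subseteq> closure (j ` range (lam_F (adj A) (1 - \<tau>)))"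
    by (rule closure_minimal) simp
  then show ?thesis
    using dense_j by auto
qed

text \<open>Elements of the domain of \<open>A\<close> are \<open>lam_Q (adj A) q\<close>, and they
  tend to \<open>x\<close> in the scale exactly if \<open>lam_F (adj A) \<tau> q\<close> tends to
  \<open>z\<close>. After \<open>J\<close> their images under \<open>A\<close> are
  \<open>AQ (lam_F (adj A) \<tau> q)\<close>, and \<open>AQ\<close> is bounded.\<close>

lemma A_ext_eq_Some_iff: "A_ext A \<tau> j x = Some w \<longleftrightarrow> (\<exists>z. x = lam_F (adj A) (1 - \<tau>) z \<and> J w = AQ z)"
proof -
  let ?N = "op_powr (Lam_star A) (1 - \<tau>)"
  have N: "the (?N (lam_F (adj A) (1 - \<tau>) z)) = z" for z
  proof -
    have "?N (lam_F (adj A) (1 - \<tau>) z) = Some z"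
      using tau by (simp add: Lam_star_eq star.op_powr_Lam_eq_Some_iff)
    then show ?thesis
      by simp
  qed
  have Q_split: "lam_Q (adj A) q = lam_F (adj A) (1 - \<tau>) (lam_F (adj A) \<tau> q)" for q
    using star.lam_F_split[of "1 - \<tau>" 1 q] tau by (simp add: star.lam_F_1)
  have val: "A_ext A \<tau> j x = Some w" if x: "x = lam_F (adj A) (1 - \<tau>) z" and w: "J w = AQ z" for x w z
  proof -
    let ?P = "\<lambda>w. \<forall>f. (\<forall>n. f n \<in> dom A) \<and> (\<lambda>n. the (?N (f n - x))) \<longlonglongrightarrow> 0 \<longrightarrow> (\<lambda>n. j (the (A (f n)))) \<longlonglongrightarrow> w"
    have norm_diff: "the (?N (lam_Q (adj A) q - x)) = lam_F (adj A) \<tau> q - z" for q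
    proof -
      have "lam_Q (adj A) q - x = lam_F (adj A) (1 - \<tau>) (lam_F (adj A) \<tau> q - z)"
        using tau by (simp add: x Q_split clinear_diff[OF star.clinear_lam_F])
      then show ?thesis
        using N by simp
    qed
    have lim: "(\<lambda>n. j (the (A (lam_Q (adj A) (q n))))) \<longlonglongrightarrow> w"
      if "(\<lambda>n. lam_F (adj A) \<tau> (q n)) \<longlonglongrightarrow> z" for q
    proof (rule tendsto_J_cancel)
      have "(\<lambda>n. AQ (lam_F (adj A) \<tau> (q n))) \<longlonglongrightarrow> AQ z"
        by (rule bounded_linear.tendsto[OF bounded_linear_AQ that])
      then show "(\<lambda>n. J (j (the (A (lam_Q (adj A) (q n)))))) \<longlonglongrightarrow> J w"
        by (simp add: A_lam_Q J_j w lam_F_AQ[OF tau(1)])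
    qed
    have P: "?P w"
    proof (intro allI impI, elim conjE)
      fix f assume f: "\<forall>n::nat. f n \<in> dom A" "(\<lambda>n. the (?N (f n - x))) \<longlonglongrightarrow> 0"
      then have "\<forall>n. \<exists>q. f n = lam_Q (adj A) q"
        unfolding dom_eq_range_lam_Q by blast
      then obtain q where q: "\<And>n. f n = lam_Q (adj A) (q n)"
        by metis
      have "(\<lambda>n. lam_F (adj A) \<tau> (q n)) \<longlonglongrightarrow> z"
        using f(2) unfolding q norm_diff by (rule LIM_zero_cancel)
      then show "(\<lambda>n. j (the (A (f n)))) \<longlonglongrightarrow> w"
        unfolding q by (rule lim)
    qed
    \<comment> \<open>One approximating sequence has to exist; otherwise \<open>?P\<close> would
      hold vacuously for every candidate.\<close>
    obtain q where q: "(\<lambda>n. lam_F (adj A) \<tau> (q n)) \<longlonglongrightarrow> z"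
      by (rule closure_range_approx[OF star.dense_range_lam_F[OF tau(1)]])
    have "(THE w. ?P w) = w"
    proof (rule the_equality)
      show "?P w"
        by (rule P)
      fix v assume v: "?P v"
      have "(\<lambda>n. the (?N (lam_Q (adj A) (q n) - x))) \<longlonglongrightarrow> 0"
        unfolding norm_diff by (rule LIM_zero[OF q])
      moreover have "\<forall>n. lam_Q (adj A) (q n) \<in> dom A"
        unfolding dom_eq_range_lam_Q by blast
      ultimately have "(\<lambda>n. j (the (A (lam_Q (adj A) (q n))))) \<longlonglongrightarrow> v"
        using v[rule_format, of "\<lambda>n. lam_Q (adj A) (q n)"] by blast
      then show "v = w"
        using lim[OF q] by (rule LIMSEQ_unique)
    qed
    moreover have "x \<in> dom ?N"
      unfolding dom_scale_norm x by blast
    ultimately show ?thesis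
      by (simp add: A_ext_def scale_ext_def)
  qed
  show ?thesis
  proof
    assume Aw: "A_ext A \<tau> j x = Some w"
    then have "x \<in> dom ?N"
      by (auto simp: A_ext_def scale_ext_def split: if_splits)
    then obtain z where z: "x = lam_F (adj A) (1 - \<tau>) z"
      unfolding dom_scale_norm by blast
    obtain v where v: "J v = AQ z"
      by (rule J_obtain)
    have "A_ext A \<tau> j x = Some v"
      by (rule val[OF z v])
    with Aw z v show "\<exists>z. x = lam_F (adj A) (1 - \<tau>) z \<and> J w = AQ z"
      by auto
  qed (use val in blast)
qed

text \<open>Testing with the domain of \<open>adj A\<close> shows that \<open>x\<close> lies in the
  domain of the double adjoint, which is \<open>A\<close>. Thus the extension has no new
  eigenvectors.\<close>

lemma A_ext_eigenvector:
  assumes A: "A_ext A \<tau> j x = Some (\<mu> *\<^sub>C j x)"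
  shows "A x = Some (\<mu> *\<^sub>C x)"
proof -
  obtain z where z: "x = lam_F (adj A) (1 - \<tau>) z" "J (\<mu> *\<^sub>C j x) = AQ z"
    using A A_ext_eq_Some_iff by blast
  interpret dual: closed_dense_pair "adj A"
    by (rule closed_dense_pair_adj)
  have \<tau>1: "0 \<le> 1 - \<tau>"
    using tau by simp
  have "cinner v x = cinner w (\<mu> *\<^sub>C x)" if w: "adj A w = Some v" for w v
  proof -
    have "w \<in> range (lam_Q A)"
      using w dual.dom_eq_range_lam_Q unfolding adj_adj by blast
    then obtain q where q: "w = lam_Q A q"
      by blast
    have wq: "w = lam_F A \<tau> (lam_F A (1 - \<tau>) q)"
      using lam_F_split[OF tau, of q] by (simp add: q lam_F_1)
    have v: "v = dual.AQ q"
      using w dual.A_lam_Q[of q] unfolding adj_adj q by simp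
    have "cinner w (\<mu> *\<^sub>C x) = cinner (lam_F A (1 - \<tau>) q) (AQ z)"
      by (simp add: wq lam_F_selfadjoint[OF tau(1)] z(2)[symmetric] clinear_scaleC[OF clinear_J] J_j
          clinear_scaleC[OF clinear_lam_F[OF tau(1)]])
    also have "\<dots> = cinner q (AQ x)"
      by (simp add: lam_F_selfadjoint[OF \<tau>1] lam_F_AQ[OF \<tau>1] z(1))
    also have "\<dots> = cinner v x"
      unfolding v by (rule cinner_flip[OF AQ_adjoint])
    finally show ?thesis
      by simp
  qed
  then have "adj (adj A) x = Some (\<mu> *\<^sub>C x)"
    unfolding star.adj_iff by blast
  then show ?thesis
    by (simp add: adj_adj)
qed

lemma linear_op_A_ext: "linear_op (A_ext A \<tau> j)"
proof -
  have cl: "clinear (lam_F (adj A) (1 - \<tau>))"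
    using tau by (intro star.clinear_lam_F) simp
  show ?thesis
    by (rule linear_opI)
      (unfold A_ext_eq_Some_iff, metis clinear_zero[OF cl] clinear_zero[OF clinear_J] clinear_zero[OF clinear_AQ],
        metis clinear_add[OF cl] clinear_add[OF clinear_J] clinear_add[OF clinear_AQ],
        metis clinear_scaleC[OF cl] clinear_scaleC[OF clinear_J] clinear_scaleC[OF clinear_AQ])
qed

text \<open>The preimage \<open>x\<close> is given; it is unique because the difference of two
  preimages is an eigenvector of \<open>A\<close> itself, while \<open>\<mu>\<close> is in the
  resolvent set.\<close>

lemma op_inv_shift_A_ext:
  assumes \<mu>: "\<mu> \<in> resolvent_set A" and x: "A_ext A \<tau> j x = Some (w + \<mu> *\<^sub>C j x)"
  shows "op_inv (emb_shift j (A_ext A \<tau> j) \<mu>) w = Some x"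
proof -
  have shift: "emb_shift j (A_ext A \<tau> j) \<mu> y = Some w \<longleftrightarrow> A_ext A \<tau> j y = Some (w + \<mu> *\<^sub>C j y)" for y
    unfolding emb_shift_def by (cases "A_ext A \<tau> j y") (auto simp: algebra_simps)
  have "y = x" if y: "A_ext A \<tau> j y = Some (w + \<mu> *\<^sub>C j y)" for y
  proof -
    have "A_ext A \<tau> j (y - x) = Some (\<mu> *\<^sub>C j (y - x))"
      using linear_op_diff[OF linear_op_A_ext y x] by (simp add: clinear_diff[OF clinear_j] scaleC.diff_right)
    then have "A (y - x) = Some (\<mu> *\<^sub>C (y - x))"
      by (rule A_ext_eigenvector)
    then have "op_shift A \<mu> (y - x) = Some 0"
      by (simp add: emb_shift_def)
    moreover have "op_shift A \<mu> 0 = Some 0"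
      by (simp add: emb_shift_def linear_op_zero[OF linear_op])
    moreover have "inj_on (op_shift A \<mu>) (dom (op_shift A \<mu>))"
      using \<mu> by (simp add: resolvent_set_on_def op_injective_def)
    ultimately have "y - x = 0"
      by (metis domI inj_onD)
    then show ?thesis
      by simp
  qed
  then show ?thesis
    unfolding op_inv_eq_Some_iff shift using x by blast
qed

end

section \<open>Resolvents and sectorial operators\<close>

definition resolvent :: "('a::complex_banach \<rightharpoonup> 'a) \<Rightarrow> complex \<Rightarrow> 'a \<Rightarrow> 'a"
  where "resolvent T z v = the (op_inv (op_shift T z) v)"

lemma op_shift_eq_Some_iff: "op_shift T z x = Some v \<longleftrightarrow> T x = Some (v + z *\<^sub>C x)"
  unfolding emb_shift_def by (cases "T x") (auto simp: algebra_simps)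

lemma op_inv_shift_resolvent:
  assumes "z \<in> resolvent_set_on V T" "v \<in> V"
  shows "op_inv (op_shift T z) v = Some (resolvent T z v)"
proof -
  have inj: "inj_on (op_shift T z) (dom (op_shift T z))" and ran: "ran (op_shift T z) = V"
    using assms(1) by (simp_all add: resolvent_set_on_def op_injective_def)
  obtain x where x: "op_shift T z x = Some v"
    using assms(2) ran by (auto simp: ran_def)
  have "x' = x" if "op_shift T z x' = Some v" for x'
    by (rule inj_onD[OF inj]) (use x that in auto)
  then have "op_inv (op_shift T z) v = Some x"
    unfolding op_inv_eq_Some_iff using x by blast
  then show ?thesis
    by (simp add: resolvent_def)
qed

lemma resolvent_right:
  assumes "z \<in> resolvent_set_on V T" "v \<in> V"
  shows "T (resolvent T z v) = Some (v + z *\<^sub>C resolvent T z v)"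
  using op_inv_shift_resolvent[OF assms] unfolding op_inv_eq_Some_iff op_shift_eq_Some_iff by blast

lemma resolvent_left:
  assumes "z \<in> resolvent_set_on V T" "T x = Some (v + z *\<^sub>C x)"
  shows "v \<in> V" and "resolvent T z v = x"
proof -
  have x: "op_shift T z x = Some v"
    using assms(2) by (simp add: op_shift_eq_Some_iff)
  then have "v \<in> ran (op_shift T z)"
    by (auto simp: ran_def)
  then show v: "v \<in> V"
    using assms(1) by (simp add: resolvent_set_on_def)
  show "resolvent T z v = x"
    using op_inv_shift_resolvent[OF assms(1) v] x unfolding op_inv_eq_Some_iff by metis
qed

lemma resolvent_norm_le:
  assumes "z \<in> resolvent_set_on V T" "v \<in> V" "op_bounded_by (op_inv (op_shift T z)) M"
  shows "norm (resolvent T z v) \<le> M * norm v"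
  using assms(3) op_inv_shift_resolvent[OF assms(1,2)] unfolding op_bounded_by_def
  by (metis domI option.sel)

lemma resolvent_add:
  assumes "linear_op T" "z \<in> resolvent_set_on V T" "u \<in> V" "v \<in> V"
  shows "resolvent T z (u + v) = resolvent T z u + resolvent T z v"
proof (rule resolvent_left(2)[OF assms(2)])
  show "T (resolvent T z u + resolvent T z v) = Some (u + v + z *\<^sub>C (resolvent T z u + resolvent T z v))"
    using linear_op_add[OF assms(1) resolvent_right[OF assms(2,3)] resolvent_right[OF assms(2,4)]]
    by (simp add: scaleC_add_right algebra_simps)
qed

lemma resolvent_scaleC:
  assumes "linear_op T" "z \<in> resolvent_set_on V T" "u \<in> V"
  shows "resolvent T z (a *\<^sub>C u) = a *\<^sub>C resolvent T z u"
proof (rule resolvent_left(2)[OF assms(2)])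
  show "T (a *\<^sub>C resolvent T z u) = Some (a *\<^sub>C u + z *\<^sub>C (a *\<^sub>C resolvent T z u))"
    using linear_op_scaleC[OF assms(1) resolvent_right[OF assms(2,3)], of a]
    by (simp add: scaleC_add_right scaleC_scaleC mult.commute)
qed

lemma resolvent_minus:
  assumes "linear_op T" "z \<in> resolvent_set_on V T" "u \<in> V"
  shows "resolvent T z (- u) = - resolvent T z u"
  using resolvent_scaleC[OF assms, of "- 1"] by simp

text \<open>\<open>resolvent_set_on\<close> prescribes the range but does not put the domain into
  \<open>V\<close>, hence the assumption \<open>Rw\<close>.\<close>

lemma resolvent_identity:
  assumes T: "linear_op T" and z: "z \<in> resolvent_set_on V T"
    and w: "w \<in> resolvent_set_on V T" and u: "u \<in> V" and Rw: "resolvent T w u \<in> V"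
  shows "resolvent T z u - resolvent T w u = (z - w) *\<^sub>C resolvent T z (resolvent T w u)"
proof -
  define a where "a = resolvent T w u"
  define b where "b = resolvent T z a"
  have ab: "T a = Some (u + w *\<^sub>C a)" "T b = Some (a + z *\<^sub>C b)"
    using resolvent_right[OF w u] resolvent_right[OF z Rw] by (simp_all add: a_def b_def)
  have "T (a + (z - w) *\<^sub>C b) = Some (u + w *\<^sub>C a + (z - w) *\<^sub>C (a + z *\<^sub>C b))"
    by (rule linear_op_add[OF T ab(1) linear_op_scaleC[OF T ab(2)]])
  also have "u + w *\<^sub>C a + (z - w) *\<^sub>C (a + z *\<^sub>C b) = u + z *\<^sub>C (a + (z - w) *\<^sub>C b)"
    by (simp add: scaleC_add_right scaleC.diff_left scaleC.diff_right scaleC_scaleC algebra_simps)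
  finally have "resolvent T z u = a + (z - w) *\<^sub>C b"
    by (rule resolvent_left(2)[OF z])
  then show ?thesis
    by (simp add: a_def b_def)
qed

lemma closed_op_if_resolvent:
  assumes T: "linear_op T" and z: "z \<in> resolvent_set T"
  shows "closed_op T"
proof (rule closed_opI[OF T])
  fix f g x y
  assume fg: "\<And>n::nat. T (f n) = Some (g n)" "f \<longlonglongrightarrow> x" "g \<longlonglongrightarrow> y"
  define k where "k = y - z *\<^sub>C x"
  obtain M where M: "op_bounded_by (op_inv (op_shift T z)) M"
    using z by (auto simp: resolvent_set_on_def)
  have "f n = resolvent T z (g n - z *\<^sub>C f n)" for n
    using resolvent_left(2)[OF z, of "f n" "g n - z *\<^sub>C f n"] fg(1) by simp
  then have "f n - resolvent T z k = resolvent T z (g n - z *\<^sub>C f n - k)" for n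
    using resolvent_add[OF T z, of "g n - z *\<^sub>C f n" "- k"] resolvent_minus[OF T z, of k] by simp
  then have le: "norm (f n - resolvent T z k) \<le> M * norm (g n - z *\<^sub>C f n - k)" for n
    using resolvent_norm_le[OF z _ M] by simp
  have "(\<lambda>n. g n - z *\<^sub>C f n - k) \<longlonglongrightarrow> 0"
    using tendsto_diff[OF fg(3) scaleC.tendsto[OF tendsto_const fg(2), of z]]
    unfolding k_def[symmetric] by (rule LIM_zero)
  then have lim: "(\<lambda>n. M * norm (g n - z *\<^sub>C f n - k)) \<longlonglongrightarrow> 0"
    by (intro tendsto_mult_right_zero tendsto_norm_zero)
  have "(\<lambda>n. f n - resolvent T z k) \<longlonglongrightarrow> 0"
    by (rule Lim_null_comparison[OF always_eventually[OF allI[OF le]] lim])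
  then have "f \<longlonglongrightarrow> resolvent T z k"
    by (rule LIM_zero_cancel)
  then have "x = resolvent T z k"
    using fg(2) LIMSEQ_unique by blast
  then show "T x = Some y"
    using resolvent_right[OF z, of k] by (simp add: k_def)
qed

text \<open>If \<open>z\<close> is orthogonal to the domain, the bounded sequence \<open>- n (S - n)\<^sup>-\<^sup>1 z\<close> stays orthogonal
  to \<open>z\<close> but tends weakly to \<open>z\<close>; the weak limit can be tested on the dense range of the adjoint
  of \<open>(S - 1)\<^sup>-\<^sup>1\<close>.\<close>

lemma sectorial_dense:
  fixes S :: "'h::complex_hilbert \<rightharpoonup> 'h"
  assumes "sectorial S"
  shows "closure (dom S) = UNIV"
proof -
  obtain \<theta> M where S: "linear_op S" and \<theta>: "\<theta> \<ge> 0" and M: "M > 0"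
    and sub: "sector \<theta> \<subseteq> resolvent_set S"
    and bnd: "\<And>z. z \<in> sector \<theta> \<Longrightarrow> op_bounded_by (op_inv (op_shift S z)) (M / cmod z)"
    using assms by (auto simp: sectorial_def)
  have sec: "complex_of_real t \<in> sector \<theta>" if "t > 0" for t
  proof -
    have "- (pi / 2) \<le> \<theta>"
      using \<theta> pi_ge_zero by linarith
    then show ?thesis
      using that \<theta> by (simp add: sector_def Arg_of_real)
  qed
  define R where "R = (\<lambda>t. resolvent S (complex_of_real t))"
  have res: "complex_of_real t \<in> resolvent_set S" if "t > 0" for t
    using sec[OF that] sub by blast
  have R_norm: "norm (R t v) \<le> M / t * norm v" if "t > 0" for t v
    using resolvent_norm_le[OF res[OF that] _ bnd[OF sec[OF that]]] that by (simp add: R_def)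
  have R_lin: "clinear (R t)" if "t > 0" for t
    unfolding R_def by (rule clinearI) (simp_all add: resolvent_add[OF S res[OF that]] resolvent_scaleC[OF S res[OF that]])
  have "bounded_clinear (R 1)"
    by (rule bounded_clinearI[where M = M]) (use R_lin[of 1] R_norm[of 1] in simp_all)
  then obtain G where G: "\<And>x y. cinner (R 1 x) y = cinner x (G y)"
    by (rule bounded_adjoint) (rule that, simp)
  have G_lin: "clinear G"
    by (rule clinear_adjoint[OF G])
  have R1_inj: "u = 0" if "R 1 u = 0" for u
    using resolvent_right[OF res[of 1], of u] that linear_op_zero[OF S] by (simp add: R_def)
  have G_dense: "closure (range G) = UNIV"
  proof (rule dense_if_orthogonal_trivial[OF csubspace_range[OF G_lin]])
    fix u assume "\<And>m. m \<in> range G \<Longrightarrow> cinner u m = 0"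
    then have "cinner (R 1 u) (R 1 u) = 0"
      by (simp add: G)
    then show "u = 0"
      unfolding cinner_self_eq_0 by (rule R1_inj)
  qed
  show ?thesis
  proof (rule dense_if_orthogonal_trivial[OF linear_op_csubspace_dom[OF S]])
    fix z assume z: "\<And>m. m \<in> dom S \<Longrightarrow> cinner z m = 0"
    \<comment> \<open>\<open>Suc n\<close> keeps the real point positive, where the resolvent exists
      for every angle of the sector.\<close>
    define y where "y = (\<lambda>n. - (real (Suc n) *\<^sub>R R (real (Suc n)) z))"
    have y_dom: "y n \<in> dom S" for n
    proof -
      have "R (real (Suc n)) z \<in> dom S"
        using resolvent_right[OF res[of "real (Suc n)"], of z] by (auto simp: R_def)
      then show ?thesis
        unfolding y_def
        by (intro complex_vec.subspace_neg csubspace_scaleR linear_op_csubspace_dom[OF S])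
    qed
    have y_norm: "norm (y n) \<le> M * norm z" for n
      using mult_left_mono[OF R_norm[of "real (Suc n)" z], of "real (Suc n)"] by (simp add: y_def del: of_nat_Suc)
    \<comment> \<open>The resolvent identity between 1 and \<open>Suc n\<close>; both terms on the
      right are of order 1 / n.\<close>
    have R1_y: "R 1 (y n) - R 1 z = - R (real (Suc n)) z - R 1 (R (real (Suc n)) z)" for n
    proof -
      define t q where "t = real (Suc n)" and "q = R t z"
      have "R 1 z - q = (1 - complex_of_real t) *\<^sub>C R 1 q"
        using resolvent_identity[OF S res[of 1] res[of t], of z]
        unfolding R_def q_def t_def by simp
      also have "\<dots> = R 1 q - t *\<^sub>R R 1 q"
        by (simp only: scaleC.diff_left scaleC_one scaleR_scaleC)
      also have "\<dots> = R 1 q + R 1 (y n)"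
        unfolding y_def t_def[symmetric] q_def[symmetric]
        by (simp only: clinear_minus[OF R_lin[OF zero_less_one]] clinear_scaleR[OF R_lin[OF zero_less_one]] diff_conv_add_uminus)
      finally have "R 1 (y n) - R 1 z = - q - R 1 q"
        by (simp add: algebra_simps)
      then show ?thesis
        by (simp only: q_def t_def)
    qed
    have lim0: "(\<lambda>n. norm (R 1 (y n - z))) \<longlonglongrightarrow> 0"
    proof (rule tendsto_sandwich[OF _ _ tendsto_const])
      have "norm (R 1 (y n - z)) \<le> (M + M * M) * norm z / real (Suc n)" for n
      proof -
        define q where "q = R (real (Suc n)) z"
        have "norm (R 1 (y n - z)) = norm (q + R 1 q)"
        proof -
          have "R 1 (y n - z) = - (q + R 1 q)"
            using R1_y[of n] unfolding q_def[symmetric] clinear_diff[OF R_lin[OF zero_less_one]] by simp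
          then show ?thesis
            by (simp only: norm_minus_cancel)
        qed
        also have "\<dots> \<le> norm q + M * norm q"
          using R_norm[of 1 q] by (intro order_trans[OF norm_triangle_ineq]) simp
        also have "\<dots> = (1 + M) * norm q"
          by (simp add: algebra_simps)
        also have "\<dots> \<le> (1 + M) * (M / real (Suc n) * norm z)"
          using R_norm[of "real (Suc n)" z] M by (intro mult_left_mono) (simp_all add: q_def)
        also have "\<dots> = (M + M * M) * norm z / real (Suc n)"
          by (simp add: field_simps)
        finally show ?thesis .
      qed
      then show "eventually (\<lambda>n. norm (R 1 (y n - z)) \<le> (M + M * M) * norm z / real (Suc n)) sequentially"
        by simp
      show "(\<lambda>n. (M + M * M) * norm z / real (Suc n)) \<longlonglongrightarrow> 0"
        by (rule LIMSEQ_Suc[OF lim_const_over_n])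
    qed simp
    \<comment> \<open>Since \<open>y n\<close> is orthogonal to \<open>z\<close>, (z|z) = (z - y
      n|z). Splitting the second \<open>z\<close> into \<open>z - G h\<close> and \<open>G h\<close>
      leaves a term bounded uniformly in \<open>n\<close> and one that tends to zero through
      \<open>R 1\<close>.\<close>
    have test: "(norm z)\<^sup>2 \<le> (M + 1) * norm z * norm (z - G h)" for h
    proof -
      have le: "(norm z)\<^sup>2 \<le> (M + 1) * norm z * norm (z - G h) + norm (R 1 (y n - z)) * norm h" for n
      proof -
        have "cinner z (y n) = 0"
          by (rule z[OF y_dom])
        then have "cinner (y n) z = 0"
          using cinner_eq_0_commute by blast
        then have "complex_of_real ((norm z)\<^sup>2) = cinner (z - y n) z"
          by (simp add: cinner.diff_left cinner_self)
        also have "\<dots> = cinner (z - y n) (z - G h) + cinner (R 1 (z - y n)) h"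
          by (simp add: cinner.diff_right G)
        finally have "(norm z)\<^sup>2 = cmod (cinner (z - y n) (z - G h) + cinner (R 1 (z - y n)) h)"
          by (metis norm_of_real abs_of_nonneg zero_le_power2)
        also have "\<dots> \<le> norm (z - y n) * norm (z - G h) + norm (R 1 (z - y n)) * norm h"
          by (intro order_trans[OF norm_triangle_ineq] add_mono norm_cinner_le)
        also have "norm (R 1 (z - y n)) = norm (R 1 (y n - z))"
          by (simp add: clinear_diff[OF R_lin] norm_minus_commute)
        also have "norm (z - y n) * norm (z - G h) \<le> ((M + 1) * norm z) * norm (z - G h)"
          using norm_triangle_ineq4[of z "y n"] y_norm[of n] by (intro mult_right_mono) (simp_all add: algebra_simps)
        finally show ?thesis
          by simp
      qed
      have "(\<lambda>n. (M + 1) * norm z * norm (z - G h) + norm (R 1 (y n - z)) * norm h)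
          \<longlonglongrightarrow> (M + 1) * norm z * norm (z - G h) + 0 * norm h"
        by (intro tendsto_intros lim0)
      from LIMSEQ_le_const[OF this] le have "(norm z)\<^sup>2 \<le> (M + 1) * norm z * norm (z - G h) + 0 * norm h"
        by blast
      then show ?thesis
        by simp
    qed
    obtain g where g: "(\<lambda>n. G (g n)) \<longlonglongrightarrow> z"
      by (rule closure_range_approx[OF G_dense])
    have "(norm z)\<^sup>2 \<le> (M + 1) * norm z * norm (z - G (g n))" for n
      by (rule test)
    moreover have "(\<lambda>n. (M + 1) * norm z * norm (z - G (g n))) \<longlonglongrightarrow> (M + 1) * norm z * norm (z - z)"
      by (intro tendsto_intros g)
    ultimately have "(norm z)\<^sup>2 \<le> (M + 1) * norm z * norm (z - z)"
      using LIMSEQ_le_const by blast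
    then show "z = 0"
      by simp
  qed
qed

lemma quasi_sectorial_closed_dense:
  fixes A :: "'h::complex_hilbert \<rightharpoonup> 'h"
  assumes "quasi_sectorial A"
  shows "closed_dense A"
proof -
  obtain \<mu> :: real where sect: "sectorial (op_shift A \<mu>)"
    using assms by (auto simp: quasi_sectorial_def)
  define S where "S = op_shift A \<mu>"
  have S_iff: "A x = Some y \<longleftrightarrow> S x = Some (y - \<mu> *\<^sub>C x)" for x y
    by (simp add: S_def op_shift_eq_Some_iff)
  have S: "linear_op S"
    using sect by (simp add: S_def sectorial_def)
  have "1 \<in> resolvent_set S"
  proof -
    obtain \<theta> where "\<theta> \<ge> 0" "sector \<theta> \<subseteq> resolvent_set S"
      using sect by (auto simp: S_def sectorial_def)
    moreover from this have "- (pi / 2) \<le> \<theta>"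
      using pi_ge_zero by linarith
    then have "1 \<in> sector \<theta>"
      using \<open>\<theta> \<ge> 0\<close> by (simp add: sector_def)
    ultimately show ?thesis
      by blast
  qed
  then have closed: "closed_op S"
    by (rule closed_op_if_resolvent[OF S])
  have "closed_op A"
  proof (rule closed_opI)
    show "linear_op A"
    proof (rule linear_opI)
      show "A 0 = Some 0"
        by (simp add: S_iff linear_op_zero[OF S])
      show "A (x + x') = Some (y + y')" if "A x = Some y" "A x' = Some y'" for x x' y y'
        using linear_op_add[OF S that[unfolded S_iff]] by (simp add: S_iff scaleC_add_right algebra_simps)
      show "A (c *\<^sub>C x) = Some (c *\<^sub>C y)" if "A x = Some y" for c x y
        using linear_op_scaleC[OF S that[unfolded S_iff], of c]
        by (simp add: S_iff scaleC.diff_right scaleC_scaleC mult.commute)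
    qed
    fix f g x y
    assume fg: "\<And>n::nat. A (f n) = Some (g n)" "f \<longlonglongrightarrow> x" "g \<longlonglongrightarrow> y"
    have "(\<lambda>n. g n - \<mu> *\<^sub>C f n) \<longlonglongrightarrow> y - \<mu> *\<^sub>C x"
      by (intro tendsto_diff scaleC.tendsto tendsto_const fg)
    with fg(1,2) show "A x = Some y"
      unfolding S_iff by (rule closed_op_limit[OF closed])
  qed
  moreover have "dom A = dom S"
    by (auto simp: S_def emb_shift_def dom_def)
  ultimately show ?thesis
    using sectorial_dense[OF sect] by unfold_locales (simp_all add: S_def)
qed

section \<open>Complementary closed subspaces\<close>

text \<open>The open mapping argument: by Baire some ball is approximated with bounded first components,
  and successive approximation makes the approximation exact.\<close>

lemma complementary_subspaces_bound:
  fixes P N :: "'a::complex_banach set"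
  assumes P: "closed P" "csubspace P" and N: "closed N" "csubspace N"
    and sum: "\<And>v. \<exists>p\<in>P. \<exists>m\<in>N. v = p + m" and trivial: "P \<inter> N = {0}"
  obtains c where "\<And>p m. p \<in> P \<Longrightarrow> m \<in> N \<Longrightarrow> norm p \<le> c * norm (p + m)"
proof -
  define S where "S = (\<lambda>n::nat. {p + m | p m. p \<in> P \<and> m \<in> N \<and> norm p \<le> real n})"
  have "\<exists>n. interior (closure (S n)) \<noteq> {}"
  proof (rule ccontr)
    assume "\<not> ?thesis"
    then have "euclidean interior_of \<Union>(range (\<lambda>n. closure (S n))) = {}"
      by (intro Baire_category_alt disjI1 completely_metrizable_space_euclidean) auto
    moreover have "\<Union>(range (\<lambda>n. closure (S n))) = UNIV"
    proof (rule UNIV_eq_I[symmetric])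
      fix v
      obtain p m where "p \<in> P" "m \<in> N" "v = p + m"
        using sum by blast
      moreover obtain n where "norm p \<le> real n"
        using real_arch_simple by blast
      ultimately have "v \<in> S n"
        unfolding S_def by blast
      then show "v \<in> \<Union>(range (\<lambda>n. closure (S n)))"
        using closure_subset by blast
    qed
    ultimately show False
      by simp
  qed
  then obtain n a where "a \<in> interior (closure (S n))"
    by blast
  then obtain \<delta> where \<delta>: "\<delta> > 0" "ball a \<delta> \<subseteq> closure (S n)"
    by (meson mem_interior)
  \<comment> \<open>A small \<open>x\<close> is the difference of \<open>a + x\<close> and
    \<open>a\<close>, which doubles the bound on the components in \<open>P\<close>.\<close>
  have step0: "x \<in> closure (S (2 * n))" if x: "norm x < \<delta>" for x
  proof -
    have "a + x \<in> closure (S n)" "a \<in> closure (S n)"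
      using \<delta> x by (auto simp: dist_norm subset_iff)
    then obtain f g where f: "\<And>k::nat. f k \<in> S n" "f \<longlonglongrightarrow> a + x" and g: "\<And>k::nat. g k \<in> S n" "g \<longlonglongrightarrow> a"
      unfolding closure_sequential by blast
    have "f k - g k \<in> S (2 * n)" for k
    proof -
      obtain p m p' m' where "f k = p + m" "p \<in> P" "m \<in> N" "norm p \<le> n"
        "g k = p' + m'" "p' \<in> P" "m' \<in> N" "norm p' \<le> n"
        using f(1)[of k] g(1)[of k] unfolding S_def by blast
      moreover from this have "p - p' \<in> P" "m - m' \<in> N" "norm (p - p') \<le> real (2 * n)"
        using norm_triangle_ineq4[of p p'] by (auto intro: complex_vec.subspace_diff P N)
      moreover from calculation have "f k - g k = (p - p') + (m - m')"
        by simp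
      ultimately show ?thesis
        unfolding S_def by blast
    qed
    moreover have "(\<lambda>k. f k - g k) \<longlonglongrightarrow> x"
      using tendsto_diff[OF f(2) g(2)] by simp
    ultimately show ?thesis
      unfolding closure_sequential by (intro exI[of _ "\<lambda>k. f k - g k"]) simp
  qed
  \<comment> \<open>Scaling \<open>v\<close> to norm \<delta> / 2 gives components in
    \<open>P\<close> of norm at most 2 n; scaling back multiplies by 2 / \<delta> times the norm of
    \<open>v\<close>.\<close>
  define c where "c = 4 * real n / \<delta>"
  have c0: "c \<ge> 0"
    using \<delta>(1) by (simp add: c_def)
  have "\<exists>p m. p \<in> P \<and> m \<in> N \<and> norm p \<le> c * norm v \<and> norm (v - (p + m)) \<le> norm v / 2" for v
  proof (cases "v = 0")
    case True
    then show ?thesis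
      using complex_vec.subspace_0[OF P(2)] complex_vec.subspace_0[OF N(2)] by (intro exI[of _ 0]) simp
  next
    case False
    define t where "t = \<delta> / (2 * norm v)"
    have t: "t > 0" "t * norm v = \<delta> / 2"
      using False \<delta>(1) by (simp_all add: t_def)
    have "t *\<^sub>R v \<in> closure (S (2 * n))"
      using t \<delta>(1) by (intro step0) simp
    then obtain s where "s \<in> S (2 * n)" "dist s (t *\<^sub>R v) < t * norm v / 2"
      using t \<delta>(1) unfolding closure_approachable by (metis half_gt_zero)
    then obtain p m where pm: "p \<in> P" "m \<in> N" "norm p \<le> real (2 * n)" "norm (p + m - t *\<^sub>R v) < t * norm v / 2"
      unfolding S_def dist_norm by blast
    have "(1 / t) *\<^sub>R p \<in> P" "(1 / t) *\<^sub>R m \<in> N"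
      by (intro csubspace_scaleR P N pm)+
    moreover have "norm ((1 / t) *\<^sub>R p) \<le> c * norm v"
      using pm(3) t False \<delta>(1) by (simp add: c_def t_def field_simps)
    moreover have "norm (v - ((1 / t) *\<^sub>R p + (1 / t) *\<^sub>R m)) \<le> norm v / 2"
    proof -
      have "v - ((1 / t) *\<^sub>R p + (1 / t) *\<^sub>R m) = (- 1 / t) *\<^sub>R (p + m - t *\<^sub>R v)"
        using t(1) by (simp add: algebra_simps)
      then have "norm (v - ((1 / t) *\<^sub>R p + (1 / t) *\<^sub>R m)) = norm (p + m - t *\<^sub>R v) / t"
        using t(1) by simp
      also have "\<dots> \<le> (t * norm v / 2) / t"
        using pm(4) t(1) by (intro divide_right_mono) simp_all
      finally show ?thesis
        using t(1) by simp
    qed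
    ultimately show ?thesis
      by blast
  qed
  then obtain \<pi> \<nu> where \<pi>: "\<And>v. \<pi> v \<in> P" and \<nu>: "\<And>v. \<nu> v \<in> N"
    and \<pi>_le: "\<And>v. norm (\<pi> v) \<le> c * norm v" and rest: "\<And>v. norm (v - (\<pi> v + \<nu> v)) \<le> norm v / 2"
    by metis
  have "norm p0 \<le> (2 * c) * norm (p0 + m0)" if p0: "p0 \<in> P" and m0: "m0 \<in> N" for p0 m0
  proof -
    define v where "v = p0 + m0"
    \<comment> \<open>\<open>w k\<close> is what remains of \<open>v\<close> after \<open>k\<close>
      approximations; it halves each time. Only the parts in \<open>P\<close> are summed: the part
      in \<open>N\<close> is recovered as a limit because \<open>N\<close> is closed.\<close>
    define w where "w = rec_nat v (\<lambda>_ u. u - (\<pi> u + \<nu> u))"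
    have w_Suc: "w (Suc k) = w k - (\<pi> (w k) + \<nu> (w k))" for k
      by (simp add: w_def)
    have w_norm: "norm (w k) \<le> norm v * (1 / 2) ^ k" for k
    proof (induction k)
      case (Suc k)
      then show ?case
        unfolding w_Suc using rest[of "w k"] by simp
    qed (simp add: w_def)
    have partial: "v - w K = (\<Sum>k<K. \<pi> (w k)) + (\<Sum>k<K. \<nu> (w k))" for K
      by (induction K) (simp add: w_def, simp add: w_Suc algebra_simps)
    have geo: "(\<lambda>k. c * norm v * (1 / 2) ^ k) sums (2 * c * norm v)"
      using sums_mult[OF geometric_sums[of "1/2::real"], of "c * norm v"] by (simp add: mult_ac)
    have term_le: "norm (\<pi> (w k)) \<le> c * norm v * (1 / 2) ^ k" for k
      using order_trans[OF \<pi>_le mult_left_mono[OF w_norm[of k] c0]] by (simp add: mult.assoc)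
    have summable: "summable (\<lambda>k. \<pi> (w k))"
      by (rule summable_comparison_test'[OF sums_summable[OF geo] term_le])
    define p where "p = (\<Sum>k. \<pi> (w k))"
    have p_lim: "(\<lambda>K. \<Sum>k<K. \<pi> (w k)) \<longlonglongrightarrow> p"
      unfolding p_def by (rule summable_LIMSEQ[OF summable])
    have pP: "p \<in> P"
      by (rule closed_sequentially[OF P(1) _ p_lim]) (intro complex_vec.subspace_sum P \<pi>)
    have "w \<longlonglongrightarrow> 0"
    proof (rule Lim_null_comparison)
      show "eventually (\<lambda>k. norm (w k) \<le> norm v * (1 / 2) ^ k) sequentially"
        by (simp add: w_norm)
      show "(\<lambda>k. norm v * (1 / 2) ^ k) \<longlonglongrightarrow> 0"
        by (intro tendsto_mult_right_zero LIMSEQ_realpow_zero) simp_all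
    qed
    then have "(\<lambda>K. v - w K - (\<Sum>k<K. \<pi> (w k))) \<longlonglongrightarrow> v - 0 - p"
      by (intro tendsto_diff tendsto_const p_lim)
    moreover have "v - w K - (\<Sum>k<K. \<pi> (w k)) \<in> N" for K
    proof -
      have "v - w K - (\<Sum>k<K. \<pi> (w k)) = (\<Sum>k<K. \<nu> (w k))"
        by (simp add: partial)
      then show ?thesis
        by (simp add: complex_vec.subspace_sum N \<nu>)
    qed
    ultimately have "v - p \<in> N"
      using closed_sequentially[OF N(1)] by fastforce
    then have "(v - p) - m0 \<in> N" "p0 - p \<in> P"
      using complex_vec.subspace_diff[OF N(2) _ m0] complex_vec.subspace_diff[OF P(2) p0 pP] by blast+
    then have "p0 - p \<in> P \<inter> N"
      by (simp add: v_def algebra_simps)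
    then have "p0 = p"
      using trivial by simp
    moreover have "norm p \<le> 2 * c * norm v"
      unfolding p_def sums_unique[OF geo]
      by (rule norm_suminf_le[OF term_le sums_summable[OF geo]])
    ultimately show ?thesis
      by (simp add: v_def)
  qed
  then show ?thesis
    by (rule that)
qed

section \<open>Neutrality of the spectral subspaces\<close>

text \<open>Linear growth leaves a polynomial of degree at most one by Liouville's theorem, and a
  bound on a single ray removes its slope.\<close>

lemma bounded_entire_on_half_line_const:
  assumes hol: "F holomorphic_on UNIV" and lin: "\<And>z. 1 \<le> cmod z \<Longrightarrow> cmod (F z) \<le> B * cmod z"
    and bnd: "\<And>t::real. 0 < t \<Longrightarrow> cmod (F (- of_real t)) \<le> D"
  shows "F z = F 0"
proof -
  define a c where "a = F 0" and "c = deriv F 0"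
  have F: "F z = a + c * z" for z
  proof -
    have "F z = (\<Sum>k\<le>1. (deriv ^^ k) F 0 / fact k * z ^ k)"
      by (rule Liouville_polynomial[OF hol, of 1 B]) (use lin in simp)
    then show ?thesis
      by (simp add: a_def c_def)
  qed
  have bound: "cmod c * t \<le> D + cmod a" if "t > 0" for t :: real
  proof -
    have "cmod c * t = cmod (a - F (- of_real t))"
      using that by (simp add: F norm_mult)
    then show ?thesis
      using norm_triangle_ineq4[of a "F (- of_real t)"] bnd[OF that] by simp
  qed
  have "c = 0"
  proof (rule ccontr)
    assume "c \<noteq> 0"
    then have c: "cmod c > 0"
      by simp
    define t where "t = (\<bar>D + cmod a\<bar> + 1) / cmod c"
    have "t > 0"
      using c by (simp add: t_def add_nonneg_pos)
    from bound[OF this] show False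
      using c by (simp add: t_def)
  qed
  then show ?thesis
    by (simp add: F)
qed

text \<open>Meant for h w = b (R w u) v: the resolvent identity supplies the difference quotient
  \<open>k\<close> in closed form, so only its continuity at \<open>z\<close> is left to
  prove.\<close>

lemma has_field_derivative_lipschitz:
  fixes h k :: "complex \<Rightarrow> complex"
  assumes "open S" "z \<in> S" and eq: "\<And>w. w \<in> S \<Longrightarrow> h w - h z = (w - z) * k w"
    and lip: "\<And>w. w \<in> S \<Longrightarrow> cmod (k w - k z) \<le> C * cmod (w - z)"
  shows "(h has_field_derivative k z) (at z)"
proof -
  have ev: "eventually (\<lambda>w. w \<in> S) (at z)"
    using assms(1,2) eventually_at_topological by blast
  have "((\<lambda>w. C * cmod (w - z)) \<longlongrightarrow> C * cmod (z - z)) (at z)"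
    by (intro tendsto_intros)
  then have "((\<lambda>w. C * cmod (w - z)) \<longlongrightarrow> 0) (at z)"
    by simp
  then have "((\<lambda>w. k w - k z) \<longlongrightarrow> 0) (at z)"
    by (rule Lim_null_comparison[rotated]) (use ev lip in \<open>auto elim: eventually_mono\<close>)
  then have "(k \<longlongrightarrow> k z) (at z)"
    by (rule LIM_zero_cancel)
  moreover have "eventually (\<lambda>w. (h w - h z) / (w - z) = k w) (at z)"
    using ev eventually_at_topological
    by (auto simp: eventually_at_filter eq elim!: eventually_mono)
  ultimately have "((\<lambda>w. (h w - h z) / (w - z)) \<longlongrightarrow> k z) (at z)"
    by (simp cong: tendsto_cong)
  then show ?thesis
    by (simp add: has_field_derivative_iff)
qed

text \<open>\<open>R\<close> is the resolvent of an operator with spectrum in the right half-plane, and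
  \<open>b u v\<close> stands for an indefinite form \<open>[R 0 u|v]\<close> for which the operator is skew-symmetric.
  By the symmetry on the imaginary axis the function
  \<open>\<lambda>z. b (u + z R z u) v\<close> extends to an entire function of at most linear growth.\<close>

locale half_plane_resolvent =
  fixes W :: "'v::complex_banach set" and R :: "complex \<Rightarrow> 'v \<Rightarrow> 'v" and M :: real
    and b :: "'v \<Rightarrow> 'v \<Rightarrow> complex"
  assumes W: "csubspace W"
    and R_W: "Re z \<le> 0 \<Longrightarrow> u \<in> W \<Longrightarrow> R z u \<in> W"
    and R_id: "Re z \<le> 0 \<Longrightarrow> Re w \<le> 0 \<Longrightarrow> u \<in> W \<Longrightarrow> R z u - R w u = (z - w) *\<^sub>C R z (R w u)"
    and R0_diff: "u \<in> W \<Longrightarrow> u' \<in> W \<Longrightarrow> R 0 (u - u') = R 0 u - R 0 u'"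
    and R_bound: "Re z < 0 \<Longrightarrow> u \<in> W \<Longrightarrow> norm (R z u) \<le> M * norm u"
    and R0_dense: "u \<in> W \<Longrightarrow> \<exists>f. (\<forall>n::nat. f n \<in> W) \<and> (\<lambda>n. R 0 (f n)) \<longlonglongrightarrow> u"
    and b_add: "u \<in> W \<Longrightarrow> u' \<in> W \<Longrightarrow> v \<in> W \<Longrightarrow> b (u + u') v = b u v + b u' v"
    and b_scale: "u \<in> W \<Longrightarrow> v \<in> W \<Longrightarrow> b (a *\<^sub>C u) v = a * b u v"
    and b_bound: "v \<in> W \<Longrightarrow> \<exists>C. \<forall>u\<in>W. cmod (b u v) \<le> C * norm u"
    and b_sym: "Re z = 0 \<Longrightarrow> u \<in> W \<Longrightarrow> v \<in> W \<Longrightarrow> b (u + z *\<^sub>C R z u) v = cnj (b (v + z *\<^sub>C R z v) u)"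
begin

lemma b_diff:
  assumes "u \<in> W" "u' \<in> W" "v \<in> W"
  shows "b (u - u') v = b u v - b u' v"
proof -
  have "b (u - u' + u') v = b (u - u') v + b u' v"
    by (rule b_add) (use assms complex_vec.subspace_diff[OF W] in auto)
  then show ?thesis
    by simp
qed

lemma M_nonneg_bound: "Re z < 0 \<Longrightarrow> u \<in> W \<Longrightarrow> norm (R z u) \<le> \<bar>M\<bar> * norm u"
  by (rule order_trans[OF R_bound]) (auto intro: mult_right_mono)

text \<open>The bound is assumed in the open half-plane only. Comparing \<open>z\<close> with a
  point slightly to its left by the resolvent identity carries it, with the same constant, to the
  imaginary axis.\<close>

lemma R_norm:
  assumes z: "Re z \<le> 0" and u: "u \<in> W"
  shows "norm (R z u) \<le> \<bar>M\<bar> * norm u"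
proof (rule field_le_epsilon)
  fix e :: real assume e: "e > 0"
  define \<epsilon> where "\<epsilon> = e / (\<bar>M\<bar> * norm (R z u) + 1)"
  have \<epsilon>: "\<epsilon> > 0"
    using e by (simp add: \<epsilon>_def add_nonneg_pos)
  define w where "w = z - of_real \<epsilon>"
  have w: "Re w < 0"
    using z \<epsilon> by (simp add: w_def)
  have "R z u = R w u - (w - z) *\<^sub>C R w (R z u)"
    using R_id[of w z u] w z u by (simp add: algebra_simps)
  also have "norm \<dots> \<le> norm (R w u) + cmod (w - z) * norm (R w (R z u))"
    unfolding norm_scaleC[symmetric] by (rule norm_triangle_ineq4)
  also have "\<dots> \<le> \<bar>M\<bar> * norm u + \<epsilon> * (\<bar>M\<bar> * norm (R z u))"
    using \<epsilon> w z u by (intro add_mono mult_mono M_nonneg_bound R_W) (auto simp: w_def)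
  also have "\<epsilon> * (\<bar>M\<bar> * norm (R z u)) \<le> \<epsilon> * (\<bar>M\<bar> * norm (R z u) + 1)"
    using \<epsilon> by simp
  also have "\<dots> = e"
    using add_nonneg_pos[of "\<bar>M\<bar> * norm (R z u)" 1] by (simp add: \<epsilon>_def)
  finally show "norm (R z u) \<le> \<bar>M\<bar> * norm u + e"
    by simp
qed

text \<open>\<open>R 0\<close> maps \<open>u + z R z u\<close> to \<open>R z u\<close>, so this is
  the form [R z u|v], expressed by a functional that is bounded in its first argument.\<close>

definition \<phi> :: "'v \<Rightarrow> 'v \<Rightarrow> complex \<Rightarrow> complex"
  where "\<phi> u v z = b (u + z *\<^sub>C R z u) v"

lemma \<phi>_eq: "Re z \<le> 0 \<Longrightarrow> u \<in> W \<Longrightarrow> v \<in> W \<Longrightarrow> \<phi> u v z = b u v + z * b (R z u) v"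
  by (simp add: \<phi>_def b_add b_scale R_W complex_vec.subspace_scale[OF W])

lemma b_R_diff:
  assumes "Re z \<le> 0" "Re w \<le> 0" "u \<in> W" "v \<in> W"
  shows "b (R w u) v - b (R z u) v = (w - z) * b (R w (R z u)) v"
proof -
  have "b (R w u) v - b (R z u) v = b (R w u - R z u) v"
    using assms by (simp add: b_diff R_W)
  then show ?thesis
    using assms by (simp add: R_id b_scale R_W)
qed

lemma b_R_lipschitz:
  assumes u: "u \<in> W" and v: "v \<in> W"
  obtains C where "0 \<le> C" "\<And>z w. Re z \<le> 0 \<Longrightarrow> Re w \<le> 0 \<Longrightarrow> cmod (b (R w u) v - b (R z u) v) \<le> C * cmod (w - z)"
    "\<And>z. Re z \<le> 0 \<Longrightarrow> cmod (b (R z u) v) \<le> C"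
proof -
  obtain C where C: "\<And>u. u \<in> W \<Longrightarrow> cmod (b u v) \<le> C * norm u"
    using b_bound[OF v] by blast
  have C': "cmod (b u v) \<le> \<bar>C\<bar> * norm u" if "u \<in> W" for u
    by (rule order_trans[OF C[OF that] mult_right_mono[OF abs_ge_self norm_ge_zero]])
  define D where "D = \<bar>C\<bar> * (\<bar>M\<bar> * (\<bar>M\<bar> * norm u)) + \<bar>C\<bar> * (\<bar>M\<bar> * norm u)"
  have D1: "\<bar>C\<bar> * (\<bar>M\<bar> * (\<bar>M\<bar> * norm u)) \<le> D" "\<bar>C\<bar> * (\<bar>M\<bar> * norm u) \<le> D" "0 \<le> D"
    by (simp_all add: D_def)
  show ?thesis
  proof (rule that)
    show "0 \<le> D"
      by (rule D1)
    fix z :: complex assume z: "Re z \<le> 0"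
    show "cmod (b (R z u) v) \<le> D"
      using order_trans[OF C'[OF R_W[OF z u]] mult_left_mono[OF R_norm[OF z u], of "\<bar>C\<bar>"]] D1 by simp
    fix w :: complex assume w: "Re w \<le> 0"
    have "cmod (b (R w (R z u)) v) \<le> \<bar>C\<bar> * norm (R w (R z u))"
      by (intro C' R_W w z u)
    also have "\<dots> \<le> \<bar>C\<bar> * (\<bar>M\<bar> * norm (R z u))"
      by (intro mult_left_mono R_norm R_W w z u) simp
    also have "\<dots> \<le> \<bar>C\<bar> * (\<bar>M\<bar> * (\<bar>M\<bar> * norm u))"
      by (intro mult_left_mono R_norm z u) simp_all
    also have "\<dots> \<le> D"
      by (rule D1)
    finally have "cmod (w - z) * cmod (b (R w (R z u)) v) \<le> cmod (w - z) * D"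
      by (rule mult_left_mono) simp
    then show "cmod (b (R w u) v - b (R z u) v) \<le> D * cmod (w - z)"
      by (simp add: b_R_diff[OF z w u v] norm_mult mult.commute)
  qed
qed

lemma holomorphic_\<phi>:
  assumes u: "u \<in> W" and v: "v \<in> W"
  shows "\<phi> u v holomorphic_on {z. Re z < 0}"
proof -
  have open_half: "open {z::complex. Re z < 0}"
    by (rule open_halfspace_Re_lt)
  have "(\<lambda>z. b (R z u) v) holomorphic_on {z. Re z < 0}"
    unfolding holomorphic_on_open[OF open_half]
  proof
    fix z :: complex assume "z \<in> {z. Re z < 0}"
    then have z: "Re z < 0"
      by simp
    obtain C where C: "\<And>x w. Re x \<le> 0 \<Longrightarrow> Re w \<le> 0 \<Longrightarrow>
        cmod (b (R w (R z u)) v - b (R x (R z u)) v) \<le> C * cmod (w - x)"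
      using b_R_lipschitz[OF R_W[of z u] v] z u by (metis less_imp_le)
    have "((\<lambda>w. b (R w u) v) has_field_derivative b (R z (R z u)) v) (at z)"
    proof (rule has_field_derivative_lipschitz[OF open_half, where k = "\<lambda>w. b (R w (R z u)) v" and C = C])
      show "b (R w u) v - b (R z u) v = (w - z) * b (R w (R z u)) v" if "w \<in> {z. Re z < 0}" for w
        using that z u v by (intro b_R_diff) auto
      show "cmod (b (R w (R z u)) v - b (R z (R z u)) v) \<le> C * cmod (w - z)" if "w \<in> {z. Re z < 0}" for w
        using that z by (intro C) auto
    qed (use z in simp)
    then show "\<exists>f'. ((\<lambda>w. b (R w u) v) has_field_derivative f') (at z)"
      by blast
  qed
  then have "(\<lambda>z. b u v + z * b (R z u) v) holomorphic_on {z. Re z < 0}"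
    by (intro holomorphic_intros)
  then show ?thesis
    by (rule holomorphic_transform) (simp add: \<phi>_eq u v)
qed

lemma continuous_\<phi>:
  assumes u: "u \<in> W" and v: "v \<in> W"
  shows "continuous_on {z. Re z \<le> 0} (\<phi> u v)"
proof -
  obtain C where C: "0 \<le> C" "\<And>z w. Re z \<le> 0 \<Longrightarrow> Re w \<le> 0 \<Longrightarrow>
      cmod (b (R w u) v - b (R z u) v) \<le> C * cmod (w - z)"
    using b_R_lipschitz[OF u v] by metis
  have "C-lipschitz_on {z. Re z \<le> 0} (\<lambda>z. b (R z u) v)"
    by (rule lipschitz_onI) (use C in \<open>auto simp: dist_norm\<close>)
  then have "continuous_on {z. Re z \<le> 0} (\<lambda>z. b (R z u) v)"
    by (rule lipschitz_on_continuous_on)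
  then have "continuous_on {z. Re z \<le> 0} (\<lambda>z. b u v + z * b (R z u) v)"
    by (intro continuous_intros)
  then show ?thesis
    by (simp add: \<phi>_eq u v cong: continuous_on_cong_simp)
qed

lemma \<phi>_linear_growth:
  assumes u: "u \<in> W" and v: "v \<in> W"
  obtains B where "\<And>z. Re z \<le> 0 \<Longrightarrow> 1 \<le> cmod z \<Longrightarrow> cmod (\<phi> u v z) \<le> B * cmod z"
proof -
  obtain C where C: "0 \<le> C" "\<And>z. Re z \<le> 0 \<Longrightarrow> cmod (b (R z u) v) \<le> C"
    using b_R_lipschitz[OF u v] by metis
  have "cmod (\<phi> u v z) \<le> (cmod (b u v) + C) * cmod z" if "Re z \<le> 0" "1 \<le> cmod z" for z
  proof -
    have "cmod (\<phi> u v z) \<le> cmod (b u v) + cmod z * cmod (b (R z u) v)"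
      unfolding \<phi>_eq[OF that(1) u v] norm_mult[symmetric] by (rule norm_triangle_ineq)
    also have "\<dots> \<le> cmod (b u v) * cmod z + cmod z * C"
      using that C mult_left_mono[of 1 "cmod z" "cmod (b u v)"] by (intro add_mono mult_left_mono) auto
    finally show ?thesis
      by (simp add: algebra_simps)
  qed
  then show ?thesis
    by (rule that)
qed

lemma \<phi>_sym: "Re z = 0 \<Longrightarrow> u \<in> W \<Longrightarrow> v \<in> W \<Longrightarrow> \<phi> u v z = cnj (\<phi> v u (- cnj z))"
  using b_sym[of z u v] complex_eqI[of "- cnj z" z] by (simp add: \<phi>_def)

lemma \<phi>_const:
  assumes u: "u \<in> W" and v: "v \<in> W" and bnd: "\<And>t::real. 0 < t \<Longrightarrow> cmod (\<phi> u v (- of_real t)) \<le> D"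
    and z: "Re z \<le> 0"
  shows "\<phi> u v z = \<phi> u v 0"
proof -
  \<comment> \<open>The continuation across the imaginary axis exchanges \<open>u\<close> and
    \<open>v\<close>; the two pieces agree on the axis by \<open>\<phi>_sym\<close>.\<close>
  define F where "F = (\<lambda>z. if Re z \<le> 0 then \<phi> u v z else cnj (\<phi> v u (- cnj z)))"
  have "(\<lambda>z. \<phi> v u (- z)) holomorphic_on {z. Re z > 0}"
    by (rule holomorphic_on_compose_gen[OF _ holomorphic_\<phi>[OF v u], unfolded o_def])
      (auto intro: holomorphic_intros)
  then have "cnj \<circ> (\<lambda>z. \<phi> v u (- z)) \<circ> cnj holomorphic_on {z. Re z > 0}"
    by (intro holomorphic_on_compose_cnj_cnj open_halfspace_Re_gt) (auto simp: image_iff intro: holomorphic_on_subset)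
  then have right: "F holomorphic_on {z. Re z > 0}"
    by (rule holomorphic_transform) (simp add: F_def)
  have left: "F holomorphic_on {z. Re z < 0}"
    by (rule holomorphic_transform[OF holomorphic_\<phi>[OF u v]]) (simp add: F_def)
  have "continuous_on ({z. Re z \<le> 0} \<union> {z. Re z \<ge> 0}) F"
    unfolding F_def
  proof (rule continuous_on_cases)
    show "continuous_on {z. 0 \<le> Re z} (\<lambda>z. cnj (\<phi> v u (- cnj z)))"
      by (intro continuous_on_cnj continuous_on_compose2[OF continuous_\<phi>[OF v u]] continuous_intros) auto
    show "\<forall>z. z \<in> {z. Re z \<le> 0} \<and> \<not> Re z \<le> 0 \<or> z \<in> {z. 0 \<le> Re z} \<and> Re z \<le> 0 \<longrightarrow>
        \<phi> u v z = cnj (\<phi> v u (- cnj z))"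
      by (auto intro: \<phi>_sym u v)
  qed (auto intro: closed_halfspace_Re_le closed_halfspace_Re_ge continuous_\<phi> u v)
  moreover have "{z. Re z \<le> 0} \<union> {z. Re z \<ge> 0} = (UNIV :: complex set)"
    by auto
  ultimately have cont: "continuous_on UNIV F"
    by simp
  \<comment> \<open>The direction 1 and the level 0 describe the line of real part zero.\<close>
  have hol: "F holomorphic_on UNIV"
    by (rule holomorphic_on_paste_across_line[of UNIV 1 F 0])
      (use left right cont in \<open>auto simp: inner_complex_def\<close>)
  obtain B1 where B1: "\<And>z. Re z \<le> 0 \<Longrightarrow> 1 \<le> cmod z \<Longrightarrow> cmod (\<phi> u v z) \<le> B1 * cmod z"
    using \<phi>_linear_growth[OF u v] by metis
  obtain B2 where B2: "\<And>z. Re z \<le> 0 \<Longrightarrow> 1 \<le> cmod z \<Longrightarrow> cmod (\<phi> v u z) \<le> B2 * cmod z"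
    using \<phi>_linear_growth[OF v u] by metis
  have "F z = F 0"
  proof (rule bounded_entire_on_half_line_const[OF hol, where B = "max B1 B2" and D = D])
    fix z assume z: "1 \<le> cmod z"
    have "B1 * cmod z \<le> max B1 B2 * cmod z" "B2 * cmod z \<le> max B1 B2 * cmod z"
      by (intro mult_right_mono; simp)+
    then show "cmod (F z) \<le> max B1 B2 * cmod z"
      using B1[OF _ z] B2[of "- cnj z"] z by (cases "Re z \<le> 0") (auto simp: F_def)
  qed (use bnd in \<open>simp add: F_def\<close>)
  with z show ?thesis
    by (simp add: F_def)
qed

lemma form_vanishes:
  assumes "u \<in> W" "v \<in> W"
  shows "b u v = 0"
proof -
  \<comment> \<open>With \<open>R 0 u\<close> in place of \<open>u\<close> the growing factor is
    absorbed: \<open>\<phi> (R 0 u) v z\<close> is \<open>b (R z u) v\<close>, which is bounded on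
    the closed left half-plane.\<close>
  have S_const: "b (R z u) v = b (R 0 u) v" if u: "u \<in> W" and v: "v \<in> W" and z: "Re z \<le> 0" for u v z
  proof -
    have R0u: "R 0 u \<in> W"
      by (rule R_W) (simp_all add: u)
    have \<phi>_R0: "\<phi> (R 0 u) v z = b (R z u) v" if "Re z \<le> 0" for z
      using R_id[of z 0 u] that u by (simp add: \<phi>_def algebra_simps)
    obtain D where "\<And>z. Re z \<le> 0 \<Longrightarrow> cmod (b (R z u) v) \<le> D"
      using b_R_lipschitz[OF u v] by metis
    then have "\<And>t::real. 0 < t \<Longrightarrow> cmod (\<phi> (R 0 u) v (- of_real t)) \<le> D"
      by (simp add: \<phi>_R0)
    from \<phi>_const[OF R0u v this z] show ?thesis
      by (simp add: \<phi>_R0 z)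
  qed
  \<comment> \<open>A constant \<open>b (R z u) v\<close> makes z b (R z (R 0 u)) v vanish; at z =
    -1 this is divided by z, and constancy for \<open>R 0 u\<close> moves the point back to
    0.\<close>
  have SS: "b (R 0 (R 0 u)) v = 0" if u: "u \<in> W" and v: "v \<in> W" for u v
  proof -
    have R0u: "R 0 u \<in> W"
      by (rule R_W) (simp_all add: u)
    have "b (R z u) v - b (R 0 u) v = z * b (R z (R 0 u)) v" if "Re z \<le> 0" for z
      using b_R_diff[of 0 z u v] that u v by simp
    from this[of "- 1"] show ?thesis
      using S_const[OF u v, of "- 1"] S_const[OF R0u v, of "- 1"] by simp
  qed
  have limit: "b w v = 0" if v: "v \<in> W" and w: "w \<in> W" and f: "\<And>n::nat. f n \<in> W" "f \<longlonglongrightarrow> w" "\<And>n. b (f n) v = 0"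
    for f w v
  proof -
    obtain C where C: "\<And>u. u \<in> W \<Longrightarrow> cmod (b u v) \<le> C * norm u"
      using b_bound[OF v] by blast
    have "cmod (b w v) \<le> C * norm (w - f n)" for n
      using C[OF complex_vec.subspace_diff[OF W w f(1)[of n]]] f by (simp add: b_diff w v)
    moreover have "(\<lambda>n. C * norm (w - f n)) \<longlonglongrightarrow> C * norm (w - w)"
      by (intro tendsto_intros f)
    ultimately have "cmod (b w v) \<le> C * norm (w - w)"
      using LIMSEQ_le_const by blast
    then show ?thesis
      by simp
  qed
  have S: "b (R 0 u) v = 0" if u: "u \<in> W" and v: "v \<in> W" for u v
  proof -
    obtain f where f: "\<And>n::nat. f n \<in> W" "(\<lambda>n. R 0 (f n)) \<longlonglongrightarrow> u"
      using R0_dense[OF u] by blast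
    have Rf: "R 0 (f n) \<in> W" for n
      by (rule R_W) (simp_all add: f)
    have le: "norm (R 0 (R 0 (f n)) - R 0 u) \<le> \<bar>M\<bar> * norm (R 0 (f n) - u)" for n
      using R_norm[of 0, OF _ complex_vec.subspace_diff[OF W Rf u]] by (simp add: R0_diff Rf u)
    have lim: "(\<lambda>n. \<bar>M\<bar> * norm (R 0 (f n) - u)) \<longlonglongrightarrow> 0"
      by (intro tendsto_mult_right_zero tendsto_norm_zero LIM_zero f)
    have "(\<lambda>n. R 0 (R 0 (f n)) - R 0 u) \<longlonglongrightarrow> 0"
      by (rule Lim_null_comparison[OF always_eventually[OF allI[OF le]] lim])
    then have "(\<lambda>n. R 0 (R 0 (f n))) \<longlonglongrightarrow> R 0 u"
      by (rule LIM_zero_cancel)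
    then show ?thesis
      by (rule limit[OF v _ _ _ SS[OF f(1) v], rotated 2]) (simp_all add: R_W f(1) u)
  qed
  obtain f where f: "\<And>n::nat. f n \<in> W" "(\<lambda>n. R 0 (f n)) \<longlonglongrightarrow> u"
    using R0_dense[OF assms(1)] by blast
  show ?thesis
    by (rule limit[OF assms(2,1) _ f(2)]) (simp_all add: R_W f S assms)
qed

end

section \<open>Operators that are skew-symmetric for a partially defined form\<close>

lemma restrict_map_eq_Some_iff: "(T |` W) x = Some y \<longleftrightarrow> x \<in> W \<and> T x = Some y"
  by (auto simp: restrict_map_def)

lemma linear_op_restrict:
  assumes T: "linear_op T" and W: "csubspace W"
  shows "linear_op (T |` W)"
  by (rule linear_opI; unfold restrict_map_eq_Some_iff)
    (auto intro: linear_op_zero[OF T] linear_op_add[OF T] linear_op_scaleC[OF T]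
      complex_vec.subspace_0[OF W] complex_vec.subspace_add[OF W] complex_vec.subspace_scale[OF W])

text \<open>Skew-symmetry would read [p|T q] = -[T p|q], but \<open>T p\<close> need not lie in the
  domain; \<open>form_skew\<close> replaces the right side by the conjugate of [q|T p].\<close>

locale skew_form =
  fixes T :: "'v::complex_banach \<rightharpoonup> 'v" and form :: "'v \<Rightarrow> 'v \<Rightarrow> complex"
  assumes T: "linear_op T"
    and form_add_left: "p \<in> dom T \<Longrightarrow> q \<in> dom T \<Longrightarrow> form (p + q) v = form p v + form q v"
    and form_scale_left: "p \<in> dom T \<Longrightarrow> form (a *\<^sub>C p) v = a * form p v"
    and form_add_right: "p \<in> dom T \<Longrightarrow> form p (v + w) = form p v + form p w"
    and form_scale_right: "p \<in> dom T \<Longrightarrow> form p (a *\<^sub>C v) = cnj a * form p v"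
    and form_bound: "p \<in> dom T \<Longrightarrow> \<exists>C. \<forall>v. cmod (form p v) \<le> C * norm v"
    and form_anti: "p \<in> dom T \<Longrightarrow> q \<in> dom T \<Longrightarrow> form p q = - cnj (form q p)"
    and form_skew: "T p = Some v \<Longrightarrow> T q = Some w \<Longrightarrow> form p w = cnj (form q v)"
begin

text \<open>The sign \<open>\<sigma>\<close> selects the half-plane that contains the spectrum.\<close>

lemma neutral_on_invariant_subspace:
  assumes W: "csubspace W" and \<sigma>: "\<sigma> = 1 \<or> \<sigma> = - 1"
    and res: "\<And>z. Re (\<sigma> * z) \<le> 0 \<Longrightarrow> z \<in> resolvent_set_on W (T |` W)"
    and bnd: "\<And>z. Re (\<sigma> * z) < 0 \<Longrightarrow> op_bounded_by (op_inv (op_shift (T |` W) z)) M"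
    and dense: "\<And>w. w \<in> W \<Longrightarrow> \<exists>f. (\<forall>n::nat. f n \<in> W) \<and> (\<lambda>n. resolvent (T |` W) 0 (f n)) \<longlonglongrightarrow> w"
    and v: "v \<in> W" and \<mu>: "Re \<mu> = 0"
  obtains p where "T p = Some (v + \<mu> *\<^sub>C p)" "form p v = 0"
proof -
  define S where "S = resolvent (T |` W)"
  note TW = linear_op_restrict[OF T W]
  have \<sigma>2: "\<sigma> * \<sigma> = 1" "cmod \<sigma> = 1"
    using \<sigma> by auto
  have res': "\<sigma> * z \<in> resolvent_set_on W (T |` W)" if "Re z \<le> 0" for z
    using that \<sigma> by (intro res) auto
  have S: "S z u \<in> W" "T (S z u) = Some (u + z *\<^sub>C S z u)"
    if "z \<in> resolvent_set_on W (T |` W)" "u \<in> W" for z u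
    using resolvent_right[OF that] unfolding S_def restrict_map_eq_Some_iff by blast+
  have S_eq: "S z u = p" if "z \<in> resolvent_set_on W (T |` W)" "p \<in> W" "T p = Some (u + z *\<^sub>C p)" for z u p
    unfolding S_def by (rule resolvent_left(2)[OF that(1)]) (simp add: restrict_map_eq_Some_iff that)
  have res0: "0 \<in> resolvent_set_on W (T |` W)"
    by (rule res) simp
  define b where "b = (\<lambda>u. form (S 0 u))"
  have b_shift: "b (u + z *\<^sub>C S z u) w = form (S z u) w" if "z \<in> resolvent_set_on W (T |` W)" "u \<in> W" for u z w
  proof -
    have "S 0 (u + z *\<^sub>C S z u) = S z u"
      by (rule S_eq[OF res0]) (simp_all add: S that)
    then show ?thesis
      by (simp add: b_def)
  qed
  have scale_sigma: "\<sigma> *\<^sub>C \<sigma> *\<^sub>C x = x" for x :: 'v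
    by (simp add: scaleC_scaleC \<sigma>2 scaleC_one)
  have sym: "form (S z u) w = cnj (form (S z w) u)" if z: "z \<in> resolvent_set_on W (T |` W)"
    and "Re z = 0" "u \<in> W" "w \<in> W" for z u w
  proof -
    define p q where "p = S z u" and "q = S z w"
    have pq: "T p = Some (u + z *\<^sub>C p)" "T q = Some (w + z *\<^sub>C q)"
      unfolding p_def q_def by (intro S that)+
    then have dom: "p \<in> dom T" "q \<in> dom T"
      by auto
    have "cnj z = - z"
      using \<open>Re z = 0\<close> by (simp add: complex_eq_iff)
    moreover have "form p w + cnj z * form p q = cnj (form q u + cnj z * form q p)"
      using form_skew[OF pq] dom by (simp add: form_add_right form_scale_right)
    ultimately have "form p w = cnj (form q u)"
      using form_anti[OF dom] by simp
    then show ?thesis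
      by (simp add: p_def q_def)
  qed
  \<comment> \<open>As \<sigma> squares to 1, this is the resolvent of \<sigma> T, whose spectrum
    lies in the right half-plane for either sign.\<close>
  interpret half_plane_resolvent W "\<lambda>z u. \<sigma> *\<^sub>C S (\<sigma> * z) u" M b
  proof
    fix z w u u' v' a
    show "csubspace W"
      by (rule W)
    show "\<sigma> *\<^sub>C S (\<sigma> * z) u \<in> W" if "Re z \<le> 0" "u \<in> W"
      by (intro complex_vec.subspace_scale W S res' that)
    show "\<sigma> *\<^sub>C S (\<sigma> * z) u - \<sigma> *\<^sub>C S (\<sigma> * w) u = (z - w) *\<^sub>C \<sigma> *\<^sub>C S (\<sigma> * z) (\<sigma> *\<^sub>C S (\<sigma> * w) u)"
      if "Re z \<le> 0" "Re w \<le> 0" "u \<in> W"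
    proof -
      have Sw: "S (\<sigma> * w) u \<in> W"
        by (intro S res' that)
      have "\<sigma> *\<^sub>C S (\<sigma> * z) u - \<sigma> *\<^sub>C S (\<sigma> * w) u = \<sigma> *\<^sub>C (\<sigma> * z - \<sigma> * w) *\<^sub>C S (\<sigma> * z) (S (\<sigma> * w) u)"
        unfolding S_def scaleC.diff_right[symmetric]
        by (subst resolvent_identity[OF TW res'[OF that(1)] res'[OF that(2)] that(3) Sw[unfolded S_def]]) simp
      also have "\<dots> = (z - w) *\<^sub>C S (\<sigma> * z) (S (\<sigma> * w) u)"
        by (simp add: scaleC_scaleC right_diff_distrib[symmetric] mult.assoc[symmetric] \<sigma>2)
      also have "S (\<sigma> * z) (S (\<sigma> * w) u) = \<sigma> *\<^sub>C S (\<sigma> * z) (\<sigma> *\<^sub>C S (\<sigma> * w) u)"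
        unfolding S_def resolvent_scaleC[OF TW res'[OF that(1)] Sw[unfolded S_def]] by (rule scale_sigma[symmetric])
      finally show ?thesis .
    qed
    show "\<sigma> *\<^sub>C S (\<sigma> * 0) (u - u') = \<sigma> *\<^sub>C S (\<sigma> * 0) u - \<sigma> *\<^sub>C S (\<sigma> * 0) u'" if "u \<in> W" "u' \<in> W"
      using resolvent_add[OF TW res0 that(1) complex_vec.subspace_neg[OF W that(2)]] resolvent_minus[OF TW res0 that(2)]
      by (simp add: S_def scaleC.diff_right[symmetric])
    show "norm (\<sigma> *\<^sub>C S (\<sigma> * z) u) \<le> M * norm u" if "Re z < 0" "u \<in> W"
      unfolding norm_scaleC \<sigma>2 S_def mult_1
      by (rule resolvent_norm_le) (use that \<sigma> in \<open>auto intro!: res bnd\<close>)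
    show "\<exists>f. (\<forall>n::nat. f n \<in> W) \<and> (\<lambda>n. \<sigma> *\<^sub>C S (\<sigma> * 0) (f n)) \<longlonglongrightarrow> u" if u: "u \<in> W"
    proof -
      obtain f where f: "\<forall>n::nat. f n \<in> W" "(\<lambda>n. S 0 (f n)) \<longlonglongrightarrow> \<sigma> *\<^sub>C u"
        using dense[of "\<sigma> *\<^sub>C u"] complex_vec.subspace_scale[OF W u] unfolding S_def by blast
      from scaleC.tendsto[OF tendsto_const[of \<sigma>] f(2)] have "(\<lambda>n. \<sigma> *\<^sub>C S (\<sigma> * 0) (f n)) \<longlonglongrightarrow> u"
        unfolding scale_sigma by simp
      with f(1) show ?thesis
        by blast
    qed
    have dom0: "S 0 u \<in> dom T" if "u \<in> W" for u
      using S(2)[OF res0 that] by blast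
    show "b (u + u') v' = b u v' + b u' v'" if "u \<in> W" "u' \<in> W"
      using that dom0 resolvent_add[OF TW res0 that] by (simp add: b_def S_def form_add_left)
    show "b (a *\<^sub>C u) v' = a * b u v'" if "u \<in> W"
      using that dom0 resolvent_scaleC[OF TW res0 that] by (simp add: b_def S_def form_scale_left)
    \<comment> \<open>\<open>form_bound\<close> controls only the second argument; the symmetry at 0
      puts \<open>u\<close> there.\<close>
    show "\<exists>C. \<forall>u\<in>W. cmod (b u v') \<le> C * norm u" if v': "v' \<in> W"
    proof -
      obtain C where "\<And>u. cmod (form (S 0 v') u) \<le> C * norm u"
        using form_bound[OF dom0[OF v']] by blast
      moreover have "b u v' = cnj (form (S 0 v') u)" if "u \<in> W" for u
        unfolding b_def by (rule sym[OF res0 _ that v']) simp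
      ultimately show ?thesis
        by (intro exI[of _ C]) simp
    qed
    show "b (u + z *\<^sub>C \<sigma> *\<^sub>C S (\<sigma> * z) u) v' = cnj (b (v' + z *\<^sub>C \<sigma> *\<^sub>C S (\<sigma> * z) v') u)"
      if "Re z = 0" "u \<in> W" "v' \<in> W"
    proof -
      have z: "\<sigma> * z \<in> resolvent_set_on W (T |` W)" "Re (\<sigma> * z) = 0"
        using that \<sigma> by (auto intro!: res')
      have "z *\<^sub>C \<sigma> *\<^sub>C x = (\<sigma> * z) *\<^sub>C x" for x :: 'v
        by (simp add: scaleC_scaleC mult.commute)
      then show ?thesis
        by (simp only: b_shift[OF z(1) that(2)] b_shift[OF z(1) that(3)] sym[OF z that(2,3)])
    qed
  qed
  have \<mu>_res: "\<mu> \<in> resolvent_set_on W (T |` W)"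
    using \<mu> \<sigma> by (intro res) auto
  have "form (S \<mu> v) v = b (v + \<mu> *\<^sub>C S \<mu> v) v"
    by (rule b_shift[OF \<mu>_res v, symmetric])
  also have "\<dots> = 0"
    by (intro form_vanishes v complex_vec.subspace_add complex_vec.subspace_scale W S \<mu>_res)
  finally show ?thesis
    by (rule that[OF S(2)[OF \<mu>_res v]])
qed

lemma neutral_on_spectral_subspace:
  assumes dense: "closure (dom T) = UNIV" and res0: "0 \<in> resolvent_set T"
    and V: "spectral_subspaces T Vp Vm" and v: "v \<in> Vp \<or> v \<in> Vm" and \<mu>: "Re \<mu> = 0"
  obtains p where "T p = Some (v + \<mu> *\<^sub>C p)" "form p v = 0"
proof -
  have closed: "closed Vp" "closed Vm" and sub: "csubspace Vp" "csubspace Vm"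
    and ex1: "\<And>v. \<exists>!w. w \<in> Vp \<times> Vm \<and> v = fst w + snd w"
    and spec: "spectrum_on Vp (T |` Vp) \<subseteq> {z. Re z > 0}" "spectrum_on Vm (T |` Vm) \<subseteq> {z. Re z < 0}"
    using V unfolding spectral_subspaces_def invariant_subspace_def by blast+
  obtain M where M: "\<And>z. Re z < 0 \<Longrightarrow> op_bounded_by (op_inv (op_shift (T |` Vp) z)) M"
    using V unfolding spectral_subspaces_def by blast
  obtain M' where M': "\<And>z. Re z > 0 \<Longrightarrow> op_bounded_by (op_inv (op_shift (T |` Vm) z)) M'"
    using V unfolding spectral_subspaces_def by blast
  have res: "z \<in> resolvent_set_on Vp (T |` Vp)" if "Re z \<le> 0" for z
    using spec(1) that by (auto simp: spectrum_on_def)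
  have res': "z \<in> resolvent_set_on Vm (T |` Vm)" if "Re z \<ge> 0" for z
    using spec(2) that by (auto simp: spectrum_on_def)
  have sum: "\<exists>p\<in>Vp. \<exists>m\<in>Vm. v = p + m" for v
  proof -
    obtain w where "w \<in> Vp \<times> Vm" "v = fst w + snd w"
      using ex1[of v] by (elim ex1E conjE)
    then show ?thesis
      unfolding mem_Times_iff by blast
  qed
  have trivial: "Vp \<inter> Vm = {0}"
  proof -
    have "x = 0" if x: "x \<in> Vp" "x \<in> Vm" for x
    proof -
      have "(x, - x) \<in> Vp \<times> Vm \<and> 0 = fst (x, - x) + snd (x, - x)"
        using x complex_vec.subspace_neg[OF sub(2)] by simp
      moreover have "(0, 0) \<in> Vp \<times> Vm \<and> 0 = fst (0, 0) + snd (0, 0 :: 'v)"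
        using sub complex_vec.subspace_0 by auto
      ultimately have "(x, - x) = (0, 0)"
        using ex1[of 0] by blast
      then show ?thesis
        by simp
    qed
    then show ?thesis
      using sub complex_vec.subspace_0 by blast
  qed
  \<comment> \<open>For \<open>d n\<close> in the domain tending to \<open>w\<close>, the two
    components of its image have preimages under the restrictions of \<open>T\<close>. Invertibility
    of \<open>T\<close> makes \<open>d n\<close> the sum of these preimages, and the bounded
    projection makes the preimage in \<open>P\<close> tend to \<open>w\<close>.\<close>
  have approx: "\<exists>f. (\<forall>n::nat. f n \<in> P) \<and> (\<lambda>n. resolvent (T |` P) 0 (f n)) \<longlonglongrightarrow> w"
    if w: "w \<in> P" and cl: "closed P" "closed N" and sb: "csubspace P" "csubspace N"
      and sum: "\<And>v. \<exists>p\<in>P. \<exists>m\<in>N. v = p + m" and tr: "P \<inter> N = {0}"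
      and r0: "0 \<in> resolvent_set_on P (T |` P)" "0 \<in> resolvent_set_on N (T |` N)" for P N w
  proof -
    obtain c where c: "\<And>p m. p \<in> P \<Longrightarrow> m \<in> N \<Longrightarrow> norm p \<le> c * norm (p + m)"
      using complementary_subspaces_bound[OF cl(1) sb(1) cl(2) sb(2) sum tr] by blast
    obtain d where d: "\<And>n::nat. d n \<in> dom T" "d \<longlonglongrightarrow> w"
      using closure_approx[OF dense] by blast
    have "\<exists>p m. p \<in> P \<and> m \<in> N \<and> T (d n) = Some (p + m)" for n
      using d(1)[of n] sum by (metis domD)
    then obtain p m where pm: "\<And>n. p n \<in> P" "\<And>n. m n \<in> N" "\<And>n. T (d n) = Some (p n + m n)"
      by metis
    have le: "norm (resolvent (T |` P) 0 (p n) - w) \<le> c * norm (d n - w)" for n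
    proof -
      define x y where "x = resolvent (T |` P) 0 (p n)" and "y = resolvent (T |` N) 0 (m n)"
      have x: "x \<in> P" "T x = Some (p n)"
        using resolvent_right[OF r0(1) pm(1)[of n]] by (simp_all add: x_def restrict_map_eq_Some_iff)
      have y: "y \<in> N" "T y = Some (m n)"
        using resolvent_right[OF r0(2) pm(2)[of n]] by (simp_all add: y_def restrict_map_eq_Some_iff)
      have "d n = resolvent T 0 (p n + m n)"
        using resolvent_left(2)[OF res0, of "d n" "p n + m n"] pm(3)[of n] by simp
      also have "\<dots> = x + y"
        using resolvent_left(2)[OF res0, of "x + y" "p n + m n"] linear_op_add[OF T x(2) y(2)] by simp
      finally have dw: "(x - w) + y = d n - w"
        by simp
      from c[OF complex_vec.subspace_diff[OF sb(1) x(1) w] y(1)] show ?thesis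
        unfolding x_def[symmetric] dw .
    qed
    have lim: "(\<lambda>n. c * norm (d n - w)) \<longlonglongrightarrow> 0"
      by (intro tendsto_mult_right_zero tendsto_norm_zero LIM_zero d)
    have "(\<lambda>n. resolvent (T |` P) 0 (p n) - w) \<longlonglongrightarrow> 0"
      by (rule Lim_null_comparison[OF always_eventually[OF allI[OF le]] lim])
    then have "(\<lambda>n. resolvent (T |` P) 0 (p n)) \<longlonglongrightarrow> w"
      by (rule LIM_zero_cancel)
    with pm(1) show ?thesis
      by blast
  qed
  have sum': "\<exists>m\<in>Vm. \<exists>p\<in>Vp. v = m + p" for v
    using sum[of v] by (metis add.commute)
  have trivial': "Vm \<inter> Vp = {0}"
    using trivial by blast
  from v show ?thesis
  proof
    assume v: "v \<in> Vp"
    show ?thesis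
    proof (rule neutral_on_invariant_subspace[OF sub(1), of 1 M v \<mu>])
      show "\<exists>f. (\<forall>n::nat. f n \<in> Vp) \<and> (\<lambda>n. resolvent (T |` Vp) 0 (f n)) \<longlonglongrightarrow> w" if "w \<in> Vp" for w
        by (rule approx[OF that closed sub sum trivial res res']) simp_all
    qed (use res M v \<mu> that in auto)
  next
    assume v: "v \<in> Vm"
    show ?thesis
    proof (rule neutral_on_invariant_subspace[OF sub(2), of "- 1" M' v \<mu>])
      show "\<exists>f. (\<forall>n::nat. f n \<in> Vm) \<and> (\<lambda>n. resolvent (T |` Vm) 0 (f n)) \<longlonglongrightarrow> w" if "w \<in> Vm" for w
        by (rule approx[OF that closed(2,1) sub(2,1) sum' trivial' res' res]) simp_all
    qed (use res' M' v \<mu> that in auto)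
  qed
qed

end

section \<open>The Hamiltonian\<close>

text \<open>The second component lives in the scale of \<open>Lam_star A\<close>, which is
  \<open>Lam (adj A)\<close>, so it is an instance of \<open>neg_scale\<close> for
  \<open>adj A\<close>.\<close>

locale hamiltonian_setting = closed_dense_pair A for A :: "'h::complex_hilbert \<rightharpoonup> 'h" +
  fixes r s :: real and jr :: "'h \<Rightarrow> 'hr::complex_hilbert" and js :: "'h \<Rightarrow> 'hs::complex_hilbert"
    and B :: "'u::complex_hilbert \<Rightarrow> 'hr" and C :: "'h \<rightharpoonup> 'y::complex_hilbert"
    and Jr :: "'hr \<Rightarrow> 'h" and Js :: "'hs \<Rightarrow> 'h"
  assumes rs: "0 \<le> r" "0 \<le> s" "r + s \<le> 1"
    and scale_r: "neg_scale A r jr Jr" and scale_s: "neg_scale (adj A) s js Js"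
    and B: "bounded_clinear B" and C: "bounded_on_scale (op_powr (Lam_star A) s) C"
begin

sublocale R: neg_scale A r jr Jr
  by (rule scale_r)

sublocale S: neg_scale "adj A" s js Js
  by (rule scale_s)

abbreviation F :: "real \<Rightarrow> 'h \<Rightarrow> 'h"
  where "F \<equiv> lam_F A"

abbreviation Fs :: "real \<Rightarrow> 'h \<Rightarrow> 'h"
  where "Fs \<equiv> lam_F (adj A)"

abbreviation AsQ :: "'h \<Rightarrow> 'h"
  where "AsQ \<equiv> S.AQ"

text \<open>The surplus of smoothness: a component x = \<open>Fs (1 - r) z\<close> of the domain is
  \<open>Fs s (Fs eps z)\<close>, so \<open>C\<close> applies to it and it pairs with the completion
  of exponent -s; likewise for the other component with \<open>B_adj\<close>.\<close>

definition eps :: real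
  where "eps = 1 - r - s"

lemma eps: "0 \<le> eps" "0 \<le> 1 - r" "0 \<le> 1 - s"
  using rs by (simp_all add: eps_def)

lemma F_split: "F (1 - s) u = F r (F eps u)"
  using lam_F_add[OF rs(1) eps(1), of u] by (simp add: eps_def)

lemma Fs_split: "Fs (1 - r) z = Fs s (Fs eps z)"
  using star.lam_F_add[OF rs(2) eps(1), of z] by (simp add: eps_def algebra_simps)

lemma A_adj_ext_eq: "A_adj_ext A s js = A_ext (adj A) s js"
  by (simp add: A_adj_ext_def A_ext_def S.Lam_star_eq adj_adj)

lemma A_adj_ext_eq_Some_iff:
  "A_adj_ext A s js y = Some w \<longleftrightarrow> (\<exists>u. y = F (1 - s) u \<and> Js w = AsQ u)"
  using S.A_ext_eq_Some_iff[of y w] by (simp add: A_adj_ext_eq adj_adj)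

text \<open>The adjoint of \<open>Jr\<close> after \<open>B\<close>, between \<open>H\<close> and
  the input space; \<open>bounded_adjoint\<close> gives only existence, hence the choice.\<close>

definition Bs :: "'h \<Rightarrow> 'u"
  where "Bs = (SOME g. \<forall>k p. cinner (Jr (B k)) p = cinner k (g p))"

lemma Bs: "cinner (Jr (B k)) p = cinner k (Bs p)"
proof -
  obtain M where M: "clinear B" "\<And>x. norm (B x) \<le> M * norm x"
    using B by (auto simp: bounded_clinear_def)
  have "bounded_clinear (\<lambda>k. Jr (B k))"
    by (rule bounded_clinearI[where M = M])
      (auto intro!: clinearI M
        simp: R.norm_J clinear_add[OF M(1)] clinear_scaleC[OF M(1)] clinear_add[OF R.clinear_J] clinear_scaleC[OF R.clinear_J])
  then obtain g where "\<And>k p. cinner (Jr (B k)) p = cinner k (g p)"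
    by (rule bounded_adjoint) (rule that, simp)
  then have "\<exists>g. \<forall>k p. cinner (Jr (B k)) p = cinner k (g p)"
    by blast
  from someI_ex[OF this] show ?thesis
    unfolding Bs_def by blast
qed

lemmas clinear_Bs = clinear_adjoint[OF Bs]

lemma Bs_flip: "cinner p (Jr (B k)) = cinner (Bs p) k"
  by (rule cinner_flip[OF Bs])

lemma B_adj_eq: "B_adj A r jr B (F r p) = Some (Bs p)"
proof -
  have "(THE v. \<forall>u. pairing jr (F r p) (B u) = cinner v u) = Bs p"
  proof (rule the_equality)
    show "\<forall>u. pairing jr (F r p) (B u) = cinner (Bs p) u"
      by (simp add: R.pairing_lam_F Bs_flip)
    fix v assume "\<forall>u. pairing jr (F r p) (B u) = cinner v u"
    then have "cinner v u = cinner (Bs p) u" for u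
      by (simp add: R.pairing_lam_F Bs_flip)
    then show "v = Bs p"
      by (rule cinner_ext[OF cinner_flip])
  qed
  moreover have "F r p \<in> dom (op_powr (Lam A) r)"
    by (simp add: dom_op_powr_Lam[OF rs(1)])
  ultimately show ?thesis
    by (simp add: B_adj_def)
qed

definition Cq :: "'h \<Rightarrow> 'y"
  where "Cq q = the (C (Fs s q))"

lemma dom_C: "dom C = range (Fs s)"
  using C by (simp add: bounded_on_scale_def Lam_star_eq star.dom_op_powr_Lam[OF rs(2)])

lemma C_Fs: "C (Fs s q) = Some (Cq q)"
proof -
  have "Fs s q \<in> dom C"
    by (simp add: dom_C)
  then show ?thesis
    by (auto simp: Cq_def)
qed

lemma bounded_clinear_Cq: "bounded_clinear Cq"
proof -
  have lin: "linear_op C"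
    using C by (simp add: bounded_on_scale_def)
  obtain M where M: "\<And>x. x \<in> dom C \<Longrightarrow> norm (the (C x)) \<le> M * norm (the (op_powr (Lam_star A) s x))"
    using C by (auto simp: bounded_on_scale_def)
  note cl = star.clinear_lam_F[OF rs(2)]
  show ?thesis
  proof (rule bounded_clinearI[where M = M])
    show "clinear Cq"
    proof (rule clinearI)
      fix x y a
      show "Cq (x + y) = Cq x + Cq y"
        using linear_op_add[OF lin C_Fs[of x] C_Fs[of y]] C_Fs[of "x + y"] by (simp add: clinear_add[OF cl])
      show "Cq (a *\<^sub>C x) = a *\<^sub>C Cq x"
        using linear_op_scaleC[OF lin C_Fs[of x], of a] C_Fs[of "a *\<^sub>C x"] by (simp add: clinear_scaleC[OF cl])
    qed
    fix q
    have "op_powr (Lam_star A) s (Fs s q) = Some q"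
      by (simp add: Lam_star_eq star.op_powr_Lam_eq_Some_iff[OF rs(2)])
    then show "norm (Cq q) \<le> M * norm q"
      using M[of "Fs s q"] by (simp add: dom_C Cq_def)
  qed
qed

lemma clinear_Cq: "clinear Cq"
  using bounded_clinear_Cq by (simp add: bounded_clinear_def)

lemma C_adj: "cinner (Cq q) y = cinner q (Js (C_adj js C y))"
proof -
  obtain g where g: "\<And>x y. cinner (Cq x) y = cinner x (g y)"
    using bounded_clinear_Cq by (rule bounded_adjoint) (rule that, simp)
  obtain w where w: "Js w = g y"
    by (rule S.J_obtain)
  have pairing: "pairing js (Fs s q) v = cinner q (Js v)" for q v
    by (rule S.pairing_lam_F)
  have "C_adj js C y = w"
    unfolding C_adj_def
  proof (rule the_equality)
    show "\<forall>x\<in>dom C. cinner (the (C x)) y = pairing js x w"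
      by (auto simp: dom_C C_Fs pairing w g)
    fix v assume "\<forall>x\<in>dom C. cinner (the (C x)) y = pairing js x v"
    then have "cinner q (g y) = cinner q (Js v)" for q
      by (simp add: dom_C C_Fs pairing g[symmetric])
    then have "g y = Js v"
      by (rule cinner_ext)
    then have "Js v = Js w"
      by (simp add: w)
    then show "v = w"
      by (simp add: S.J_eq_iff)
  qed
  then show ?thesis
    by (simp add: g w)
qed

text \<open>\<open>\<beta>\<close> and \<open>\<gamma>\<close> are the off-diagonal entries B B' and
  C' C of the Hamiltonian as operators on \<open>H\<close>, with arguments in the coordinates of
  \<open>emb\<close> and values after \<open>Jr\<close> and \<open>Js\<close>.\<close>

definition \<beta> :: "'h \<Rightarrow> 'h"
  where "\<beta> u = Jr (B (Bs (F eps u)))"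

definition \<gamma> :: "'h \<Rightarrow> 'h"
  where "\<gamma> z = Js (C_adj js C (Cq (Fs eps z)))"

lemma clinear_F_eps: "clinear (F eps)" "clinear (Fs eps)"
  by (intro clinear_lam_F star.clinear_lam_F eps)+

lemma clinear_comp: "clinear f \<Longrightarrow> clinear g \<Longrightarrow> clinear (\<lambda>x. f (g x))"
  by (rule clinearI) (simp_all add: clinear_add clinear_scaleC)

lemma clinear_B: "clinear B"
  using B by (simp add: bounded_clinear_def)

lemma clinear_\<beta>: "clinear \<beta>"
  unfolding \<beta>_def[abs_def]
  by (rule clinear_comp[OF R.clinear_J clinear_comp[OF clinear_B clinear_comp[OF clinear_Bs clinear_F_eps(1)]]])

lemma clinear_\<gamma>: "clinear \<gamma>"
  unfolding \<gamma>_def[abs_def]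
  by (rule clinear_comp[OF clinear_adjoint[OF C_adj] clinear_comp[OF clinear_Cq clinear_F_eps(2)]])

lemma cinner_\<beta>: "cinner (F eps u) (\<beta> u') = cinner (Bs (F eps u)) (Bs (F eps u'))"
  by (simp add: \<beta>_def Bs_flip)

lemma cinner_\<gamma>: "cinner (Fs eps z) (\<gamma> z') = cinner (Cq (Fs eps z)) (Cq (Fs eps z'))"
  by (simp add: \<gamma>_def C_adj[symmetric])

text \<open>For x = \<open>Fs (1 - r) z\<close> and y = \<open>F (1 - s) u\<close> this is the
  duality (y|A x) = (A' y|x) of the extended operators.\<close>

lemma cinner_AQ: "cinner (F eps u) (AQ z) = cnj (cinner (Fs eps z) (AsQ u))"
proof -
  have "cinner (F eps u) (AQ z) = cinner u (AQ (Fs eps z))"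
    by (simp add: lam_F_selfadjoint eps lam_F_AQ)
  also have "\<dots> = cnj (cinner (AQ (Fs eps z)) u)"
    by (rule cinner_commute)
  also have "cinner (AQ (Fs eps z)) u = cinner (Fs eps z) (AsQ u)"
    by (rule AQ_adjoint)
  finally show ?thesis .
qed

text \<open>Coordinates in \<open>H\<close> times \<open>H\<close> for the domain of the
  Hamiltonian, in which its entries become everywhere defined operators on \<open>H\<close>.\<close>

definition emb :: "'h \<Rightarrow> 'h \<Rightarrow> 'hr \<times> 'hs"
  where "emb z u = (jr (Fs (1 - r) z), js (F (1 - s) u))"

abbreviation T :: "'hr \<times> 'hs \<rightharpoonup> 'hr \<times> 'hs"
  where "T \<equiv> hamiltonian A r s jr js B C"

lemma emb_add: "emb z u + emb z' u' = emb (z + z') (u + u')"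
  using eps by (simp add: emb_def clinear_add[OF R.clinear_j] clinear_add[OF S.clinear_j] clinear_add[OF clinear_lam_F]
      clinear_add[OF star.clinear_lam_F])

lemma emb_scaleC: "a *\<^sub>C emb z u = emb (a *\<^sub>C z) (a *\<^sub>C u)"
  using eps by (simp add: emb_def scaleC_prod_def clinear_scaleC[OF R.clinear_j] clinear_scaleC[OF S.clinear_j]
      clinear_scaleC[OF clinear_lam_F] clinear_scaleC[OF star.clinear_lam_F])

lemma inv_jr: "inv jr (jr x) = x" and inv_js: "inv js (js y) = y"
  by (rule inv_f_f, rule R.inj_j S.inj_j)+

lemma hamiltonian_emb:
  "T (emb z u) = Some w \<longleftrightarrow> Jr (fst w) = AQ z - \<beta> u \<and> Js (snd w) = - \<gamma> z - AsQ u"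
proof -
  define x y where "x = Fs (1 - r) z" and "y = F (1 - s) u"
  obtain a where a: "Jr a = AQ z"
    by (rule R.J_obtain)
  obtain d where d: "Js d = AsQ u"
    by (rule S.J_obtain)
  have "A_ext A r jr x = Some a"
    using a by (auto simp: R.A_ext_eq_Some_iff x_def)
  moreover have "A_adj_ext A s js y = Some d"
    using d by (auto simp: A_adj_ext_eq_Some_iff y_def)
  moreover have "B_adj A r jr B y = Some (Bs (F eps u))"
    by (simp add: y_def F_split B_adj_eq)
  moreover have "C x = Some (Cq (Fs eps z))"
    by (simp add: x_def Fs_split C_Fs)
  moreover have "dom (op_powr (Lam A) (1 - s)) = range (F (1 - s))"
    by (rule dom_op_powr_Lam[OF eps(3)])
  ultimately have T: "T (emb z u) = Some (a - B (Bs (F eps u)), - C_adj js C (Cq (Fs eps z)) - d)"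
    unfolding hamiltonian_def emb_def x_def[symmetric] y_def[symmetric]
    by (simp add: inv_jr inv_js R.dom_scale_norm Let_def) (simp add: x_def y_def)
  have "Jr (a - B (Bs (F eps u))) = AQ z - \<beta> u"
    by (simp add: clinear_diff[OF R.clinear_J] a \<beta>_def)
  moreover have "Js (- C_adj js C (Cq (Fs eps z)) - d) = - \<gamma> z - AsQ u"
    by (simp add: clinear_diff[OF S.clinear_J] clinear_minus[OF S.clinear_J] d \<gamma>_def)
  ultimately show ?thesis
    unfolding T by (cases w) (metis R.J_eq_iff S.J_eq_iff fst_conv option.inject prod.inject snd_conv)
qed

lemma dom_hamiltonian: "dom T = {emb z u | z u. True}"
proof -
  have "v \<in> dom T \<longleftrightarrow> fst v \<in> jr ` range (Fs (1 - r)) \<and> snd v \<in> js ` range (F (1 - s))" for v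
    by (simp add: hamiltonian_def domIff R.dom_scale_norm dom_op_powr_Lam[OF eps(3)] Let_def)
  then have "dom T = (jr ` range (Fs (1 - r))) \<times> (js ` range (F (1 - s)))"
    unfolding set_eq_iff mem_Times_iff by blast
  also have "\<dots> = {emb z u | z u. True}"
    unfolding emb_def by auto
  finally show ?thesis .
qed

lemma dom_hamiltonian_cases:
  assumes "v \<in> dom T"
  obtains z u where "v = emb z u"
  using assms unfolding dom_hamiltonian by blast

lemma dense_dom_hamiltonian: "closure (dom T) = UNIV"
proof -
  have "dom T = (jr ` range (Fs (1 - r))) \<times> (js ` range (F (1 - s)))"
    unfolding dom_hamiltonian emb_def by auto
  then show ?thesis
    using R.dense_image_j S.dense_image_j by (simp add: closure_Times adj_adj)
qed

lemma linear_op_hamiltonian: "linear_op T"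
proof (rule linear_opI)
  note cl = clinear_AQ S.clinear_AQ clinear_\<beta> clinear_\<gamma> R.clinear_J S.clinear_J
  have "emb 0 0 = 0"
    using emb_scaleC[of 0 0 0] by simp
  moreover have "T (emb 0 0) = Some 0"
    unfolding hamiltonian_emb by (simp add: cl[THEN clinear_zero])
  ultimately show "T 0 = Some 0"
    by simp
  fix v v' w w' a
  assume v: "T v = Some w"
  then obtain z u where zu: "v = emb z u"
    using dom_hamiltonian_cases by blast
  have w: "Jr (fst w) = AQ z - \<beta> u" "Js (snd w) = - \<gamma> z - AsQ u"
    using v unfolding zu hamiltonian_emb by auto
  show "T (a *\<^sub>C v) = Some (a *\<^sub>C w)"
    unfolding zu emb_scaleC hamiltonian_emb
    by (simp add: scaleC_prod_def cl[THEN clinear_scaleC] w scaleC.diff_right scaleC.minus_right)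
  assume v': "T v' = Some w'"
  then obtain z' u' where zu': "v' = emb z' u'"
    using dom_hamiltonian_cases by blast
  have w': "Jr (fst w') = AQ z' - \<beta> u'" "Js (snd w') = - \<gamma> z' - AsQ u'"
    using v' unfolding zu' hamiltonian_emb by auto
  show "T (v + v') = Some (w + w')"
    unfolding zu zu' emb_add hamiltonian_emb
    by (simp add: cl[THEN clinear_add] w w' algebra_simps)
qed

text \<open>The extension of \<open>(x|y') - (y|x')\<close> to \<open>x, y\<close> in the domain of the Hamiltonian and \<open>x', y'\<close> in the
  completions.\<close>

definition form :: "'hr \<times> 'hs \<Rightarrow> 'hr \<times> 'hs \<Rightarrow> complex"
  where "form v w = pairing js (inv jr (fst v)) (snd w) - pairing jr (inv js (snd v)) (fst w)"

lemma form_emb: "form (emb z u) w = cinner (Fs eps z) (Js (snd w)) - cinner (F eps u) (Jr (fst w))"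
  by (simp add: form_def emb_def inv_jr inv_js F_split Fs_split R.pairing_lam_F S.pairing_lam_F)

lemma Jr_emb: "Jr (fst (emb z u)) = F r (Fs (1 - r) z)"
  and Js_emb: "Js (snd (emb z u)) = Fs s (F (1 - s) u)"
  by (simp_all add: emb_def R.J_j S.J_j)

lemma cinner_Fs_Js_emb: "cinner (Fs eps z) (Fs s (F (1 - s) u)) = cinner (Fs (1 - r) z) (F (1 - s) u)"
  by (simp add: Fs_split star.lam_F_selfadjoint[OF rs(2)])

lemma cinner_F_Jr_emb: "cinner (F eps u) (F r (Fs (1 - r) z)) = cinner (F (1 - s) u) (Fs (1 - r) z)"
  by (simp add: F_split lam_F_selfadjoint[OF rs(1)])

lemma skew_form: "skew_form T form"
proof
  show "linear_op T"
    by (rule linear_op_hamiltonian)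
  fix p q v w a
  show "form (p + q) v = form p v + form q v" if "p \<in> dom T" "q \<in> dom T"
    using that by (elim dom_hamiltonian_cases)
      (simp add: emb_add form_emb clinear_F_eps[THEN clinear_add] cinner_add_left)
  show "form (a *\<^sub>C p) v = a * form p v" if "p \<in> dom T"
    using that by (elim dom_hamiltonian_cases)
      (simp add: emb_scaleC form_emb clinear_F_eps[THEN clinear_scaleC] cinner_scaleC_left right_diff_distrib)
  show "form p (v + w) = form p v + form p w" if "p \<in> dom T"
    using that by (elim dom_hamiltonian_cases)
      (simp add: form_emb clinear_add[OF R.clinear_J] clinear_add[OF S.clinear_J] cinner_add_right)
  show "form p (a *\<^sub>C v) = cnj a * form p v" if "p \<in> dom T"
    using that by (elim dom_hamiltonian_cases)
      (simp add: form_emb scaleC_prod_def clinear_scaleC[OF R.clinear_J] clinear_scaleC[OF S.clinear_J]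
        cinner_scaleC_right right_diff_distrib)
  show "\<exists>C. \<forall>v. cmod (form p v) \<le> C * norm v" if dom: "p \<in> dom T"
  proof -
    obtain z u where p: "p = emb z u"
      using dom by (rule dom_hamiltonian_cases)
    have "cmod (form p v) \<le> (norm (Fs eps z) + norm (F eps u)) * norm v" for v
    proof -
      have "cmod (form p v) \<le> norm (Fs eps z) * norm (snd v) + norm (F eps u) * norm (fst v)"
        unfolding p form_emb
        using norm_cinner_le[of "Fs eps z" "Js (snd v)"] norm_cinner_le[of "F eps u" "Jr (fst v)"]
        by (intro order_trans[OF norm_triangle_ineq4] add_mono) (simp_all add: R.norm_J S.norm_J)
      also have "\<dots> \<le> norm (Fs eps z) * norm v + norm (F eps u) * norm v"
        using norm_fst_le[of "fst v" "snd v"] norm_snd_le[of "snd v" "fst v"]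
        by (intro add_mono mult_left_mono) simp_all
      finally show ?thesis
        by (simp add: algebra_simps)
    qed
    then show ?thesis
      by blast
  qed
  show "form p q = - cnj (form q p)" if "p \<in> dom T" "q \<in> dom T"
  proof -
    obtain z u where p: "p = emb z u"
      using \<open>p \<in> dom T\<close> by (rule dom_hamiltonian_cases)
    obtain z' u' where q: "q = emb z' u'"
      using \<open>q \<in> dom T\<close> by (rule dom_hamiltonian_cases)
    show ?thesis
      unfolding p q form_emb Jr_emb Js_emb cinner_Fs_Js_emb cinner_F_Jr_emb
      by (simp add: cinner_commute[symmetric])
  qed
  show "form p w = cnj (form q v)" if pq: "T p = Some v" "T q = Some w"
  proof -
    obtain z u where p: "p = emb z u"
      using pq(1) dom_hamiltonian_cases by blast
    obtain z' u' where q: "q = emb z' u'"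
      using pq(2) dom_hamiltonian_cases by blast
    have v: "Jr (fst v) = AQ z - \<beta> u" "Js (snd v) = - \<gamma> z - AsQ u"
      and w: "Jr (fst w) = AQ z' - \<beta> u'" "Js (snd w) = - \<gamma> z' - AsQ u'"
      using pq unfolding p q hamiltonian_emb by auto
    show ?thesis
      unfolding p q form_emb v w
      by (simp add: cinner.diff_right cinner.minus_right cinner_\<beta> cinner_\<gamma> cinner_AQ cinner_commute[symmetric])
  qed
qed

text \<open>The form \<open>(x|y') + (y|x')\<close> makes the Hamiltonian dissipative with defect
  \<open>\<parallel>B\<^sup>* y\<parallel>\<^sup>2 + \<parallel>C x\<parallel>\<^sup>2\<close>. If one component of \<open>v\<close> vanishes, the two forms agree on it up to sign.\<close>

lemma observations_vanish:
  assumes T: "T (emb z u) = Some (v + \<mu> *\<^sub>C emb z u)" and \<mu>: "Re \<mu> = 0"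
    and neutral: "form (emb z u) v = 0" and comp: "fst v = 0 \<or> snd v = 0"
  shows "Bs (F eps u) = 0" and "Cq (Fs eps z) = 0"
proof -
  define x y where "x = Fs (1 - r) z" and "y = F (1 - s) u"
  have comps: "Jr (fst v) + \<mu> *\<^sub>C F r x = AQ z - \<beta> u" "Js (snd v) + \<mu> *\<^sub>C Fs s y = - \<gamma> z - AsQ u"
    using T unfolding hamiltonian_emb
    by (simp_all add: scaleC_prod_def clinear_add[OF R.clinear_J] clinear_scaleC[OF R.clinear_J]
        clinear_add[OF S.clinear_J] clinear_scaleC[OF S.clinear_J] Jr_emb Js_emb x_def y_def)
  \<comment> \<open>A vanishing component kills one of the two terms of the form, and neutrality
    then kills the other.\<close>
  have zero: "cinner (F eps u) (Jr (fst v)) = 0" "cinner (Fs eps z) (Js (snd v)) = 0"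
    using comp neutral
    by (auto simp: form_emb clinear_zero[OF R.clinear_J] clinear_zero[OF S.clinear_J] cinner.zero_right)
  have 1: "cnj \<mu> * cinner y x = cinner (F eps u) (AQ z) - complex_of_real ((norm (Bs (F eps u)))\<^sup>2)"
    using arg_cong[OF comps(1), of "cinner (F eps u)"] zero(1) cinner_F_Jr_emb[of u z]
    by (simp add: cinner.add_right cinner.diff_right cinner_scaleC_right cinner_\<beta> cinner_self x_def y_def)
  have 2: "cnj \<mu> * cinner x y = - complex_of_real ((norm (Cq (Fs eps z)))\<^sup>2) - cinner (Fs eps z) (AsQ u)"
    using arg_cong[OF comps(2), of "cinner (Fs eps z)"] zero(2) cinner_Fs_Js_emb[of z u]
    by (simp add: cinner.add_right cinner.diff_right cinner.minus_right cinner_scaleC_right cinner_\<gamma> cinner_self x_def y_def)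
  \<comment> \<open>For imaginary \<mu> the shifts cancel in the sum of the real parts of both rows,
    and so do the terms with \<open>AQ\<close> and \<open>AsQ\<close>; only the two squared norms
    remain.\<close>
  have "Re (cnj \<mu> * cinner y x) + Re (cnj \<mu> * cinner x y) = 0"
  proof -
    have "cinner y x = cnj (cinner x y)"
      by (rule cinner_commute)
    then show ?thesis
      using \<mu> by simp
  qed
  moreover have "Re (cinner (F eps u) (AQ z)) = Re (cinner (Fs eps z) (AsQ u))"
    by (simp add: cinner_AQ)
  ultimately have "(norm (Bs (F eps u)))\<^sup>2 + (norm (Cq (Fs eps z)))\<^sup>2 = 0"
    unfolding 1 2 minus_complex.sel uminus_complex.sel Re_complex_of_real by linarith
  then show "Bs (F eps u) = 0" "Cq (Fs eps z) = 0"
    by (simp_all add: add_nonneg_eq_0_iff)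
qed

lemma B_kernel_memI:
  assumes "\<And>\<mu>. Re \<mu> = 0 \<Longrightarrow> \<exists>p. T p = Some ((0, g) + \<mu> *\<^sub>C p) \<and> form p (0, g) = 0"
  shows "g \<in> B_kernel A r s jr js B"
  unfolding B_kernel_def
proof
  fix \<mu> assume \<mu>: "\<mu> \<in> {z. Re z = 0} \<inter> resolvent_set (adj A)"
  \<comment> \<open>The lower right entry of the Hamiltonian is minus the adjoint of
    \<open>A\<close>, so its resolvent at -\<mu> corresponds to the resolvent of the adjoint at
    \<mu>, and the preimage of \<open>g\<close> is \<open>- y\<close>.\<close>
  then have "Re (- \<mu>) = 0"
    by simp
  then obtain p where p: "T p = Some ((0, g) + (- \<mu>) *\<^sub>C p)" "form p (0, g) = 0"
    using assms by blast
  then obtain z u where zu: "p = emb z u"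
    using dom_hamiltonian_cases by blast
  define y where "y = F (1 - s) u"
  have zero: "Bs (F eps u) = 0" "Cq (Fs eps z) = 0"
    using observations_vanish[of z u "(0, g)" "- \<mu>"] p \<open>Re (- \<mu>) = 0\<close> unfolding zu by auto
  have "Js (g - \<mu> *\<^sub>C js y) = - \<gamma> z - AsQ u"
    using p(1) unfolding zu hamiltonian_emb by (simp add: scaleC_prod_def emb_def y_def)
  also have "\<gamma> z = 0"
    using cinner_self_eq_0[of "\<gamma> z"] C_adj[of "\<gamma> z" 0]
    by (simp add: \<gamma>_def zero cinner.zero_right cinner_eq_0_commute)
  finally have "Js (g + \<mu> *\<^sub>C js (- y)) = AsQ (- u)"
    by (simp add: clinear_minus[OF S.clinear_j] clinear_minus[OF S.clinear_AQ] scaleC.minus_right)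
  moreover have y: "- y = F (1 - s) (- u)"
    by (simp add: y_def clinear_minus[OF clinear_lam_F[OF eps(3)]])
  ultimately have "A_ext (adj A) s js (- y) = Some (g + \<mu> *\<^sub>C js (- y))"
    unfolding A_adj_ext_eq[symmetric] A_adj_ext_eq_Some_iff by blast
  then have "op_inv (emb_shift js (A_adj_ext A s js) \<mu>) g = Some (- y)"
    unfolding A_adj_ext_eq using \<mu> by (intro S.op_inv_shift_A_ext) auto
  moreover have "B_adj A r jr B (- y) = Some 0"
    unfolding y F_split B_adj_eq
    by (simp add: clinear_minus[OF clinear_F_eps(1)] clinear_minus[OF clinear_Bs] zero)
  ultimately show "g \<in> op_ker (B_adj A r jr B \<circ>\<^sub>m op_inv (emb_shift js (A_adj_ext A s js) \<mu>))"
    by (simp add: op_ker_def)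
qed

lemma C_kernel_memI:
  assumes "\<And>\<mu>. Re \<mu> = 0 \<Longrightarrow> \<exists>p. T p = Some ((f, 0) + \<mu> *\<^sub>C p) \<and> form p (f, 0) = 0"
  shows "f \<in> C_kernel A r jr C"
  unfolding C_kernel_def
proof
  fix \<mu> assume \<mu>: "\<mu> \<in> {z. Re z = 0} \<inter> resolvent_set A"
  then obtain p where p: "T p = Some ((f, 0) + \<mu> *\<^sub>C p)" "form p (f, 0) = 0"
    using assms by blast
  then obtain z u where zu: "p = emb z u"
    using dom_hamiltonian_cases by blast
  define x where "x = Fs (1 - r) z"
  have zero: "Bs (F eps u) = 0" "Cq (Fs eps z) = 0"
    using observations_vanish[of z u "(f, 0)" \<mu>] p \<mu> unfolding zu by auto
  have "Jr (f + \<mu> *\<^sub>C jr x) = AQ z - \<beta> u"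
    using p(1) unfolding zu hamiltonian_emb by (simp add: scaleC_prod_def emb_def x_def)
  also have "\<beta> u = 0"
    by (simp add: \<beta>_def zero clinear_zero[OF clinear_B] clinear_zero[OF R.clinear_J])
  finally have "A_ext A r jr x = Some (f + \<mu> *\<^sub>C jr x)"
    unfolding R.A_ext_eq_Some_iff x_def by auto
  then have "op_inv (emb_shift jr (A_ext A r jr) \<mu>) f = Some x"
    using \<mu> by (intro R.op_inv_shift_A_ext) auto
  moreover have "C x = Some 0"
    by (simp add: x_def Fs_split C_Fs zero)
  ultimately show "f \<in> op_ker (C \<circ>\<^sub>m op_inv (emb_shift jr (A_ext A r jr) \<mu>))"
    by (simp add: op_ker_def)
qed

end

section \<open>Graph subspaces\<close>

lemma mem_graph_I_op_iff: "(x, y) \<in> graph_I_op X \<longleftrightarrow> X x = Some y"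
  by (auto simp: graph_I_op_def)

lemma mem_graph_op_I_iff: "(x, y) \<in> graph_op_I Y \<longleftrightarrow> Y y = Some x"
  by (auto simp: graph_op_I_def)

lemma graph_I_op_exists:
  fixes V :: "('a::complex_banach \<times> 'b::complex_banach) set"
  assumes "closed V" and V: "csubspace V" and trivial: "\<And>g. (0, g) \<in> V \<Longrightarrow> g = 0"
  shows "\<exists>X. closed_op X \<and> V = graph_I_op X"
proof -
  define X where "X x = (if \<exists>y. (x, y) \<in> V then Some (THE y. (x, y) \<in> V) else None)" for x
  have uniq: "y = y'" if "(x, y) \<in> V" "(x, y') \<in> V" for x y y'
    using complex_vec.subspace_diff[OF V that] trivial[of "y - y'"] by simp
  have the: "(THE y. (x, y) \<in> V) = y" if "(x, y) \<in> V" for x y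
    using that uniq by blast
  have X_iff: "X x = Some y \<longleftrightarrow> (x, y) \<in> V" for x y
    using the by (auto simp: X_def)
  have "linear_op X"
  proof (rule linear_opI)
    show "X 0 = Some 0"
      unfolding X_iff using complex_vec.subspace_0[OF V] by (simp add: zero_prod_def)
    show "X (x + x') = Some (y + y')" if "X x = Some y" "X x' = Some y'" for x x' y y'
      using complex_vec.subspace_add[OF V that[unfolded X_iff]] by (simp add: X_iff)
    show "X (c *\<^sub>C x) = Some (c *\<^sub>C y)" if "X x = Some y" for c x y
      using complex_vec.subspace_scale[OF V that[unfolded X_iff], of c] by (simp add: X_iff scaleC_prod_def)
  qed
  moreover have "{(x, y). X x = Some y} = V"
    by (auto simp: X_iff)
  ultimately have "closed_op X"
    using \<open>closed V\<close> by (simp add: closed_op_def)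
  moreover have "V = graph_I_op X"
    by (auto simp: mem_graph_I_op_iff X_iff)
  ultimately show ?thesis
    by blast
qed

lemma graph_op_I_exists:
  fixes V :: "('a::complex_banach \<times> 'b::complex_banach) set"
  assumes "closed V" and V: "csubspace V" and trivial: "\<And>f. (f, 0) \<in> V \<Longrightarrow> f = 0"
  shows "\<exists>Y. closed_op Y \<and> V = graph_op_I Y"
proof -
  have "\<exists>Y. closed_op Y \<and> {(y, x). (x, y) \<in> V} = graph_I_op Y"
  proof (rule graph_I_op_exists)
    have "{(y, x). (x, y) \<in> V} = (\<lambda>p. (snd p, fst p)) -` V"
      by auto
    then show "closed {(y, x). (x, y) \<in> V}"
      using \<open>closed V\<close> by (simp add: closed_vimage continuous_intros)
    show "csubspace {(y, x). (x, y) \<in> V}"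
    proof (rule csubspaceI)
      show "0 \<in> {(y, x). (x, y) \<in> V}"
        using complex_vec.subspace_0[OF V] by (simp add: zero_prod_def)
      show "p + q \<in> {(y, x). (x, y) \<in> V}" if "p \<in> {(y, x). (x, y) \<in> V}" "q \<in> {(y, x). (x, y) \<in> V}" for p q
        using that complex_vec.subspace_add[OF V, of "(snd p, fst p)" "(snd q, fst q)"] by (auto simp: case_prod_beta)
      show "c *\<^sub>C p \<in> {(y, x). (x, y) \<in> V}" if "p \<in> {(y, x). (x, y) \<in> V}" for c p
        using that complex_vec.subspace_scale[OF V, of "(snd p, fst p)" c] by (auto simp: case_prod_beta scaleC_prod_def)
    qed
  qed (use trivial in auto)
  then obtain Y where Y: "closed_op Y" "{(y, x). (x, y) \<in> V} = graph_I_op Y"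
    by blast
  have "(x, y) \<in> V \<longleftrightarrow> (x, y) \<in> graph_op_I Y" for x y
    using Y(2) by (auto simp: mem_graph_op_I_iff mem_graph_I_op_iff[symmetric])
  then have "V = graph_op_I Y"
    by auto
  with Y(1) show ?thesis
    by blast
qed

lemma graph_op_inverse:
  assumes "V = graph_I_op X" "V = graph_op_I Y"
  shows "op_injective X \<and> op_inv X = Y"
proof -
  have iff: "X x = Some y \<longleftrightarrow> Y y = Some x" for x y
    using assms by (metis mem_graph_I_op_iff mem_graph_op_I_iff)
  have "op_injective X"
    unfolding op_injective_def by (rule inj_onI) (metis domD iff option.inject)
  moreover have "op_inv X = Y"
  proof
    fix y
    have "op_inv X y = Some x \<longleftrightarrow> Y y = Some x" for x
      unfolding op_inv_eq_Some_iff iff by auto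
    then show "op_inv X y = Y y"
      by (metis not_Some_eq)
  qed
  ultimately show ?thesis
    by blast
qed

theorem proposition6p3:
  fixes A :: "'h::complex_hilbert \<rightharpoonup> 'h"
    and r s :: real
    and jr :: "'h \<Rightarrow> 'hr::complex_hilbert"
    and js :: "'h \<Rightarrow> 'hs::complex_hilbert"
    and B :: "'u::complex_hilbert \<Rightarrow> 'hr"
    and C :: "'h \<rightharpoonup> 'y::complex_hilbert"
    and V0p V0m :: "('hr \<times> 'hs) set"
  assumes separable: "\<exists>D :: 'h set. countable D \<and> closure D = UNIV"
    and A: "quasi_sectorial A"
    and rs: "0 \<le> r" "0 \<le> s" "r + s < 1"
    and jr: "negative_space (Lam A) r jr"
    and js: "negative_space (Lam_star A) s js"
    and B: "bounded_clinear B"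
    and C: "bounded_on_scale (op_powr (Lam_star A) s) C"
    and T0: "{z. Re z = 0} \<subseteq> resolvent_set (hamiltonian A r s jr js B C)"
    and V0: "spectral_subspaces (hamiltonian A r s jr js B C) V0p V0m"
  shows "(B_kernel A r s jr js B = {0} \<longrightarrow>
            (\<exists>X0p X0m. closed_op X0p \<and> closed_op X0m \<and>
              V0p = graph_I_op X0p \<and> V0m = graph_I_op X0m)) \<and>
         (C_kernel A r jr C = {0} \<longrightarrow>
            (\<exists>Y0p Y0m. closed_op Y0p \<and> closed_op Y0m \<and>
              V0p = graph_op_I Y0p \<and> V0m = graph_op_I Y0m)) \<and>
         (B_kernel A r s jr js B = {0} \<and> C_kernel A r jr C = {0} \<longrightarrow>
            (\<forall>X0p X0m Y0p Y0m.
              V0p = graph_I_op X0p \<and> V0m = graph_I_op X0m \<and>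
              V0p = graph_op_I Y0p \<and> V0m = graph_op_I Y0m \<longrightarrow>
              op_injective X0p \<and> op_injective X0m \<and> op_inv X0p = Y0p \<and> op_inv X0m = Y0m))"
proof -
  interpret closed_dense_pair A
    by (rule closed_dense.closed_dense_pair[OF quasi_sectorial_closed_dense[OF A]])
  interpret dual: closed_dense_pair "adj A"
    by (rule closed_dense_pair_adj)
  obtain Jr where Jr: "neg_scale A r jr Jr"
    using neg_scale_exists[OF jr] rs by auto
  obtain Js where Js: "neg_scale (adj A) s js Js"
    using dual.neg_scale_exists[of s js] js rs by (auto simp: Lam_star_eq)
  interpret hamiltonian_setting A r s jr js B C Jr Js
    by (intro hamiltonian_setting.intro hamiltonian_setting_axioms.intro closed_dense_pair_axioms Jr Js B C)
      (use rs in auto)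
  have V: "closed V0p" "closed V0m" "csubspace V0p" "csubspace V0m"
    using V0 by (auto simp: spectral_subspaces_def invariant_subspace_def)
  \<comment> \<open>For \<open>v\<close> with a vanishing component this is the hypothesis of
    \<open>B_kernel_memI\<close> and \<open>C_kernel_memI\<close>, for every imaginary
    \<mu>.\<close>
  have neutral: "\<exists>p. T p = Some (v + \<mu> *\<^sub>C p) \<and> form p v = 0" if "v \<in> V0p \<or> v \<in> V0m" "Re \<mu> = 0" for v \<mu>
  proof -
    have "0 \<in> resolvent_set T"
      using T0 by auto
    from skew_form.neutral_on_spectral_subspace[OF skew_form dense_dom_hamiltonian this V0 that]
    show ?thesis
      by blast
  qed
  have "g = 0" if "B_kernel A r s jr js B = {0}" "(0, g) \<in> V0p \<or> (0, g) \<in> V0m" for g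
    using B_kernel_memI[OF neutral[OF that(2)]] that(1) by simp
  then have 1: "B_kernel A r s jr js B = {0} \<longrightarrow>
      (\<exists>X0p X0m. closed_op X0p \<and> closed_op X0m \<and> V0p = graph_I_op X0p \<and> V0m = graph_I_op X0m)"
    using graph_I_op_exists[OF V(1,3)] graph_I_op_exists[OF V(2,4)] by meson
  have "f = 0" if "C_kernel A r jr C = {0}" "(f, 0) \<in> V0p \<or> (f, 0) \<in> V0m" for f
    using C_kernel_memI[OF neutral[OF that(2)]] that(1) by simp
  then have 2: "C_kernel A r jr C = {0} \<longrightarrow>
      (\<exists>Y0p Y0m. closed_op Y0p \<and> closed_op Y0m \<and> V0p = graph_op_I Y0p \<and> V0m = graph_op_I Y0m)"
    using graph_op_I_exists[OF V(1,3)] graph_op_I_exists[OF V(2,4)] by meson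
  have 3: "op_injective X0p \<and> op_injective X0m \<and> op_inv X0p = Y0p \<and> op_inv X0m = Y0m"
    if "V0p = graph_I_op X0p" "V0m = graph_I_op X0m" "V0p = graph_op_I Y0p" "V0m = graph_op_I Y0m"
    for X0p X0m Y0p Y0m
    using graph_op_inverse[OF that(1,3)] graph_op_inverse[OF that(2,4)] by simp
  show ?thesis
    by (intro conjI[OF 1 conjI[OF 2]] allI impI, elim conjE) (rule 3)
qed

end
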